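(* Let $(\Gamma_k)_{k\ge 0}$ be a tower of strongly Birkhoff Galois structures over a Barr exact category $\mathcal{C}_0$, fix $n\ge 0$, and write $\Gamma=\Gamma_n$, $\mathcal{C}=\mathcal{C}_n$, $\mathcal{B}=\mathcal{B}_n$. A double extension in $\mathcal{C}$ is a double covering (i.e. a $\Gamma_{n+1}$-covering) if and only if it is a symmetric double covering with respect to $\Gamma$.
   Context: **Higher extensions.** $\mathcal{C}_0$ is a Barr exact category and $\mathcal{E}_1$ is the class of regular epimorphisms in $\mathcal{C}_0$. For a category $\mathcal{Y}$, a morphism $\alpha\colon f_A\to f_B$ in the arrow category $\mathsf{Arr}(\mathcal{Y})$, from $f_A\colon A_\top\to A_\perp$ to $f_B\colon B_\top\to B_\perp$, is a pair $(\alpha_\top\colon A_\top\to B_\top,\ \alpha_\perp\colon A_\perp\to B_\perp)$ with $f_B\circ\alpha_\top=\alpha_\perp\circ f_A$. For a class $\mathcal{E}$ of morphisms of $\mathcal{Y}$, this square is an $\mathcal{E}$-double extension when $\alpha_\top,\alpha_\perp,f_A,f_B$, the projections of the pullback $A_\perp\times_{B_\perp}B_\top$, and the comparison map $A_\top\to A_\perp\times_{B_\perp}B_\top$ are all in $\mathcal{E}$. Inductively, for $m\ge1$, $\mathcal{C}_m=\mathsf{Ext}^m(\mathcal{C}_0)$ is the full subcategory of $\mathsf{Arr}^m(\mathcal{C}_0)$ whose objects are the elements of $\mathcal{E}_m$ (the $m$-fold extensions), and $\mathcal{E}_{m+1}$ is the class of morphisms of $\mathcal{C}_m$ whose underlying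 square in $\mathcal{C}_{m-1}$ is an $\mathcal{E}_m$-double extension (the $(m+1)$-fold extensions). **Galois structures.** A Galois structure $\Gamma=(\mathcal{Y},\mathcal{X},L,\mathrm{I},\eta,\epsilon,\mathcal{E})$ consists of a category $\mathcal{Y}$, a class $\mathcal{E}$ of regular epimorphisms of $\mathcal{Y}$ (the extensions), and a full replete subcategory $\mathrm{I}\colon\mathcal{X}\to\mathcal{Y}$ with left adjoint $L$, unit $\eta$ with every component in $\mathcal{E}$, and counit $\epsilon$, such that: $\mathcal{E}$ contains all isomorphisms and is closed under composition; $L$ sends extensions to extensions; pullbacks along extensions exist and a pullback of an extension is an extension; every extension $e\colon Q\to B$ is of effective $\mathcal{E}$-descent, i.e. the pullback functor $e^*\colon\mathsf{Ext}(B)\to\mathsf{Ext}(Q)$ is monadic, where $\mathsf{Ext}(B)$ is the full subcategory of the slice over $B$ on the extensions. $\Gamma$ is strongly $\mathcal{E}$-Birkhoff if for every extension $f\colon A\to B$ the reflection square $(\eta_A,\eta_B)\colon f\to \mathrm{I}L(f)$ is an $\mathcal{E}$-double extension. A trivial $\Gamma$-covering is an extension whose reflection square is a pullback. A $\Gamma$-covering is an extension $c\colon A\to B$ for which there is an extension $e\colon Q\to B$ such that the pullback of $c$ along $e$ is a trivial $\Gamma$-covering. **Tower.** A tower of strongly Birkhoff Galois structures is a sequence of Galois structures $\Gamma_k=(\mathcal{C}_k,\mathcal{B}_k,F_k,\mathrm{I}_k,\eta^k,\epsilon^k,\mathcal{E}_{k+1})$, $k\ge0$, each strongly $\mathcal{E}_{k+1}$-Birkhoff,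 where for $k\ge 1$ the category $\mathcal{B}_k=\mathsf{Cov}(\mathcal{C}_{k-1})$ is the full subcategory of $\mathcal{C}_k=\mathsf{Ext}(\mathcal{C}_{k-1})$ determined by the $\Gamma_{k-1}$-coverings. **At level $n$.** A double extension in $\mathcal{C}=\mathcal{C}_n$ is an $\mathcal{E}_{n+1}$-double extension, i.e. an $(n+2)$-fold extension; a double covering is a $\Gamma_{n+1}$-covering. A $3$-cubical extension in $\mathcal{C}$ is the underlying commutative cube in $\mathcal{C}$ of an $(n+3)$-fold extension. It is a discrete fibration when it is a limit cube: the cone out of its initial vertex is a limit of the diagram formed by the rest of the cube. Such a cube may be regarded, in any of its three directions, as an arrow between double extensions in $\mathcal{C}$; it is then called a discrete fibration from its domain to its codomain. A double extension $\tau$ in $\mathcal{C}$ is a symmetrically trivial double covering (with respect to $\Gamma$) when a discrete fibration $\tau\to\beta$ exists whose codomain $\beta$ lies in $\mathcal{B}$ (i.e. all four vertices of the square $\beta$ lie in $\mathcal{B}$). A double extension $\alpha$ in $\mathcal{C}$ is a symmetric double covering (with respect to $\Gamma$) when a discrete fibration $\tau\to\alpha$ exists whose domain $\tau$ is a symmetrically trivial double covering. *)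

theory Defs
  imports Main
begin

section \<open>Categories, functors, adjunctions\<close>

record ('o, 'm) cat =
  Ob   :: "'o set"
  Mor  :: "'m set"
  Dom  :: "'m \<Rightarrow> 'o"
  Cod  :: "'m \<Rightarrow> 'o"
  Id   :: "'o \<Rightarrow> 'm"
  Comp :: "'m \<Rightarrow> 'm \<Rightarrow> 'm"  (infixl \<open>\<cdot>\<index>\<close> 70)

definition hom :: "('o, 'm) cat \<Rightarrow> 'o \<Rightarrow> 'o \<Rightarrow> 'm set" where
  "hom C a b = {f \<in> Mor C. Dom C f = a \<and> Cod C f = b}"

definition category :: "('o, 'm) cat \<Rightarrow> bool" where
  "category C \<longleftrightarrow>
     (\<forall>f \<in> Mor C. Dom C f \<in> Ob C \<and> Cod C f \<in> Ob C) \<and>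
     (\<forall>a \<in> Ob C. Id C a \<in> hom C a a) \<and>
     (\<forall>f \<in> Mor C. \<forall>g \<in> Mor C. Cod C f = Dom C g \<longrightarrow>
        g \<cdot>\<^bsub>C\<^esub> f \<in> hom C (Dom C f) (Cod C g)) \<and>
     (\<forall>f \<in> Mor C. f \<cdot>\<^bsub>C\<^esub> Id C (Dom C f) = f \<and> Id C (Cod C f) \<cdot>\<^bsub>C\<^esub> f = f) \<and>
     (\<forall>f \<in> Mor C. \<forall>g \<in> Mor C. \<forall>h \<in> Mor C. Cod C f = Dom C g \<longrightarrow> Cod C g = Dom C h \<longrightarrow>
        h \<cdot>\<^bsub>C\<^esub> (g \<cdot>\<^bsub>C\<^esub> f) = (h \<cdot>\<^bsub>C\<^esub> g) \<cdot>\<^bsub>C\<^esub> f)"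

definition iso :: "('o, 'm) cat \<Rightarrow> 'm \<Rightarrow> bool" where
  "iso C f \<longleftrightarrow> f \<in> Mor C \<and>
     (\<exists>g \<in> hom C (Cod C f) (Dom C f).
        g \<cdot>\<^bsub>C\<^esub> f = Id C (Dom C f) \<and> f \<cdot>\<^bsub>C\<^esub> g = Id C (Cod C f))"

definition full_sub :: "('o, 'm) cat \<Rightarrow> 'o set \<Rightarrow> ('o, 'm) cat" where
  "full_sub C S = C\<lparr> Ob := Ob C \<inter> S, Mor := {f \<in> Mor C. Dom C f \<in> S \<and> Cod C f \<in> S} \<rparr>"

definition replete :: "('o, 'm) cat \<Rightarrow> 'o set \<Rightarrow> bool" where
  "replete C S \<longleftrightarrow> (\<forall>f. iso C f \<longrightarrow> Dom C f \<in> S \<longrightarrow> Cod C f \<in> S)"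

record ('o, 'm, 'p, 'n) funct =
  fob  :: "'o \<Rightarrow> 'p"
  fmor :: "'m \<Rightarrow> 'n"

definition is_functor ::
  "('o, 'm) cat \<Rightarrow> ('p, 'n) cat \<Rightarrow> ('o, 'm, 'p, 'n) funct \<Rightarrow> bool" where
  "is_functor C D F \<longleftrightarrow> category C \<and> category D \<and>
     (\<forall>a \<in> Ob C. fob F a \<in> Ob D \<and> fmor F (Id C a) = Id D (fob F a)) \<and>
     (\<forall>f \<in> Mor C. fmor F f \<in> hom D (fob F (Dom C f)) (fob F (Cod C f))) \<and>
     (\<forall>f \<in> Mor C. \<forall>g \<in> Mor C. Cod C f = Dom C g \<longrightarrow>
        fmor F (g \<cdot>\<^bsub>C\<^esub> f) = fmor F g \<cdot>\<^bsub>D\<^esub> fmor F f)"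

definition id_functor :: "('o, 'm, 'o, 'm) funct" where
  "id_functor = \<lparr> fob = (\<lambda>a. a), fmor = (\<lambda>f. f) \<rparr>"

definition comp_functor ::
  "('p, 'n, 'q, 'k) funct \<Rightarrow> ('o, 'm, 'p, 'n) funct \<Rightarrow> ('o, 'm, 'q, 'k) funct" where
  "comp_functor G F = \<lparr> fob = (\<lambda>a. fob G (fob F a)), fmor = (\<lambda>f. fmor G (fmor F f)) \<rparr>"

definition nat_trans :: "('o, 'm) cat \<Rightarrow> ('p, 'n) cat \<Rightarrow>
    ('o, 'm, 'p, 'n) funct \<Rightarrow> ('o, 'm, 'p, 'n) funct \<Rightarrow> ('o \<Rightarrow> 'n) \<Rightarrow> bool" where
  "nat_trans C D F G \<theta> \<longleftrightarrow>
     (\<forall>a \<in> Ob C. \<theta> a \<in> hom D (fob F a) (fob G a)) \<and>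
     (\<forall>f \<in> Mor C. \<theta> (Cod C f) \<cdot>\<^bsub>D\<^esub> fmor F f = fmor G f \<cdot>\<^bsub>D\<^esub> \<theta> (Dom C f))"

definition nat_iso :: "('o, 'm) cat \<Rightarrow> ('p, 'n) cat \<Rightarrow>
    ('o, 'm, 'p, 'n) funct \<Rightarrow> ('o, 'm, 'p, 'n) funct \<Rightarrow> ('o \<Rightarrow> 'n) \<Rightarrow> bool" where
  "nat_iso C D F G \<theta> \<longleftrightarrow> nat_trans C D F G \<theta> \<and> (\<forall>a \<in> Ob C. iso D (\<theta> a))"

definition equivalence ::
  "('o, 'm) cat \<Rightarrow> ('p, 'n) cat \<Rightarrow> ('o, 'm, 'p, 'n) funct \<Rightarrow> bool" where
  "equivalence C D F \<longleftrightarrow> is_functor C D F \<and>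
     (\<exists>G \<theta> \<theta>'. is_functor D C G \<and>
        nat_iso C C id_functor (comp_functor G F) \<theta> \<and>
        nat_iso D D (comp_functor F G) id_functor \<theta>')"

text \<open>The functor \<open>F : C \<rightarrow> D\<close> is left adjoint to \<open>G : D \<rightarrow> C\<close>, with unit \<open>\<eta>\<close> and counit \<open>\<epsilon>\<close>.\<close>

definition adjunction :: "('o, 'm) cat \<Rightarrow> ('p, 'n) cat \<Rightarrow>
    ('o, 'm, 'p, 'n) funct \<Rightarrow> ('p, 'n, 'o, 'm) funct \<Rightarrow> ('o \<Rightarrow> 'm) \<Rightarrow> ('p \<Rightarrow> 'n) \<Rightarrow> bool" where
  "adjunction C D F G \<eta> \<epsilon> \<longleftrightarrow>
     is_functor C D F \<and> is_functor D C G \<and>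
     nat_trans C C id_functor (comp_functor G F) \<eta> \<and>
     nat_trans D D (comp_functor F G) id_functor \<epsilon> \<and>
     (\<forall>a \<in> Ob C. \<epsilon> (fob F a) \<cdot>\<^bsub>D\<^esub> fmor F (\<eta> a) = Id D (fob F a)) \<and>
     (\<forall>b \<in> Ob D. fmor G (\<epsilon> b) \<cdot>\<^bsub>C\<^esub> \<eta> (fob G b) = Id C (fob G b))"

section \<open>Monadic functors\<close>

text \<open>The Eilenberg--Moore category of the monad with endofunctor \<open>T\<close>, unit \<open>\<eta>\<close> and
  multiplication \<open>\<mu>\<close>. An algebra is a pair (carrier, structure map); a morphism is recorded
  together with its domain and codomain.\<close>

definition em_cat :: "('o, 'm) cat \<Rightarrow> ('o, 'm, 'o, 'm) funct \<Rightarrow> ('o \<Rightarrow> 'm) \<Rightarrow> ('o \<Rightarrow> 'm) \<Rightarrow>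
    ('o \<times> 'm, ('o \<times> 'm) \<times> ('o \<times> 'm) \<times> 'm) cat" where
  "em_cat C T \<eta> \<mu> =
     (let Alg = {(a, s). a \<in> Ob C \<and> s \<in> hom C (fob T a) a \<and>
                   s \<cdot>\<^bsub>C\<^esub> \<eta> a = Id C a \<and> s \<cdot>\<^bsub>C\<^esub> fmor T s = s \<cdot>\<^bsub>C\<^esub> \<mu> a}
      in \<lparr> Ob = Alg,
           Mor = {(x, y, h). x \<in> Alg \<and> y \<in> Alg \<and> h \<in> hom C (fst x) (fst y) \<and>
                    h \<cdot>\<^bsub>C\<^esub> snd x = snd y \<cdot>\<^bsub>C\<^esub> fmor T h},
           Dom = (\<lambda>(x, y, h). x),
           Cod = (\<lambda>(x, y, h). y),
           Id = (\<lambda>x. (x, x, Id C (fst x))),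
           Comp = (\<lambda>(y', z, k) (x, y, h). (x, z, k \<cdot>\<^bsub>C\<^esub> h)) \<rparr>)"

definition em_comparison :: "('p, 'n) cat \<Rightarrow> ('p, 'n, 'o, 'm) funct \<Rightarrow> ('p \<Rightarrow> 'n) \<Rightarrow>
    ('p, 'n, 'o \<times> 'm, ('o \<times> 'm) \<times> ('o \<times> 'm) \<times> 'm) funct" where
  "em_comparison D G \<epsilon> =
     (let K = (\<lambda>b. (fob G b, fmor G (\<epsilon> b)))
      in \<lparr> fob = K, fmor = (\<lambda>f. (K (Dom D f), K (Cod D f), fmor G f)) \<rparr>)"

definition monadic ::
  "('p, 'n) cat \<Rightarrow> ('o, 'm) cat \<Rightarrow> ('p, 'n, 'o, 'm) funct \<Rightarrow> bool" where
  "monadic D C G \<longleftrightarrow>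
     (\<exists>F \<eta> \<epsilon>. adjunction C D F G \<eta> \<epsilon> \<and>
        equivalence D
          (em_cat C (comp_functor G F) \<eta> (\<lambda>a. fmor G (\<epsilon> (fob F a))))
          (em_comparison D G \<epsilon>))"

section \<open>Limits, regular epimorphisms, Barr exact categories\<close>

text \<open>Diagrams are indexed by directed graphs: \<open>N\<close> is the set of nodes, \<open>X\<close> assigns an
  object to each node, and \<open>(u, f, v) \<in> K\<close> is an edge from \<open>u\<close> to \<open>v\<close> labelled by the
  morphism \<open>f\<close>.\<close>

definition diagram ::
  "('o, 'm) cat \<Rightarrow> 'i set \<Rightarrow> ('i \<Rightarrow> 'o) \<Rightarrow> ('i \<times> 'm \<times> 'i) set \<Rightarrow> bool" where
  "diagram C N X K \<longleftrightarrow> (\<forall>v \<in> N. X v \<in> Ob C) \<and>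
     (\<forall>(u, f, v) \<in> K. u \<in> N \<and> v \<in> N \<and> f \<in> hom C (X u) (X v))"

definition cone ::
  "('o, 'm) cat \<Rightarrow> 'i set \<Rightarrow> ('i \<Rightarrow> 'o) \<Rightarrow> ('i \<times> 'm \<times> 'i) set \<Rightarrow> 'o \<Rightarrow> ('i \<Rightarrow> 'm) \<Rightarrow> bool" where
  "cone C N X K l \<pi> \<longleftrightarrow> l \<in> Ob C \<and> (\<forall>v \<in> N. \<pi> v \<in> hom C l (X v)) \<and>
     (\<forall>(u, f, v) \<in> K. f \<cdot>\<^bsub>C\<^esub> \<pi> u = \<pi> v)"

definition is_limit ::
  "('o, 'm) cat \<Rightarrow> 'i set \<Rightarrow> ('i \<Rightarrow> 'o) \<Rightarrow> ('i \<times> 'm \<times> 'i) set \<Rightarrow> 'o \<Rightarrow> ('i \<Rightarrow> 'm) \<Rightarrow> bool" where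
  "is_limit C N X K l \<pi> \<longleftrightarrow> diagram C N X K \<and> cone C N X K l \<pi> \<and>
     (\<forall>z \<zeta>. cone C N X K z \<zeta> \<longrightarrow>
        (\<exists>!h. h \<in> hom C z l \<and> (\<forall>v \<in> N. \<pi> v \<cdot>\<^bsub>C\<^esub> h = \<zeta> v)))"

definition finitely_complete :: "('o, 'm) cat \<Rightarrow> bool" where
  "finitely_complete C \<longleftrightarrow>
     (\<forall>(N :: nat set) X K. finite N \<longrightarrow> finite K \<longrightarrow> diagram C N X K \<longrightarrow>
        (\<exists>l \<pi>. is_limit C N X K l \<pi>))"

text \<open>\<open>is_pullback C f g P p q\<close>: the square \<open>f \<cdot> p = g \<cdot> q\<close> with \<open>p : P \<rightarrow> dom f\<close> and
  \<open>q : P \<rightarrow> dom g\<close> is a pullback. Thus \<open>p\<close> is the pullback of \<open>g\<close> along \<open>f\<close>.\<close>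

definition is_pullback :: "('o, 'm) cat \<Rightarrow> 'm \<Rightarrow> 'm \<Rightarrow> 'o \<Rightarrow> 'm \<Rightarrow> 'm \<Rightarrow> bool" where
  "is_pullback C f g P p q \<longleftrightarrow>
     f \<in> Mor C \<and> g \<in> Mor C \<and> Cod C f = Cod C g \<and>
     p \<in> hom C P (Dom C f) \<and> q \<in> hom C P (Dom C g) \<and> f \<cdot>\<^bsub>C\<^esub> p = g \<cdot>\<^bsub>C\<^esub> q \<and>
     (\<forall>z \<in> Ob C. \<forall>u \<in> hom C z (Dom C f). \<forall>v \<in> hom C z (Dom C g). f \<cdot>\<^bsub>C\<^esub> u = g \<cdot>\<^bsub>C\<^esub> v \<longrightarrow>
        (\<exists>!h. h \<in> hom C z P \<and> p \<cdot>\<^bsub>C\<^esub> h = u \<and> q \<cdot>\<^bsub>C\<^esub> h = v))"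

definition is_coequalizer :: "('o, 'm) cat \<Rightarrow> 'm \<Rightarrow> 'm \<Rightarrow> 'm \<Rightarrow> bool" where
  "is_coequalizer C u v e \<longleftrightarrow>
     u \<in> Mor C \<and> v \<in> Mor C \<and> e \<in> Mor C \<and>
     Dom C u = Dom C v \<and> Cod C u = Dom C e \<and> Cod C v = Dom C e \<and> e \<cdot>\<^bsub>C\<^esub> u = e \<cdot>\<^bsub>C\<^esub> v \<and>
     (\<forall>k \<in> Mor C. Dom C k = Dom C e \<longrightarrow> k \<cdot>\<^bsub>C\<^esub> u = k \<cdot>\<^bsub>C\<^esub> v \<longrightarrow>
        (\<exists>!h. h \<in> hom C (Cod C e) (Cod C k) \<and> h \<cdot>\<^bsub>C\<^esub> e = k))"

definition regular_epi :: "('o, 'm) cat \<Rightarrow> 'm \<Rightarrow> bool" where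
  "regular_epi C e \<longleftrightarrow> (\<exists>u v. is_coequalizer C u v e)"

definition regular_category :: "('o, 'm) cat \<Rightarrow> bool" where
  "regular_category C \<longleftrightarrow> category C \<and> finitely_complete C \<and>
     (\<forall>f P p q. is_pullback C f f P p q \<longrightarrow> (\<exists>e. is_coequalizer C p q e)) \<and>
     (\<forall>f e P p q. regular_epi C e \<longrightarrow> is_pullback C f e P p q \<longrightarrow> regular_epi C p)"

definition internal_equivalence_relation ::
  "('o, 'm) cat \<Rightarrow> 'o \<Rightarrow> 'o \<Rightarrow> 'm \<Rightarrow> 'm \<Rightarrow> bool" where
  "internal_equivalence_relation C a R r s \<longleftrightarrow>
     a \<in> Ob C \<and> R \<in> Ob C \<and> r \<in> hom C R a \<and> s \<in> hom C R a \<and>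
     (\<forall>z \<in> Ob C. \<forall>u \<in> hom C z R. \<forall>v \<in> hom C z R.
        r \<cdot>\<^bsub>C\<^esub> u = r \<cdot>\<^bsub>C\<^esub> v \<longrightarrow> s \<cdot>\<^bsub>C\<^esub> u = s \<cdot>\<^bsub>C\<^esub> v \<longrightarrow> u = v) \<and>
     (\<exists>d \<in> hom C a R. r \<cdot>\<^bsub>C\<^esub> d = Id C a \<and> s \<cdot>\<^bsub>C\<^esub> d = Id C a) \<and>
     (\<exists>t \<in> hom C R R. r \<cdot>\<^bsub>C\<^esub> t = s \<and> s \<cdot>\<^bsub>C\<^esub> t = r) \<and>
     (\<forall>P p q. is_pullback C s r P p q \<longrightarrow>
        (\<exists>t \<in> hom C P R. r \<cdot>\<^bsub>C\<^esub> t = r \<cdot>\<^bsub>C\<^esub> p \<and> s \<cdot>\<^bsub>C\<^esub> t = s \<cdot>\<^bsub>C\<^esub> q))"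

definition barr_exact :: "('o, 'm) cat \<Rightarrow> bool" where
  "barr_exact C \<longleftrightarrow> regular_category C \<and>
     (\<forall>a R r s. internal_equivalence_relation C a R r s \<longrightarrow> (\<exists>f. is_pullback C f f R r s))"

section \<open>Extensions and higher extensions\<close>

definition commutative_square :: "('o, 'm) cat \<Rightarrow> 'm \<Rightarrow> 'm \<Rightarrow> 'm \<Rightarrow> 'm \<Rightarrow> bool" where
  "commutative_square C f g t b \<longleftrightarrow> f \<in> Mor C \<and> g \<in> Mor C \<and>
     t \<in> hom C (Dom C f) (Dom C g) \<and> b \<in> hom C (Cod C f) (Cod C g) \<and>
     g \<cdot>\<^bsub>C\<^esub> t = b \<cdot>\<^bsub>C\<^esub> f"

text \<open>The square \<open>(t, b) : f \<rightarrow> g\<close> of the arrow category, seen as a square in \<open>C\<close>.\<close>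

definition double_extension ::
  "('o, 'm) cat \<Rightarrow> 'm set \<Rightarrow> 'm \<Rightarrow> 'm \<Rightarrow> 'm \<Rightarrow> 'm \<Rightarrow> bool" where
  "double_extension C E f g t b \<longleftrightarrow> commutative_square C f g t b \<and>
     t \<in> E \<and> b \<in> E \<and> f \<in> E \<and> g \<in> E \<and>
     (\<exists>P p q c. is_pullback C b g P p q \<and> p \<in> E \<and> q \<in> E \<and>
        c \<in> hom C (Dom C f) P \<and> p \<cdot>\<^bsub>C\<^esub> c = f \<and> q \<cdot>\<^bsub>C\<^esub> c = t \<and> c \<in> E)"

text \<open>All iterated arrow categories of a category with objects in \<open>'o\<close> and morphisms in \<open>'m\<close>
  live in one type, so that the level can be a variable. The objects of an arrow category are the
  morphisms of the category below; \<open>Square f g t b\<close> is the morphism \<open>(t, b) : f \<rightarrow> g\<close>.\<close>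

datatype ('o, 'm) cell =
    Obj0 'o
  | Mor0 (the_mor0: 'm)
  | Square (sq_dom: "('o, 'm) cell") (sq_cod: "('o, 'm) cell")
           (sq_top: "('o, 'm) cell") (sq_bot: "('o, 'm) cell")

type_synonym ('o, 'm) cell_cat = "(('o, 'm) cell, ('o, 'm) cell) cat"

definition base_cat :: "('o, 'm) cat \<Rightarrow> ('o, 'm) cell_cat" where
  "base_cat C =
     \<lparr> Ob = Obj0 ` Ob C,
       Mor = Mor0 ` Mor C,
       Dom = (\<lambda>f. Obj0 (Dom C (the_mor0 f))),
       Cod = (\<lambda>f. Obj0 (Cod C (the_mor0 f))),
       Id = (\<lambda>a. case a of Obj0 x \<Rightarrow> Mor0 (Id C x) | _ \<Rightarrow> undefined),
       Comp = (\<lambda>g f. Mor0 (the_mor0 g \<cdot>\<^bsub>C\<^esub> the_mor0 f)) \<rparr>"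

definition arrow_cat :: "('o, 'm) cell_cat \<Rightarrow> ('o, 'm) cell_cat" where
  "arrow_cat C =
     \<lparr> Ob = Mor C,
       Mor = {Square f g t b | f g t b. commutative_square C f g t b},
       Dom = sq_dom,
       Cod = sq_cod,
       Id = (\<lambda>f. Square f f (Id C (Dom C f)) (Id C (Cod C f))),
       Comp = (\<lambda>\<beta> \<alpha>. Square (sq_dom \<alpha>) (sq_cod \<beta>)
                 (sq_top \<beta> \<cdot>\<^bsub>C\<^esub> sq_top \<alpha>) (sq_bot \<beta> \<cdot>\<^bsub>C\<^esub> sq_bot \<alpha>)) \<rparr>"

definition iterated_arrow_cat :: "('o, 'm) cat \<Rightarrow> nat \<Rightarrow> ('o, 'm) cell_cat" where
  "iterated_arrow_cat C m = (arrow_cat ^^ m) (base_cat C)"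

text \<open>\<open>higher_ext C m\<close> is the class of \<open>m\<close>-fold extensions; the \<open>0\<close>-fold extensions are
  by convention the objects of \<open>C\<close>, so that \<open>ext_cat C m\<close> below is uniform in \<open>m\<close>.\<close>

fun higher_ext :: "('o, 'm) cat \<Rightarrow> nat \<Rightarrow> ('o, 'm) cell set" where
  "higher_ext C 0 = Ob (base_cat C)"
| "higher_ext C (Suc 0) = {e. regular_epi (base_cat C) e}"
| "higher_ext C (Suc (Suc m)) =
     {\<alpha> \<in> Mor (full_sub (iterated_arrow_cat C (Suc m)) (higher_ext C (Suc m))).
        double_extension (full_sub (iterated_arrow_cat C m) (higher_ext C m)) (higher_ext C (Suc m))
          (sq_dom \<alpha>) (sq_cod \<alpha>) (sq_top \<alpha>) (sq_bot \<alpha>)}"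

definition ext_cat :: "('o, 'm) cat \<Rightarrow> nat \<Rightarrow> ('o, 'm) cell_cat" where
  "ext_cat C m = full_sub (iterated_arrow_cat C m) (higher_ext C m)"

section \<open>Effective descent\<close>

definition slice :: "('o, 'm) cat \<Rightarrow> 'o \<Rightarrow> ('m, 'm \<times> 'm \<times> 'm) cat" where
  "slice C b =
     \<lparr> Ob = {f \<in> Mor C. Cod C f = b},
       Mor = {(f, g, h). f \<in> Mor C \<and> g \<in> Mor C \<and> Cod C f = b \<and> Cod C g = b \<and>
                h \<in> hom C (Dom C f) (Dom C g) \<and> g \<cdot>\<^bsub>C\<^esub> h = f},
       Dom = (\<lambda>(f, g, h). f),
       Cod = (\<lambda>(f, g, h). g),
       Id = (\<lambda>f. (f, f, Id C (Dom C f))),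
       Comp = (\<lambda>(g', k, j) (f, g, h). (f, k, j \<cdot>\<^bsub>C\<^esub> h)) \<rparr>"

definition ext_over :: "('o, 'm) cat \<Rightarrow> 'm set \<Rightarrow> 'o \<Rightarrow> ('m, 'm \<times> 'm \<times> 'm) cat" where
  "ext_over C E b = full_sub (slice C b) E"

text \<open>The pullback functor depends on a choice of pullbacks, and is determined only up to natural
  isomorphism; monadicity does not depend on the choice.\<close>

definition is_pullback_functor :: "('o, 'm) cat \<Rightarrow> 'm set \<Rightarrow> 'm \<Rightarrow>
    ('m, 'm \<times> 'm \<times> 'm, 'm, 'm \<times> 'm \<times> 'm) funct \<Rightarrow> bool" where
  "is_pullback_functor C E e P \<longleftrightarrow>
     is_functor (ext_over C E (Cod C e)) (ext_over C E (Dom C e)) P \<and>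
     (\<exists>\<pi>. (\<forall>f \<in> Ob (ext_over C E (Cod C e)).
              is_pullback C e f (Dom C (fob P f)) (fob P f) (\<pi> f)) \<and>
          (\<forall>(f, g, h) \<in> Mor (ext_over C E (Cod C e)).
              \<pi> g \<cdot>\<^bsub>C\<^esub> snd (snd (fmor P (f, g, h))) = h \<cdot>\<^bsub>C\<^esub> \<pi> f))"

definition effective_descent :: "('o, 'm) cat \<Rightarrow> 'm set \<Rightarrow> 'm \<Rightarrow> bool" where
  "effective_descent C E e \<longleftrightarrow>
     (\<exists>P. is_pullback_functor C E e P \<and>
        monadic (ext_over C E (Cod C e)) (ext_over C E (Dom C e)) P)"

section \<open>Galois structures and coverings\<close>

text \<open>The full replete subcategory is given by its set of objects \<open>Sub\<close>; the inclusion functor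
  acts as the identity and is left implicit.\<close>

record ('o, 'm) galois =
  Cat    :: "('o, 'm) cat"
  Sub    :: "'o set"
  Refl   :: "('o, 'm, 'o, 'm) funct"
  Unit   :: "'o \<Rightarrow> 'm"
  Counit :: "'o \<Rightarrow> 'm"
  Exts   :: "'m set"

definition galois_structure :: "('o, 'm) galois \<Rightarrow> bool" where
  "galois_structure G \<longleftrightarrow>
     (let C = Cat G; E = Exts G in
      category C \<and>
      (\<forall>e \<in> E. regular_epi C e) \<and>
      Sub G \<subseteq> Ob C \<and> replete C (Sub G) \<and>
      adjunction C (full_sub C (Sub G)) (Refl G) id_functor (Unit G) (Counit G) \<and>
      (\<forall>a \<in> Ob C. Unit G a \<in> E) \<and>
      (\<forall>f. iso C f \<longrightarrow> f \<in> E) \<and>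
      (\<forall>f \<in> E. \<forall>g \<in> E. Cod C f = Dom C g \<longrightarrow> g \<cdot>\<^bsub>C\<^esub> f \<in> E) \<and>
      (\<forall>e \<in> E. fmor (Refl G) e \<in> E) \<and>
      (\<forall>e \<in> E. \<forall>f \<in> Mor C. Cod C f = Cod C e \<longrightarrow> (\<exists>P p q. is_pullback C f e P p q)) \<and>
      (\<forall>e \<in> E. \<forall>f P p q. is_pullback C f e P p q \<longrightarrow> p \<in> E) \<and>
      (\<forall>e \<in> E. effective_descent C E e))"

definition strongly_birkhoff :: "('o, 'm) galois \<Rightarrow> bool" where
  "strongly_birkhoff G \<longleftrightarrow>
     (\<forall>f \<in> Exts G. double_extension (Cat G) (Exts G) f (fmor (Refl G) f)
        (Unit G (Dom (Cat G) f)) (Unit G (Cod (Cat G) f)))"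

definition trivial_covering :: "('o, 'm) galois \<Rightarrow> 'm \<Rightarrow> bool" where
  "trivial_covering G f \<longleftrightarrow> f \<in> Exts G \<and>
     is_pullback (Cat G) (Unit G (Cod (Cat G) f)) (fmor (Refl G) f)
       (Dom (Cat G) f) f (Unit G (Dom (Cat G) f))"

definition covering :: "('o, 'm) galois \<Rightarrow> 'm \<Rightarrow> bool" where
  "covering G c \<longleftrightarrow> c \<in> Exts G \<and>
     (\<exists>e \<in> Exts G. Cod (Cat G) e = Cod (Cat G) c \<and>
        (\<exists>P p q. is_pullback (Cat G) e c P p q \<and> trivial_covering G p))"

definition birkhoff_tower ::
  "('o, 'm) cat \<Rightarrow> (nat \<Rightarrow> (('o, 'm) cell, ('o, 'm) cell) galois) \<Rightarrow> bool" where
  "birkhoff_tower C \<Gamma> \<longleftrightarrow>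
     (\<forall>k. Cat (\<Gamma> k) = ext_cat C k \<and> Exts (\<Gamma> k) = higher_ext C (Suc k) \<and>
          galois_structure (\<Gamma> k) \<and> strongly_birkhoff (\<Gamma> k)) \<and>
     (\<forall>k. Sub (\<Gamma> (Suc k)) = {c. covering (\<Gamma> k) c})"

section \<open>Cubes and symmetric double coverings\<close>

text \<open>The underlying cube of a morphism \<open>\<Phi>\<close> of a two-fold arrow category of \<open>C\<close>. Its vertices
  are indexed by \<open>(x, y, z)\<close>: \<open>z\<close> is the direction of \<open>\<Phi>\<close> itself, \<open>y\<close> that of the domain and
  codomain of \<open>\<Phi>\<close> as morphisms between arrows of \<open>C\<close>, and \<open>x\<close> that of these arrows.
  \<open>x_edge \<Phi> y z\<close> is the edge of \<open>C\<close> from \<open>(0, y, z)\<close> to \<open>(1, y, z)\<close>, and similarly for the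
  other directions.\<close>

definition sq_end :: "bool \<Rightarrow> ('o, 'm) cell \<Rightarrow> ('o, 'm) cell" where
  "sq_end i \<alpha> = (if i then sq_cod \<alpha> else sq_dom \<alpha>)"

definition sq_comp :: "bool \<Rightarrow> ('o, 'm) cell \<Rightarrow> ('o, 'm) cell" where
  "sq_comp i \<alpha> = (if i then sq_bot \<alpha> else sq_top \<alpha>)"

definition x_edge :: "('o, 'm) cell \<Rightarrow> bool \<Rightarrow> bool \<Rightarrow> ('o, 'm) cell" where
  "x_edge \<Phi> y z = sq_end y (sq_end z \<Phi>)"

definition y_edge :: "('o, 'm) cell \<Rightarrow> bool \<Rightarrow> bool \<Rightarrow> ('o, 'm) cell" where
  "y_edge \<Phi> x z = sq_comp x (sq_end z \<Phi>)"

definition z_edge :: "('o, 'm) cell \<Rightarrow> bool \<Rightarrow> bool \<Rightarrow> ('o, 'm) cell" where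
  "z_edge \<Phi> x y = sq_comp x (sq_comp y \<Phi>)"

fun cube_vertex ::
  "('o, 'm) cell_cat \<Rightarrow> ('o, 'm) cell \<Rightarrow> bool \<times> bool \<times> bool \<Rightarrow> ('o, 'm) cell" where
  "cube_vertex C \<Phi> (x, y, z) = (if x then Cod C else Dom C) (x_edge \<Phi> y z)"

definition cube_edges ::
  "('o, 'm) cell \<Rightarrow> ((bool \<times> bool \<times> bool) \<times> ('o, 'm) cell \<times> (bool \<times> bool \<times> bool)) set" where
  "cube_edges \<Phi> =
     {((False, y, z), x_edge \<Phi> y z, (True, y, z)) | y z. True} \<union>
     {((x, False, z), y_edge \<Phi> x z, (x, True, z)) | x z. True} \<union>
     {((x, y, False), z_edge \<Phi> x y, (x, y, True)) | x y. True}"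

text \<open>The morphism from the initial vertex of the cube to \<open>(x, y, z)\<close>, composed along the
  directions \<open>x\<close>, \<open>y\<close>, \<open>z\<close> in this order.\<close>

fun initial_cone ::
  "('o, 'm) cell_cat \<Rightarrow> ('o, 'm) cell \<Rightarrow> bool \<times> bool \<times> bool \<Rightarrow> ('o, 'm) cell" where
  "initial_cone C \<Phi> (x, y, z) =
     (let i = Id C (cube_vertex C \<Phi> (False, False, False));
          j = (if x then x_edge \<Phi> False False \<cdot>\<^bsub>C\<^esub> i else i);
          k = (if y then y_edge \<Phi> x False \<cdot>\<^bsub>C\<^esub> j else j)
      in if z then z_edge \<Phi> x y \<cdot>\<^bsub>C\<^esub> k else k)"

definition limit_cube :: "('o, 'm) cell_cat \<Rightarrow> ('o, 'm) cell \<Rightarrow> bool" where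
  "limit_cube C \<Phi> \<longleftrightarrow>
     (let v\<^sub>0 = (False, False, False) in
      is_limit C (UNIV - {v\<^sub>0}) (cube_vertex C \<Phi>) {(u, f, v) \<in> cube_edges \<Phi>. u \<noteq> v\<^sub>0}
        (cube_vertex C \<Phi> v\<^sub>0) (initial_cone C \<Phi>))"

text \<open>The two faces orthogonal to a given direction; \<open>False\<close> selects the one containing the
  initial vertex, which is the domain of the cube seen as an arrow in that direction.\<close>

definition x_face :: "('o, 'm) cell \<Rightarrow> bool \<Rightarrow> ('o, 'm) cell" where
  "x_face \<Phi> x = Square (y_edge \<Phi> x False) (y_edge \<Phi> x True) (z_edge \<Phi> x False) (z_edge \<Phi> x True)"

definition y_face :: "('o, 'm) cell \<Rightarrow> bool \<Rightarrow> ('o, 'm) cell" where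
  "y_face \<Phi> y = Square (x_edge \<Phi> y False) (x_edge \<Phi> y True) (z_edge \<Phi> False y) (z_edge \<Phi> True y)"

definition z_face :: "('o, 'm) cell \<Rightarrow> bool \<Rightarrow> ('o, 'm) cell" where
  "z_face \<Phi> z = Square (x_edge \<Phi> False z) (x_edge \<Phi> True z) (y_edge \<Phi> False z) (y_edge \<Phi> True z)"

definition sq_transpose :: "('o, 'm) cell \<Rightarrow> ('o, 'm) cell" where
  "sq_transpose \<alpha> = Square (sq_top \<alpha>) (sq_bot \<alpha>) (sq_dom \<alpha>) (sq_cod \<alpha>)"

text \<open>A face of a cube is an unoriented square, so it gives rise to two (mutually transposed)
  morphisms between arrows; the domain and the codomain of a cube are always read off with the same
  orientation.\<close>

definition discrete_fibration ::
  "('o, 'm) cat \<Rightarrow> nat \<Rightarrow> ('o, 'm) cell \<Rightarrow> ('o, 'm) cell \<Rightarrow> ('o, 'm) cell \<Rightarrow> bool" where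
  "discrete_fibration C n \<Phi> \<tau> \<beta> \<longleftrightarrow>
     \<Phi> \<in> higher_ext C (n + 3) \<and> limit_cube (ext_cat C n) \<Phi> \<and>
     (\<exists>face \<in> {x_face \<Phi>, y_face \<Phi>, z_face \<Phi>}.
        (\<tau> = face False \<and> \<beta> = face True) \<or>
        (\<tau> = sq_transpose (face False) \<and> \<beta> = sq_transpose (face True)))"

definition symmetrically_trivial_double_covering ::
  "('o, 'm) cat \<Rightarrow> (nat \<Rightarrow> (('o, 'm) cell, ('o, 'm) cell) galois) \<Rightarrow> nat \<Rightarrow> ('o, 'm) cell \<Rightarrow> bool"
  where
  "symmetrically_trivial_double_covering C \<Gamma> n \<tau> \<longleftrightarrow> \<tau> \<in> higher_ext C (n + 2) \<and>
     (\<exists>\<Phi> \<beta>. discrete_fibration C n \<Phi> \<tau> \<beta> \<and>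
        (\<forall>f \<in> {sq_dom \<beta>, sq_cod \<beta>}.
           Dom (ext_cat C n) f \<in> Sub (\<Gamma> n) \<and> Cod (ext_cat C n) f \<in> Sub (\<Gamma> n)))"

definition symmetric_double_covering ::
  "('o, 'm) cat \<Rightarrow> (nat \<Rightarrow> (('o, 'm) cell, ('o, 'm) cell) galois) \<Rightarrow> nat \<Rightarrow> ('o, 'm) cell \<Rightarrow> bool"
  where
  "symmetric_double_covering C \<Gamma> n \<alpha> \<longleftrightarrow> \<alpha> \<in> higher_ext C (n + 2) \<and>
     (\<exists>\<Phi> \<tau>. discrete_fibration C n \<Phi> \<tau> \<alpha> \<and> symmetrically_trivial_double_covering C \<Gamma> n \<tau>)"

end

theory Submission
  imports Defs
begin

text \<open>
Let \<open>\<E>\<close> be the class of extensions of \<open>\<C>\<close>. A discrete fibration \<open>\<tau> \<rightarrow> \<beta>\<close> of double extensions is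
weaker than a pullback of \<open>\<beta>\<close> in the category of extensions of \<open>\<C>\<close>: it only says that the
comparison \<open>\<zeta>\<close> from \<open>\<tau>\<close> to the pullback \<open>\<pi>\<close> of \<open>\<beta>\<close>, which is itself a double extension, is a
pullback square in \<open>\<C>\<close> (\<open>limit_comparison_pullback\<close>). The theorem holds because such a \<open>\<zeta>\<close> cannot
be seen by the Galois structure one level up. A double extension \<open>x \<rightarrow> W\<close> which is a pullback
square in \<open>\<C>\<close> is also, in the category of extensions, a pullback of the arrow between the
identities of the codomains of \<open>x\<close> and \<open>W\<close>; identities are coverings, so it is a trivial double
covering (\<open>trivial_of_cartesian\<close>). Thus each discrete fibration \<open>\<tau> \<rightarrow> \<beta>\<close> gives a factorisation
\<open>\<tau> = \<pi> \<cdot> \<zeta>\<close> with \<open>\<zeta>\<close> a trivial double covering and \<open>\<pi>\<close> a pullback of \<open>\<beta>\<close> (\<open>dfib_factor\<close>).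

In a strongly Birkhoff structure an extension \<open>f : A \<rightarrow> B\<close> is a trivial covering exactly when \<open>f\<close> and
the unit at \<open>A\<close> are jointly monic, because the comparison map of the reflection square is a regular
epimorphism. Hence trivial coverings compose, are stable under pullback, include each pullback of an
extension between reflective objects, and satisfy the cancellation \<open>trivial_cancel\<close>: if \<open>\<zeta>\<close> and
\<open>\<pi> \<cdot> \<zeta>\<close> are trivial, so is the extension \<open>\<pi>\<close>.

A symmetric double covering is a double covering: if \<open>\<beta>\<close> lies in \<open>\<B>\<close> then \<open>\<pi>\<close> is a pullback of an
extension between coverings, so \<open>\<tau> = \<pi> \<cdot> \<zeta>\<close> is trivial (\<open>trivial_of_dfib\<close>); and for a discrete
fibration \<open>\<tau> \<rightarrow> \<alpha>\<close> with \<open>\<tau>\<close> trivial, cancellation makes \<open>\<pi>\<close>, a pullback of \<open>\<alpha>\<close> along a double extension,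
trivial (\<open>covering_of_dfib\<close>).

Conversely, let \<open>\<pi>\<close> be a pullback of \<open>\<alpha>\<close> which is a trivial double covering. Its reflection
\<open>\<gamma> : c \<rightarrow> c'\<close> is a double extension between coverings and both \<open>\<pi> \<rightarrow> \<alpha>\<close> and \<open>\<pi> \<rightarrow> \<gamma>\<close> are discrete
fibrations. One double extension splits \<open>c\<close> and \<open>c'\<close> together, and pulling \<open>\<gamma>\<close> back along it, in
the other direction of the square, gives a double extension with two opposite sides that are trivial
coverings (\<open>splitting_square\<close>); for such a square the unit is a discrete fibration to its
reflection, whose vertices lie in \<open>\<B>\<close> (\<open>reflect_trivial_square\<close>). It remains to compose
(\<open>dfib_of_covering\<close>), for which discrete fibrations have to be closed under composition, pullback and
transposition. The symmetry under transposition rests on a description of threefold extensions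
(\<open>E3E\<close>, \<open>E3I\<close>) that does not single out a direction of the cube: the six faces are double extensions and the
comparison map to the limit of the cube without its initial vertex is in \<open>\<E>\<close>.
\<close>

section \<open>Arrows and pullbacks\<close>

lemma mem_hom [simp]: "f \<in> hom C a b \<longleftrightarrow> f \<in> Mor C \<and> Dom C f = a \<and> Cod C f = b"
  by (simp add: hom_def)

locale cat_on =
  fixes C :: "('o, 'm) cat" (structure)
  assumes category: "category C"
begin

lemma dom_Ob [simp]: "f \<in> Mor C \<Longrightarrow> Dom C f \<in> Ob C"
  and cod_Ob [simp]: "f \<in> Mor C \<Longrightarrow> Cod C f \<in> Ob C"
  using category by (auto simp: category_def)

lemma Id_Mor [simp]: "a \<in> Ob C \<Longrightarrow> Id C a \<in> Mor C"
  and Dom_Id [simp]: "a \<in> Ob C \<Longrightarrow> Dom C (Id C a) = a"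
  and Cod_Id [simp]: "a \<in> Ob C \<Longrightarrow> Cod C (Id C a) = a"
  using category by (auto simp: category_def)

lemma comp_Mor [simp]: "f \<in> Mor C \<Longrightarrow> g \<in> Mor C \<Longrightarrow> Cod C f = Dom C g \<Longrightarrow> g \<cdot> f \<in> Mor C"
  and Dom_comp [simp]: "f \<in> Mor C \<Longrightarrow> g \<in> Mor C \<Longrightarrow> Cod C f = Dom C g \<Longrightarrow> Dom C (g \<cdot> f) = Dom C f"
  and Cod_comp [simp]: "f \<in> Mor C \<Longrightarrow> g \<in> Mor C \<Longrightarrow> Cod C f = Dom C g \<Longrightarrow> Cod C (g \<cdot> f) = Cod C g"
  using category by (auto simp: category_def)

lemma comp_Id [simp]: "f \<in> Mor C \<Longrightarrow> Dom C f = a \<Longrightarrow> f \<cdot> Id C a = f"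
  and Id_comp [simp]: "f \<in> Mor C \<Longrightarrow> Cod C f = a \<Longrightarrow> Id C a \<cdot> f = f"
  using category by (auto simp: category_def)

lemma assoc: "f \<in> Mor C \<Longrightarrow> g \<in> Mor C \<Longrightarrow> h \<in> Mor C \<Longrightarrow> Cod C f = Dom C g \<Longrightarrow>
    Cod C g = Dom C h \<Longrightarrow> h \<cdot> g \<cdot> f = h \<cdot> (g \<cdot> f)"
  using category by (simp add: category_def)

text \<open>Composites are bracketed to the right, so an equation between composites rewrites a longer composite
  only after an arrow has been appended to both sides.\<close>

lemma whisker: "g \<cdot> f = k \<cdot> h \<Longrightarrow> x \<in> Mor C \<Longrightarrow> f \<in> Mor C \<Longrightarrow> g \<in> Mor C \<Longrightarrow> h \<in> Mor C \<Longrightarrow> k \<in> Mor C \<Longrightarrow>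
    Cod C x = Dom C f \<Longrightarrow> Cod C x = Dom C h \<Longrightarrow> Cod C f = Dom C g \<Longrightarrow> Cod C h = Dom C k \<Longrightarrow>
    g \<cdot> (f \<cdot> x) = k \<cdot> (h \<cdot> x)"
  by (metis assoc)

lemma whisker1: "g \<cdot> f = k \<Longrightarrow> x \<in> Mor C \<Longrightarrow> f \<in> Mor C \<Longrightarrow> g \<in> Mor C \<Longrightarrow>
    Cod C x = Dom C f \<Longrightarrow> Cod C f = Dom C g \<Longrightarrow> g \<cdot> (f \<cdot> x) = k \<cdot> x"
  by (metis assoc)

lemma iso_Id: "a \<in> Ob C \<Longrightarrow> iso C (Id C a)"
  by (auto simp: iso_def intro!: bexI[of _ "Id C a"])

lemma regular_epi_Mor: "regular_epi C e \<Longrightarrow> e \<in> Mor C"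
  by (auto simp: regular_epi_def is_coequalizer_def)

lemma regular_epi_cancel:
  assumes "regular_epi C e" "h \<in> Mor C" "k \<in> Mor C" "Dom C h = Cod C e" "Dom C k = Cod C e"
    and eq: "h \<cdot> e = k \<cdot> e"
  shows "h = k"
proof -
  obtain u v where co: "is_coequalizer C u v e"
    using assms by (auto simp: regular_epi_def)
  have e: "e \<in> Mor C" "u \<in> Mor C" "v \<in> Mor C" "Cod C u = Dom C e" "Cod C v = Dom C e" "e \<cdot> u = e \<cdot> v"
    using co by (auto simp: is_coequalizer_def)
  have "(h \<cdot> e) \<cdot> u = (h \<cdot> e) \<cdot> v"
    using e assms(2-5) by (simp add: assoc)
  moreover have "h \<cdot> e \<in> Mor C" "Dom C (h \<cdot> e) = Dom C e" "Cod C (h \<cdot> e) = Cod C h"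
    using e assms(2-5) by auto
  ultimately have ex1: "\<exists>!x. x \<in> hom C (Cod C e) (Cod C h) \<and> x \<cdot> e = h \<cdot> e"
    using co unfolding is_coequalizer_def by metis
  have "Cod C h = Cod C k"
    using eq assms e by (metis Cod_comp)
  then show ?thesis using ex1 assms by auto
qed

text \<open>From \<open>r \<cdot> e = 1\<close> follows \<open>(e \<cdot> r) \<cdot> e = 1 \<cdot> e\<close>, and \<open>e\<close> can be cancelled.\<close>

lemma iso_of_retraction:
  assumes "regular_epi C e" "r \<in> Mor C" "Dom C r = Cod C e" "Cod C r = Dom C e" "r \<cdot> e = Id C (Dom C e)"
  shows "e \<cdot> r = Id C (Cod C e)" "iso C e"
proof -
  have e: "e \<in> Mor C" using assms regular_epi_Mor by auto
  have "(e \<cdot> r) \<cdot> e = Id C (Cod C e) \<cdot> e"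
    using e assms by (simp add: assoc)
  show *: "e \<cdot> r = Id C (Cod C e)"
    by (rule regular_epi_cancel[OF assms(1)]) (use e assms \<open>(e \<cdot> r) \<cdot> e = Id C (Cod C e) \<cdot> e\<close> in auto)
  show "iso C e" using e assms * by (auto simp: iso_def)
qed

lemma pullback_arrows:
  assumes "is_pullback C f g P p q"
  shows "f \<in> Mor C" "g \<in> Mor C" "Cod C f = Cod C g" "p \<in> Mor C" "q \<in> Mor C" "Dom C p = P" "Dom C q = P"
    "Cod C p = Dom C f" "Cod C q = Dom C g" "f \<cdot> p = g \<cdot> q" "P \<in> Ob C"
  using assms by (auto simp: is_pullback_def)

lemma pullback_lift:
  assumes "is_pullback C f g P p q" "u \<in> Mor C" "v \<in> Mor C" "Dom C u = Dom C v"
    "Cod C u = Dom C f" "Cod C v = Dom C g" "f \<cdot> u = g \<cdot> v"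
  obtains h where "h \<in> Mor C" "Dom C h = Dom C u" "Cod C h = P" "p \<cdot> h = u" "q \<cdot> h = v"
proof -
  have "\<exists>h. h \<in> hom C (Dom C u) P \<and> p \<cdot> h = u \<and> q \<cdot> h = v"
    using assms(1) unfolding is_pullback_def using assms(2-7) by (metis dom_Ob mem_hom)
  then show thesis using that by auto
qed

lemma pullback_eqI:
  assumes pb: "is_pullback C f g P p q" and "h \<in> Mor C" "k \<in> Mor C" "Dom C h = Dom C k"
    "Cod C h = P" "Cod C k = P" "p \<cdot> h = p \<cdot> k" "q \<cdot> h = q \<cdot> k"
  shows "h = k"
proof -
  note [simp] = pullback_arrows[OF pb]
  have "f \<cdot> (p \<cdot> h) = g \<cdot> (q \<cdot> h)"
    using assms by (intro whisker) auto
  moreover have "p \<cdot> h \<in> hom C (Dom C h) (Dom C f)" "q \<cdot> h \<in> hom C (Dom C h) (Dom C g)" "Dom C h \<in> Ob C"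
    using assms(2-6) by auto
  ultimately have "\<exists>!x. x \<in> hom C (Dom C h) P \<and> p \<cdot> x = p \<cdot> h \<and> q \<cdot> x = q \<cdot> h"
    using pb unfolding is_pullback_def by blast
  then show ?thesis using assms by auto
qed

lemma pullbackI:
  assumes "f \<in> Mor C" "g \<in> Mor C" "Cod C f = Cod C g" "p \<in> Mor C" "q \<in> Mor C" "Dom C p = P" "Dom C q = P"
    "Cod C p = Dom C f" "Cod C q = Dom C g" "f \<cdot> p = g \<cdot> q"
    and ex: "\<And>u v. u \<in> Mor C \<Longrightarrow> v \<in> Mor C \<Longrightarrow> Dom C u = Dom C v \<Longrightarrow> Cod C u = Dom C f \<Longrightarrow> Cod C v = Dom C g \<Longrightarrow>
        f \<cdot> u = g \<cdot> v \<Longrightarrow> \<exists>h. h \<in> Mor C \<and> Dom C h = Dom C v \<and> Cod C h = P \<and> p \<cdot> h = u \<and> q \<cdot> h = v"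
    and un: "\<And>h k. h \<in> Mor C \<Longrightarrow> k \<in> Mor C \<Longrightarrow> Dom C h = Dom C k \<Longrightarrow> Cod C h = P \<Longrightarrow> Cod C k = P \<Longrightarrow>
        p \<cdot> h = p \<cdot> k \<Longrightarrow> q \<cdot> h = q \<cdot> k \<Longrightarrow> h = k"
  shows "is_pullback C f g P p q"
  unfolding is_pullback_def
proof (intro conjI ballI impI)
  fix z u v assume "z \<in> Ob C" "u \<in> hom C z (Dom C f)" "v \<in> hom C z (Dom C g)" "f \<cdot> u = g \<cdot> v"
  then show "\<exists>!h. h \<in> hom C z P \<and> p \<cdot> h = u \<and> q \<cdot> h = v"
    using ex[of u v] un by (auto intro!: ex_ex1I)
qed (use assms in auto)

lemma pullback_sym: "is_pullback C f g P p q \<Longrightarrow> is_pullback C g f P q p"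
  unfolding is_pullback_def by (auto simp: conj_commute)

lemma pullback_Id: "f \<in> Mor C \<Longrightarrow> is_pullback C (Id C (Cod C f)) f (Dom C f) f (Id C (Dom C f))"
  by (rule pullbackI) auto

lemma pullback_iso:
  assumes pb: "is_pullback C f g P p q" and c: "c \<in> Mor C" "Cod C c = P" "iso C c"
  shows "is_pullback C f g (Dom C c) (p \<cdot> c) (q \<cdot> c)"
proof -
  note [simp] = pullback_arrows[OF pb] c(1,2)
  obtain d where d [simp]: "d \<in> Mor C" "Dom C d = P" "Cod C d = Dom C c" and dc: "d \<cdot> c = Id C (Dom C c)"
    and cd: "c \<cdot> d = Id C P"
    using c by (auto simp: iso_def)
  show ?thesis
  proof (rule pullbackI)
    show "f \<cdot> (p \<cdot> c) = g \<cdot> (q \<cdot> c)" by (rule whisker) auto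
  next
    fix u v assume uv: "u \<in> Mor C" "v \<in> Mor C" "Dom C u = Dom C v" "Cod C u = Dom C f" "Cod C v = Dom C g" "f \<cdot> u = g \<cdot> v"
    obtain h where h: "h \<in> Mor C" "Dom C h = Dom C u" "Cod C h = P" "p \<cdot> h = u" "q \<cdot> h = v"
      by (rule pullback_lift[OF pb uv])
    have "c \<cdot> (d \<cdot> h) = h" using h cd by (simp add: assoc[symmetric])
    then show "\<exists>h. h \<in> Mor C \<and> Dom C h = Dom C v \<and> Cod C h = Dom C c \<and> p \<cdot> c \<cdot> h = u \<and> q \<cdot> c \<cdot> h = v"
      using h uv by (intro exI[of _ "d \<cdot> h"]) (simp add: assoc)
  next
    fix h k assume hk: "h \<in> Mor C" "k \<in> Mor C" "Dom C h = Dom C k" "Cod C h = Dom C c" "Cod C k = Dom C c"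
      "p \<cdot> c \<cdot> h = p \<cdot> c \<cdot> k" "q \<cdot> c \<cdot> h = q \<cdot> c \<cdot> k"
    have "c \<cdot> h = c \<cdot> k"
      by (rule pullback_eqI[OF pb]) (use hk in \<open>auto simp: assoc\<close>)
    then have "d \<cdot> (c \<cdot> h) = d \<cdot> (c \<cdot> k)" by simp
    then show "h = k" using hk dc by (simp add: assoc[symmetric])
  qed auto
qed

lemma pullback_unique:
  assumes 1: "is_pullback C f g P p q" and 2: "is_pullback C f g Q r s"
  obtains c where "c \<in> Mor C" "Dom C c = Q" "Cod C c = P" "iso C c" "p \<cdot> c = r" "q \<cdot> c = s"
proof -
  note [simp] = pullback_arrows[OF 1] pullback_arrows[OF 2]
  obtain c where c [simp]: "c \<in> Mor C" "Dom C c = Q" "Cod C c = P" "p \<cdot> c = r" "q \<cdot> c = s"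
    by (rule pullback_lift[OF 1, of r s]) (use pullback_arrows[OF 2] in auto)
  obtain d where d [simp]: "d \<in> Mor C" "Dom C d = P" "Cod C d = Q" "r \<cdot> d = p" "s \<cdot> d = q"
    by (rule pullback_lift[OF 2, of p q]) (use pullback_arrows[OF 1] in auto)
  have "c \<cdot> d = Id C P"
    by (rule pullback_eqI[OF 1]) (simp_all add: assoc[symmetric])
  moreover have "d \<cdot> c = Id C Q"
    by (rule pullback_eqI[OF 2]) (simp_all add: assoc[symmetric])
  ultimately have "iso C c" by (auto simp: iso_def intro!: bexI[of _ d])
  then show thesis by (rule that[OF c(1-3) _ c(4,5)])
qed

lemma pullback_paste:
  assumes 1: "is_pullback C f g P p q" and 2: "is_pullback C h p Q r s"
  shows "is_pullback C (f \<cdot> h) g Q r (q \<cdot> s)"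
proof -
  note [simp] = pullback_arrows(1-9,11)[OF 1] pullback_arrows(1-9,11)[OF 2]
  note eq = pullback_arrows(10)[OF 1] pullback_arrows(10)[OF 2]
  have hf [simp]: "Cod C h = Dom C f" using pullback_arrows(3)[OF 2] by simp
  show ?thesis
  proof (rule pullbackI)
    show "f \<cdot> h \<cdot> r = g \<cdot> (q \<cdot> s)" using whisker[OF eq(1), of s] eq(2) by (simp add: assoc)
  next
    fix u v assume uv: "u \<in> Mor C" "v \<in> Mor C" "Dom C u = Dom C v" "Cod C u = Dom C (f \<cdot> h)" "Cod C v = Dom C g"
      "f \<cdot> h \<cdot> u = g \<cdot> v"
    obtain x where x: "x \<in> Mor C" "Dom C x = Dom C u" "Cod C x = P" "p \<cdot> x = h \<cdot> u" "q \<cdot> x = v"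
      by (rule pullback_lift[OF 1, of "h \<cdot> u" v]) (use uv in \<open>auto simp: assoc\<close>)
    obtain y where y: "y \<in> Mor C" "Dom C y = Dom C u" "Cod C y = Q" "r \<cdot> y = u" "s \<cdot> y = x"
      by (rule pullback_lift[OF 2, of u x]) (use uv x in \<open>auto simp: assoc\<close>)
    show "\<exists>h. h \<in> Mor C \<and> Dom C h = Dom C v \<and> Cod C h = Q \<and> r \<cdot> h = u \<and> q \<cdot> s \<cdot> h = v"
      using x y uv by (intro exI[of _ y]) (simp add: assoc)
  next
    fix x y assume xy: "x \<in> Mor C" "y \<in> Mor C" "Dom C x = Dom C y" "Cod C x = Q" "Cod C y = Q"
      "r \<cdot> x = r \<cdot> y" "q \<cdot> s \<cdot> x = q \<cdot> s \<cdot> y"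
    have "s \<cdot> x = s \<cdot> y"
    proof (rule pullback_eqI[OF 1])
      have "p \<cdot> (s \<cdot> x) = h \<cdot> (r \<cdot> x)" "p \<cdot> (s \<cdot> y) = h \<cdot> (r \<cdot> y)"
        using whisker[OF eq(2), of x] whisker[OF eq(2), of y] xy by simp_all
      then show "p \<cdot> (s \<cdot> x) = p \<cdot> (s \<cdot> y)" using xy by simp
    qed (use xy in \<open>auto simp: assoc\<close>)
    then show "x = y" using pullback_eqI[OF 2, of x y] xy by simp
  qed auto
qed

lemma pullback_cancel:
  assumes 1: "is_pullback C f g P p q" and 2: "is_pullback C (f \<cdot> h) g Q r t"
    and h: "h \<in> Mor C" "Cod C h = Dom C f" and s: "s \<in> Mor C" "Dom C s = Q" "Cod C s = P"
    and eq: "p \<cdot> s = h \<cdot> r" "q \<cdot> s = t"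
  shows "is_pullback C h p Q r s"
proof -
  note [simp] = pullback_arrows(1-9,11)[OF 1] pullback_arrows(4-7)[OF 2] h s
  have [simp]: "Cod C r = Dom C h" "Cod C t = Dom C g"
    using pullback_arrows(8,9)[OF 2] by auto
  show ?thesis
  proof (rule pullbackI)
    show "h \<cdot> r = p \<cdot> s" using eq by simp
  next
    fix u v assume uv: "u \<in> Mor C" "v \<in> Mor C" "Dom C u = Dom C v" "Cod C u = Dom C h" "Cod C v = Dom C p" "h \<cdot> u = p \<cdot> v"
    have "f \<cdot> h \<cdot> u = g \<cdot> (q \<cdot> v)"
      using uv whisker[OF pullback_arrows(10)[OF 1], of v] by (simp add: assoc)
    then obtain x where x: "x \<in> Mor C" "Dom C x = Dom C u" "Cod C x = Q" "r \<cdot> x = u" "t \<cdot> x = q \<cdot> v"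
      by (elim pullback_lift[OF 2, of u "q \<cdot> v", rotated 5]) (use uv in auto)
    have "s \<cdot> x = v"
    proof (rule pullback_eqI[OF 1])
      show "p \<cdot> (s \<cdot> x) = p \<cdot> v" using x uv whisker[OF eq(1), of x] by simp
      show "q \<cdot> (s \<cdot> x) = q \<cdot> v" using x uv whisker1[OF eq(2), of x] by simp
    qed (use x uv in auto)
    then show "\<exists>k. k \<in> Mor C \<and> Dom C k = Dom C v \<and> Cod C k = Q \<and> r \<cdot> k = u \<and> s \<cdot> k = v"
      using x uv by (intro exI[of _ x]) simp
  next
    fix x y assume xy: "x \<in> Mor C" "y \<in> Mor C" "Dom C x = Dom C y" "Cod C x = Q" "Cod C y = Q"
      "r \<cdot> x = r \<cdot> y" "s \<cdot> x = s \<cdot> y"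
    have "t \<cdot> x = t \<cdot> y" using xy whisker1[OF eq(2), of x] whisker1[OF eq(2), of y] by simp
    show "x = y" by (rule pullback_eqI[OF 2]) (use xy \<open>t \<cdot> x = t \<cdot> y\<close> in simp_all)
  qed auto
qed

text \<open>A monomorphism identifies the two arrows that \<open>e\<close> coequalises, so the identity also
  coequalises them and factors through \<open>e\<close>.\<close>

lemma iso_of_monic_regular_epi:
  assumes "regular_epi C e"
    and mono: "\<And>u v. u \<in> Mor C \<Longrightarrow> v \<in> Mor C \<Longrightarrow> Dom C u = Dom C v \<Longrightarrow> Cod C u = Dom C e \<Longrightarrow> Cod C v = Dom C e \<Longrightarrow>
      e \<cdot> u = e \<cdot> v \<Longrightarrow> u = v"
  shows "iso C e"
proof -
  obtain u v where co: "is_coequalizer C u v e"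
    using assms by (auto simp: regular_epi_def)
  then have "u = v"
    unfolding is_coequalizer_def using mono by metis
  moreover have e: "e \<in> Mor C" "u \<in> Mor C" "Cod C u = Dom C e"
    using co by (auto simp: is_coequalizer_def)
  ultimately obtain r where r: "r \<in> hom C (Cod C e) (Cod C (Id C (Dom C e)))" "r \<cdot> e = Id C (Dom C e)"
    using co unfolding is_coequalizer_def by (metis Dom_Id Id_Mor dom_Ob)
  show ?thesis
    by (rule iso_of_retraction(2)[OF assms(1), of r]) (use r e in simp_all)
qed

end

text \<open>The closure properties of the extensions of a Galois structure. They are separated from the
  reflection so that they can be used for the extensions of each level of a tower.\<close>

locale extensions = cat_on C for C :: "('o, 'm) cat" (structure) +
  fixes E :: "'m set"
  assumes E_regular_epi: "e \<in> E \<Longrightarrow> regular_epi C e"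
    and E_iso: "iso C f \<Longrightarrow> f \<in> E"
    and E_comp: "f \<in> E \<Longrightarrow> g \<in> E \<Longrightarrow> Cod C f = Dom C g \<Longrightarrow> g \<cdot> f \<in> E"
    and E_pullback_exists: "e \<in> E \<Longrightarrow> f \<in> Mor C \<Longrightarrow> Cod C f = Cod C e \<Longrightarrow> \<exists>P p q. is_pullback C f e P p q"
    and E_pullback: "e \<in> E \<Longrightarrow> is_pullback C f e P p q \<Longrightarrow> p \<in> E"
begin

lemma E_Mor [simp]: "e \<in> E \<Longrightarrow> e \<in> Mor C"
  by (rule regular_epi_Mor[OF E_regular_epi])

lemma E_cancel: "e \<in> E \<Longrightarrow> h \<in> Mor C \<Longrightarrow> k \<in> Mor C \<Longrightarrow> Dom C h = Cod C e \<Longrightarrow> Dom C k = Cod C e \<Longrightarrow>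
    h \<cdot> e = k \<cdot> e \<Longrightarrow> h = k"
  by (rule regular_epi_cancel[OF E_regular_epi])

lemma E_pullback': "e \<in> E \<Longrightarrow> is_pullback C e f P p q \<Longrightarrow> q \<in> E"
  by (rule E_pullback[OF _ pullback_sym])

lemma pullback_along_E:
  assumes "e \<in> E" "f \<in> Mor C" "Cod C f = Cod C e"
  obtains P p q where "is_pullback C f e P p q" "p \<in> E"
  using E_pullback_exists[OF assms] E_pullback[OF assms(1)] by blast

lemma E_Id: "a \<in> Ob C \<Longrightarrow> Id C a \<in> E"
  by (rule E_iso[OF iso_Id])

end

section \<open>Trivial coverings\<close>

text \<open>The category and the class of extensions are parameters of their own, so that the categories of
  extensions of the tower, which are built from the category below, can be substituted for them.\<close>

locale birkhoff =
  fixes C :: "('o, 'm) cat" (structure) and E :: "'m set" and G :: "('o, 'm) galois"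
  assumes galois: "galois_structure G" and birkhoff: "strongly_birkhoff G"
    and Cat_G [simp]: "Cat G = C" and Exts_G [simp]: "Exts G = E"
begin

abbreviation "S \<equiv> Sub G"
abbreviation "Fo \<equiv> fob (Refl G)"
abbreviation "F \<equiv> fmor (Refl G)"
abbreviation "\<eta> \<equiv> Unit G"

sublocale extensions C E
proof
  note * = galois[unfolded galois_structure_def Let_def Cat_G Exts_G]
  show "category C" "e \<in> E \<Longrightarrow> regular_epi C e" "iso C f \<Longrightarrow> f \<in> E"
    "f \<in> E \<Longrightarrow> g \<in> E \<Longrightarrow> Cod C f = Dom C g \<Longrightarrow> g \<cdot> f \<in> E"
    "e \<in> E \<Longrightarrow> f \<in> Mor C \<Longrightarrow> Cod C f = Cod C e \<Longrightarrow> \<exists>P p q. is_pullback C f e P p q"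
    "e \<in> E \<Longrightarrow> is_pullback C f e P p q \<Longrightarrow> p \<in> E" for e f g P p q
    using * by blast+
qed

lemma adjoint: "adjunction C (full_sub C S) (Refl G) id_functor \<eta> (Counit G)"
  using galois by (simp add: galois_structure_def Let_def)

lemma unit_E [simp]: "a \<in> Ob C \<Longrightarrow> \<eta> a \<in> E"
  using galois by (simp add: galois_structure_def Let_def)

lemma reflection_E: "e \<in> E \<Longrightarrow> F e \<in> E"
  using galois by (simp add: galois_structure_def Let_def)

lemma Fo_Ob [simp]: "a \<in> Ob C \<Longrightarrow> Fo a \<in> Ob C"
  and Fo_S [simp]: "a \<in> Ob C \<Longrightarrow> Fo a \<in> S"
  using adjoint by (auto simp: adjunction_def is_functor_def full_sub_def)

lemma F_Mor [simp]: "f \<in> Mor C \<Longrightarrow> F f \<in> Mor C"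
  and Dom_F [simp]: "f \<in> Mor C \<Longrightarrow> Dom C (F f) = Fo (Dom C f)"
  and Cod_F [simp]: "f \<in> Mor C \<Longrightarrow> Cod C (F f) = Fo (Cod C f)"
  using adjoint by (auto simp: adjunction_def is_functor_def full_sub_def)

lemma F_comp: "f \<in> Mor C \<Longrightarrow> g \<in> Mor C \<Longrightarrow> Cod C f = Dom C g \<Longrightarrow> F (g \<cdot> f) = F g \<cdot> F f"
  using adjoint by (auto simp: adjunction_def is_functor_def full_sub_def)

lemma Dom_unit [simp]: "a \<in> Ob C \<Longrightarrow> Dom C (\<eta> a) = a"
  and Cod_unit [simp]: "a \<in> Ob C \<Longrightarrow> Cod C (\<eta> a) = Fo a"
  and unit_natural: "f \<in> Mor C \<Longrightarrow> \<eta> (Cod C f) \<cdot> f = F f \<cdot> \<eta> (Dom C f)"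
  using adjoint by (auto simp: adjunction_def nat_trans_def id_functor_def comp_functor_def)

lemma extend_along_unit:
  assumes f: "f \<in> Mor C" "Cod C f \<in> S"
  obtains g where "g \<in> Mor C" "Dom C g = Fo (Dom C f)" "Cod C g = Cod C f" "g \<cdot> \<eta> (Dom C f) = f"
proof -
  define x where "x = Counit G (Cod C f)"
  have x: "x \<in> Mor C" "Dom C x = Fo (Cod C f)" "Cod C x = Cod C f" "x \<cdot> \<eta> (Cod C f) = Id C (Cod C f)"
    using adjoint f by (auto simp: x_def adjunction_def nat_trans_def id_functor_def comp_functor_def full_sub_def)
  have "x \<cdot> F f \<cdot> \<eta> (Dom C f) = x \<cdot> (\<eta> (Cod C f) \<cdot> f)"
    using x f by (simp add: assoc unit_natural)
  also have "\<dots> = f" using x f by (simp add: assoc[symmetric])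
  finally show thesis using x f by (intro that[of "x \<cdot> F f"]) auto
qed

lemma unit_eq_natural:
  assumes "f \<in> Mor C" "x \<in> Mor C" "y \<in> Mor C" "Cod C x = Dom C f" "Cod C y = Dom C f"
    "\<eta> (Dom C f) \<cdot> x = \<eta> (Dom C f) \<cdot> y"
  shows "\<eta> (Cod C f) \<cdot> (f \<cdot> x) = \<eta> (Cod C f) \<cdot> (f \<cdot> y)"
  using assms whisker[OF unit_natural[of f], of x] whisker[OF unit_natural[of f], of y] by simp

lemma trivial_covering_iff:
  "trivial_covering G f \<longleftrightarrow> f \<in> E \<and> is_pullback C (\<eta> (Cod C f)) (F f) (Dom C f) f (\<eta> (Dom C f))"
  by (simp add: trivial_covering_def)

lemma trivial_E: "trivial_covering G f \<Longrightarrow> f \<in> E"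
  by (simp add: trivial_covering_iff)

lemma trivial_pullback: "trivial_covering G f \<Longrightarrow> is_pullback C (\<eta> (Cod C f)) (F f) (Dom C f) f (\<eta> (Dom C f))"
  by (simp add: trivial_covering_iff)

lemma trivial_monic:
  assumes "trivial_covering G f" "x \<in> Mor C" "y \<in> Mor C" "Dom C x = Dom C y" "Cod C x = Dom C f" "Cod C y = Dom C f"
    "f \<cdot> x = f \<cdot> y" "\<eta> (Dom C f) \<cdot> x = \<eta> (Dom C f) \<cdot> y"
  shows "x = y"
  by (rule pullback_eqI[OF trivial_pullback[OF assms(1)] assms(2-)])

text \<open>The comparison map \<open>c\<close> of the reflection square is a regular epimorphism because the structure is
  strongly Birkhoff. Joint monicity of \<open>f\<close> and the unit makes it monic as well, hence invertible. So triviality can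
  be tested on pairs of parallel arrows.\<close>

lemma trivialI_monic:
  assumes f: "f \<in> E"
    and monic: "\<And>x y. x \<in> Mor C \<Longrightarrow> y \<in> Mor C \<Longrightarrow> Dom C x = Dom C y \<Longrightarrow> Cod C x = Dom C f \<Longrightarrow> Cod C y = Dom C f \<Longrightarrow>
      f \<cdot> x = f \<cdot> y \<Longrightarrow> \<eta> (Dom C f) \<cdot> x = \<eta> (Dom C f) \<cdot> y \<Longrightarrow> x = y"
  shows "trivial_covering G f"
proof -
  obtain P p q c where pb: "is_pullback C (\<eta> (Cod C f)) (F f) P p q" and c: "c \<in> E" "Dom C c = Dom C f" "Cod C c = P"
    and eq: "p \<cdot> c = f" "q \<cdot> c = \<eta> (Dom C f)"
    using birkhoff f unfolding strongly_birkhoff_def double_extension_def by auto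
  note pq = pullback_arrows[OF pb]
  have "iso C c"
  proof (rule iso_of_monic_regular_epi[OF E_regular_epi[OF c(1)]])
    fix x y assume xy: "x \<in> Mor C" "y \<in> Mor C" "Dom C x = Dom C y" "Cod C x = Dom C c" "Cod C y = Dom C c"
      "c \<cdot> x = c \<cdot> y"
    have "p \<cdot> (c \<cdot> x) = f \<cdot> x" "p \<cdot> (c \<cdot> y) = f \<cdot> y" "q \<cdot> (c \<cdot> x) = \<eta> (Dom C f) \<cdot> x" "q \<cdot> (c \<cdot> y) = \<eta> (Dom C f) \<cdot> y"
      using xy(1-5) c pq(1-9) by (auto intro!: whisker1 eq)
    then show "x = y"
      using monic[of x y] xy c by simp
  qed
  then have "is_pullback C (\<eta> (Cod C f)) (F f) (Dom C f) f (\<eta> (Dom C f))"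
    using pullback_iso[OF pb, of c] c eq by simp
  then show ?thesis using f by (simp add: trivial_covering_iff)
qed

text \<open>The projection \<open>k\<close> to an object of the reflective subcategory factors through the unit, so two
  arrows that agree after \<open>f\<close> and the unit agree after both projections of the pullback.\<close>

lemma trivial_of_pullback:
  assumes f: "f \<in> E" and pb: "is_pullback C h g P f k" and g: "Dom C g \<in> S"
  shows "trivial_covering G f"
proof (rule trivialI_monic[OF f])
  note [simp] = pullback_arrows(1-9)[OF pb]
  obtain k' where k': "k' \<in> Mor C" "Dom C k' = Fo (Dom C f)" "Cod C k' = Dom C g" "k' \<cdot> \<eta> (Dom C f) = k"
    using extend_along_unit[of k] g by auto
  fix x y assume xy: "x \<in> Mor C" "y \<in> Mor C" "Dom C x = Dom C y" "Cod C x = Dom C f" "Cod C y = Dom C f"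
      "f \<cdot> x = f \<cdot> y" "\<eta> (Dom C f) \<cdot> x = \<eta> (Dom C f) \<cdot> y"
  have "k' \<cdot> (\<eta> (Dom C f) \<cdot> x) = k \<cdot> x" "k' \<cdot> (\<eta> (Dom C f) \<cdot> y) = k \<cdot> y"
    using k' f xy(1-5) by (auto intro!: whisker1)
  then have "k \<cdot> x = k \<cdot> y" using xy(7) by simp
  then show "x = y" using pullback_eqI[OF pb xy(1-3)] xy by simp
qed

lemma trivial_pulled_back:
  assumes f: "trivial_covering G f" and pb: "is_pullback C h f P p k"
  shows "trivial_covering G p"
proof (rule trivialI_monic)
  show "p \<in> E" by (rule E_pullback[OF trivial_E[OF f] pb])
  note [simp] = pullback_arrows(1-9)[OF pb]
  fix x y assume xy: "x \<in> Mor C" "y \<in> Mor C" "Dom C x = Dom C y" "Cod C x = Dom C p" "Cod C y = Dom C p"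
      "p \<cdot> x = p \<cdot> y" "\<eta> (Dom C p) \<cdot> x = \<eta> (Dom C p) \<cdot> y"
  have "k \<cdot> x = k \<cdot> y"
  proof (rule trivial_monic[OF f])
    show "f \<cdot> (k \<cdot> x) = f \<cdot> (k \<cdot> y)"
      using xy whisker[OF pullback_arrows(10)[OF pb], of x] whisker[OF pullback_arrows(10)[OF pb], of y] by simp
    show "\<eta> (Dom C f) \<cdot> (k \<cdot> x) = \<eta> (Dom C f) \<cdot> (k \<cdot> y)"
      using unit_eq_natural[of k x y] xy by simp
  qed (use xy in auto)
  then show "x = y" using pullback_eqI[OF pb xy(1-3)] xy by simp
qed

lemma trivial_comp:
  assumes f: "trivial_covering G f" and g: "trivial_covering G g" and fg: "Cod C f = Dom C g"
  shows "trivial_covering G (g \<cdot> f)"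
proof (rule trivialI_monic)
  note [simp] = trivial_E[OF f, THEN E_Mor] trivial_E[OF g, THEN E_Mor]
  show "g \<cdot> f \<in> E" using f g fg by (simp add: trivial_E E_comp)
  fix x y assume xy: "x \<in> Mor C" "y \<in> Mor C" "Dom C x = Dom C y" "Cod C x = Dom C (g \<cdot> f)" "Cod C y = Dom C (g \<cdot> f)"
      "g \<cdot> f \<cdot> x = g \<cdot> f \<cdot> y" "\<eta> (Dom C (g \<cdot> f)) \<cdot> x = \<eta> (Dom C (g \<cdot> f)) \<cdot> y"
  have "f \<cdot> x = f \<cdot> y"
    by (rule trivial_monic[OF g]) (use xy fg unit_eq_natural[of f x y] in \<open>simp_all add: assoc\<close>)
  then show "x = y"
    using trivial_monic[OF f xy(1-3)] xy fg by simp
qed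

text \<open>Let \<open>u\<close> and \<open>v\<close> agree after \<open>g\<close> and the unit. After a base change \<open>z\<close> along \<open>f\<close>, the arrow
  \<open>u\<close> lifts to some \<open>w\<close> through \<open>f\<close>. As the reflection square of \<open>f\<close> is a pullback, \<open>v\<close> lifts to some \<open>w'\<close>
  with the same image under the unit as \<open>w\<close>. Joint monicity for \<open>g \<cdot> f\<close> gives \<open>w = w'\<close>, and \<open>z\<close> can be cancelled.\<close>

lemma trivial_cancel:
  assumes f: "trivial_covering G f" and g: "g \<in> E" and fg: "Cod C f = Dom C g"
    and gf: "trivial_covering G (g \<cdot> f)"
  shows "trivial_covering G g"
proof (rule trivialI_monic[OF g])
  note [simp] = trivial_E[OF f, THEN E_Mor] g[THEN E_Mor] fg
  fix u v assume uv: "u \<in> Mor C" "v \<in> Mor C" "Dom C u = Dom C v" "Cod C u = Dom C g" "Cod C v = Dom C g"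
      "g \<cdot> u = g \<cdot> v" "\<eta> (Dom C g) \<cdot> u = \<eta> (Dom C g) \<cdot> v"
  obtain Z z w where pb: "is_pullback C u f Z z w" and z: "z \<in> E"
    using pullback_along_E[OF trivial_E[OF f], of u] uv by auto
  note [simp] = pullback_arrows(4-9)[OF pb]
  have "\<eta> (Cod C f) \<cdot> (v \<cdot> z) = \<eta> (Cod C f) \<cdot> u \<cdot> z"
    using uv by (simp add: assoc[symmetric])
  also have "\<dots> = F f \<cdot> (\<eta> (Dom C f) \<cdot> w)"
    using whisker[OF unit_natural[of f], of w] uv(1-5) by (simp add: assoc pullback_arrows(10)[OF pb])
  finally have *: "\<eta> (Cod C f) \<cdot> (v \<cdot> z) = F f \<cdot> (\<eta> (Dom C f) \<cdot> w)" .
  obtain w' where w': "w' \<in> Mor C" "Dom C w' = Dom C (v \<cdot> z)" "Cod C w' = Dom C f" "f \<cdot> w' = v \<cdot> z"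
      "\<eta> (Dom C f) \<cdot> w' = \<eta> (Dom C f) \<cdot> w"
    by (rule pullback_lift[OF trivial_pullback[OF f] _ _ _ _ _ *]) (use uv in simp_all)
  have "w = w'"
  proof (rule trivial_monic[OF gf])
    have "g \<cdot> f \<cdot> w = g \<cdot> u \<cdot> z" using uv(1-5) by (simp add: assoc pullback_arrows(10)[OF pb])
    also have "\<dots> = g \<cdot> f \<cdot> w'" unfolding uv(6) using uv(1-5) w' by (simp add: assoc)
    finally show "g \<cdot> f \<cdot> w = g \<cdot> f \<cdot> w'" .
  qed (use uv w' in simp_all)
  then have uz: "u \<cdot> z = v \<cdot> z" using w'(4) pullback_arrows(10)[OF pb] by simp
  show "u = v" by (rule E_cancel[OF z uv(1,2) _ _ uz]) (simp_all add: uv(3))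
qed

lemma trivial_Id: "a \<in> Ob C \<Longrightarrow> trivial_covering G (Id C a)"
  by (rule trivialI_monic) (auto simp: E_Id)

lemma covering_of_trivial:
  assumes f: "trivial_covering G f"
  shows "covering G f"
proof -
  have "f \<in> E" by (rule trivial_E[OF f])
  then show ?thesis
    using f pullback_Id[of f] unfolding covering_def
    by (auto intro!: exI bexI[of _ "Id C (Cod C f)"] simp: E_Id)
qed

lemma trivial_in_S:
  assumes "f \<in> E" "Dom C f \<in> S"
  shows "trivial_covering G f"
  using assms trivial_of_pullback[OF assms(1) pullback_Id[of f]] by simp

lemma coveringE:
  assumes "covering G c"
  obtains e P p q where "e \<in> E" "Cod C e = Cod C c" "is_pullback C e c P p q" "trivial_covering G p" "c \<in> E"
  using assms by (auto simp: covering_def)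

text \<open>The pullback \<open>K\<close> of objects of the reflective subcategory lies in the subcategory up to
  isomorphism, so the factorisation of \<open>k\<close> through the unit is, up to isomorphism, the
  reflection of the extension \<open>k\<close>.\<close>

lemma factor_through_unit_E:
  assumes pb: "is_pullback C f g K p q" and S: "Dom C f \<in> S" "Dom C g \<in> S"
    and k: "k \<in> E" "Cod C k = K"
    and h: "h \<in> Mor C" "Dom C h = Fo (Dom C k)" "Cod C h = K" "h \<cdot> \<eta> (Dom C k) = k"
  shows "h \<in> E"
proof -
  note pq = pullback_arrows(1-9,11)[OF pb]
  have [simp]: "k \<in> Mor C" "K \<in> Ob C" using k pq by auto
  obtain p' where p': "p' \<in> Mor C" "Dom C p' = Fo K" "Cod C p' = Dom C f" "p' \<cdot> \<eta> K = p"
    using extend_along_unit[of p] pq S by auto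
  obtain q' where q': "q' \<in> Mor C" "Dom C q' = Fo K" "Cod C q' = Dom C g" "q' \<cdot> \<eta> K = q"
    using extend_along_unit[of q] pq S by auto
  have "f \<cdot> p' = g \<cdot> q'"
    by (rule E_cancel[of "\<eta> K"]) (use p' q' pq pullback_arrows(10)[OF pb] in \<open>simp_all add: assoc\<close>)
  then obtain r where r: "r \<in> Mor C" "Dom C r = Fo K" "Cod C r = K" "p \<cdot> r = p'" "q \<cdot> r = q'"
    using pullback_lift[OF pb, of p' q'] p' q' by auto
  have r\<eta>: "r \<cdot> \<eta> K = Id C K"
  proof (rule pullback_eqI[OF pb])
    show "p \<cdot> (r \<cdot> \<eta> K) = p \<cdot> Id C K" using whisker1[OF r(4), of "\<eta> K"] r p' pq by simp
    show "q \<cdot> (r \<cdot> \<eta> K) = q \<cdot> Id C K" using whisker1[OF r(5), of "\<eta> K"] r q' pq by simp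
  qed (use r in auto)
  have "\<eta> K \<cdot> r = Id C (Fo K)"
    using iso_of_retraction(1)[OF E_regular_epi[OF unit_E[of K]], of r] r\<eta> r by simp
  then have "iso C r" using r r\<eta> by (auto simp: iso_def intro!: bexI[of _ "\<eta> K"])
  then have "r \<cdot> F k \<in> E"
    by (rule E_comp[OF reflection_E[OF k(1)] E_iso]) (use r k in auto)
  moreover have "h = r \<cdot> F k"
  proof (rule E_cancel[of "\<eta> (Dom C k)"])
    have "r \<cdot> F k \<cdot> \<eta> (Dom C k) = r \<cdot> \<eta> K \<cdot> k"
      using r k unit_natural[of k] by (simp add: assoc)
    then show "h \<cdot> \<eta> (Dom C k) = r \<cdot> F k \<cdot> \<eta> (Dom C k)" using r\<eta> h k by simp
  qed (use h k r in auto)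
  ultimately show ?thesis by simp
qed

end

section \<open>Double extensions\<close>

text \<open>Since \<open>double_exts\<close> turns a class of arrows of a category into a class of arrows of its category of
  extensions, both operations can be iterated; from \<open>E\<close>, the class of \<open>(m + 1)\<close>-fold extensions, they
  produce the next level of the tower.\<close>

definition ext_arrows :: "('o, 'm) cell_cat \<Rightarrow> ('o, 'm) cell set \<Rightarrow> ('o, 'm) cell_cat" where
  "ext_arrows C E = full_sub (arrow_cat C) E"

definition double_exts :: "('o, 'm) cell_cat \<Rightarrow> ('o, 'm) cell set \<Rightarrow> ('o, 'm) cell set" where
  "double_exts C E = {\<alpha> \<in> Mor (ext_arrows C E). double_extension C E (sq_dom \<alpha>) (sq_cod \<alpha>) (sq_top \<alpha>) (sq_bot \<alpha>)}"

lemma ext_arrows_simps [simp]: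
  "Dom (ext_arrows C E) = sq_dom" "Cod (ext_arrows C E) = sq_cod"
  "Id (ext_arrows C E) f = Square f f (Id C (Dom C f)) (Id C (Cod C f))"
  "Comp (ext_arrows C E) \<beta> \<alpha> = Square (sq_dom \<alpha>) (sq_cod \<beta>) (Comp C (sq_top \<beta>) (sq_top \<alpha>)) (Comp C (sq_bot \<beta>) (sq_bot \<alpha>))"
  by (simp_all add: ext_arrows_def full_sub_def arrow_cat_def)

lemma Ob_ext_arrows: "Ob (ext_arrows C E) = Mor C \<inter> E"
  by (simp add: ext_arrows_def full_sub_def arrow_cat_def)

lemma Mor_ext_arrows: "Square f g t b \<in> Mor (ext_arrows C E) \<longleftrightarrow> f \<in> E \<and> g \<in> E \<and> f \<in> Mor C \<and> g \<in> Mor C \<and>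
    t \<in> Mor C \<and> Dom C t = Dom C f \<and> Cod C t = Dom C g \<and> b \<in> Mor C \<and> Dom C b = Cod C f \<and> Cod C b = Cod C g \<and>
    Comp C g t = Comp C b f"
  by (auto simp: ext_arrows_def full_sub_def arrow_cat_def commutative_square_def)

lemma Mor_ext_arrowsE:
  assumes "\<alpha> \<in> Mor (ext_arrows C E)"
  obtains f g t b where "\<alpha> = Square f g t b" "Square f g t b \<in> Mor (ext_arrows C E)"
  using assms by (auto simp: ext_arrows_def full_sub_def arrow_cat_def)

lemma Mor_ext_arrows_Square:
  assumes "\<alpha> \<in> Mor (ext_arrows C E)" "sq_dom \<alpha> = f" "sq_cod \<alpha> = g"
  obtains t b where "\<alpha> = Square f g t b" "Square f g t b \<in> Mor (ext_arrows C E)"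
proof -
  obtain f' g' t b where "\<alpha> = Square f' g' t b" "Square f' g' t b \<in> Mor (ext_arrows C E)"
    using assms(1) by (rule Mor_ext_arrowsE)
  then show thesis using that[of t b] assms(2,3) by simp
qed

locale ext_cells = extensions C E for C :: "('o, 'm) cell_cat" (structure) and E
begin

abbreviation "D \<equiv> ext_arrows C E"
abbreviation "E2 \<equiv> double_exts C E"

lemma Ob_D [simp]: "Ob D = E"
  by (auto simp: Ob_ext_arrows)

lemma Mor_D: "Square f g t b \<in> Mor D \<longleftrightarrow> f \<in> E \<and> g \<in> E \<and>
    t \<in> Mor C \<and> Dom C t = Dom C f \<and> Cod C t = Dom C g \<and> b \<in> Mor C \<and> Dom C b = Cod C f \<and> Cod C b = Cod C g \<and>
    g \<cdot> t = b \<cdot> f"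
  by (auto simp: Mor_ext_arrows)

lemma Mor_D_E [simp]: "\<alpha> \<in> Mor D \<Longrightarrow> sq_dom \<alpha> \<in> E" "\<alpha> \<in> Mor D \<Longrightarrow> sq_cod \<alpha> \<in> E"
  by (erule Mor_ext_arrowsE, simp add: Mor_D)+

lemma Mor_D_arrows:
  assumes "\<alpha> \<in> Mor D"
  obtains f g t b where "\<alpha> = Square f g t b" "f \<in> E" "g \<in> E" "t \<in> Mor C" "Dom C t = Dom C f" "Cod C t = Dom C g"
    "b \<in> Mor C" "Dom C b = Cod C f" "Cod C b = Cod C g" "g \<cdot> t = b \<cdot> f"
  using assms by (rule Mor_ext_arrowsE) (auto simp: Mor_D)

lemma category_D: "category D"
  unfolding category_def
proof (intro conjI ballI impI)
  fix \<alpha> \<beta> assume \<alpha>: "\<alpha> \<in> Mor D" and \<beta>: "\<beta> \<in> Mor D" and eq: "Cod D \<alpha> = Dom D \<beta>"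
  from \<alpha> obtain f g t b where \<alpha>': "\<alpha> = Square f g t b" "Square f g t b \<in> Mor D" by (rule Mor_ext_arrowsE)
  from \<beta> obtain g' k s c where \<beta>': "\<beta> = Square g' k s c" "Square g' k s c \<in> Mor D" by (rule Mor_ext_arrowsE)
  have [simp]: "g' = g" using eq \<alpha>' \<beta>' by simp
  have fs: "f \<in> E" "g \<in> E" "k \<in> E" "t \<in> Mor C" "b \<in> Mor C" "s \<in> Mor C" "c \<in> Mor C" "Dom C t = Dom C f" "Cod C t = Dom C g"
    "Dom C b = Cod C f" "Cod C b = Cod C g" "Dom C s = Dom C g" "Cod C s = Dom C k" "Dom C c = Cod C g" "Cod C c = Cod C k"
    and e1: "g \<cdot> t = b \<cdot> f" and e2: "k \<cdot> s = c \<cdot> g" using \<alpha>' \<beta>' by (auto simp: Mor_D)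
  have "k \<cdot> (s \<cdot> t) = c \<cdot> (g \<cdot> t)" using fs by (intro whisker e2) auto
  then show "\<beta> \<cdot>\<^bsub>D\<^esub> \<alpha> \<in> hom D (Dom D \<alpha>) (Cod D \<beta>)"
    using fs \<alpha>' \<beta>' e1 by (simp add: Mor_D assoc)
next
  fix \<alpha> \<beta> \<gamma> assume \<alpha>: "\<alpha> \<in> Mor D" and \<beta>: "\<beta> \<in> Mor D" and \<gamma>: "\<gamma> \<in> Mor D"
    and "Cod D \<alpha> = Dom D \<beta>" "Cod D \<beta> = Dom D \<gamma>"
  then show "\<gamma> \<cdot>\<^bsub>D\<^esub> (\<beta> \<cdot>\<^bsub>D\<^esub> \<alpha>) = \<gamma> \<cdot>\<^bsub>D\<^esub> \<beta> \<cdot>\<^bsub>D\<^esub> \<alpha>"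
    by (elim Mor_D_arrows) (simp add: assoc)
next
  fix \<alpha> assume "\<alpha> \<in> Mor D"
  then show "\<alpha> \<cdot>\<^bsub>D\<^esub> Id D (Dom D \<alpha>) = \<alpha>" "Id D (Cod D \<alpha>) \<cdot>\<^bsub>D\<^esub> \<alpha> = \<alpha>" "Dom D \<alpha> \<in> Ob D" "Cod D \<alpha> \<in> Ob D"
    by (elim Mor_D_arrows, simp add: Mor_D)+
qed (simp add: Mor_D)

sublocale D: cat_on D
  using category_D by unfold_locales

lemma E2_Mor_D: "\<alpha> \<in> E2 \<Longrightarrow> \<alpha> \<in> Mor D"
  by (simp add: double_exts_def)

lemma E2E:
  assumes "\<alpha> \<in> E2"
  obtains f g t b where "\<alpha> = Square f g t b" "Square f g t b \<in> E2"
  using assms by (metis E2_Mor_D Mor_ext_arrowsE)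

lemma E2_arrows:
  assumes "Square f g t b \<in> E2"
  shows "f \<in> E" "g \<in> E" "t \<in> E" "b \<in> E" "Dom C t = Dom C f" "Cod C t = Dom C g" "Dom C b = Cod C f" "Cod C b = Cod C g"
    "g \<cdot> t = b \<cdot> f"
  using assms by (auto simp: double_exts_def double_extension_def Mor_D)

lemma E2I:
  assumes "f \<in> E" "g \<in> E" "t \<in> E" "b \<in> E" "Dom C t = Dom C f" "Cod C t = Dom C g" "Dom C b = Cod C f" "Cod C b = Cod C g"
    "g \<cdot> t = b \<cdot> f" and pb: "is_pullback C b g P p q" and c: "c \<in> E" "Dom C c = Dom C f" "Cod C c = P" "p \<cdot> c = f" "q \<cdot> c = t"
  shows "Square f g t b \<in> E2"
proof -
  have "p \<in> E" "q \<in> E" using E_pullback[OF assms(2) pb] E_pullback'[OF assms(4) pb] by auto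
  then have "\<exists>P p q c. is_pullback C b g P p q \<and> p \<in> E \<and> q \<in> E \<and> c \<in> hom C (Dom C f) P \<and> p \<cdot> c = f \<and> q \<cdot> c = t \<and> c \<in> E"
    using pb c by (intro exI[of _ P] exI[of _ p] exI[of _ q] exI[of _ c]) simp
  then have "double_extension C E f g t b"
    using assms(1-9) by (simp add: double_extension_def commutative_square_def)
  then show ?thesis using assms by (simp add: double_exts_def Mor_D)
qed

lemma E2_comparison:
  assumes \<alpha>: "Square f g t b \<in> E2" and pb: "is_pullback C b g P p q"
  obtains c where "c \<in> E" "Dom C c = Dom C f" "Cod C c = P" "p \<cdot> c = f" "q \<cdot> c = t"
proof -
  obtain P' p' q' c where pb': "is_pullback C b g P' p' q'" and c: "c \<in> E" "Dom C c = Dom C f" "Cod C c = P'"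
    "p' \<cdot> c = f" "q' \<cdot> c = t"
    using \<alpha> by (auto simp: double_exts_def double_extension_def)
  obtain i where i: "i \<in> Mor C" "Dom C i = P'" "Cod C i = P" "iso C i" "p \<cdot> i = p'" "q \<cdot> i = q'"
    by (rule pullback_unique[OF pb pb'])
  have "i \<cdot> c \<in> E" using i c by (simp add: E_comp E_iso)
  moreover have "p \<cdot> (i \<cdot> c) = f" "q \<cdot> (i \<cdot> c) = t"
    using whisker1[OF i(5), of c] whisker1[OF i(6), of c] i c pullback_arrows[OF pb] by simp_all
  ultimately show thesis using i c by (intro that[of "i \<cdot> c"]) auto
qed

lemma E2_of_pullback:
  assumes pb: "is_pullback C b g P f t" and "b \<in> E" "g \<in> E"
  shows "Square f g t b \<in> E2"
proof -
  note pullback_arrows[OF pb]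
  moreover have "f \<in> E" "t \<in> E" using E_pullback[OF assms(3) pb] E_pullback'[OF assms(2) pb] .
  moreover have "Id C P \<in> E" using calculation by (intro E_Id) auto
  ultimately show ?thesis using assms
    by (intro E2I[OF _ _ _ _ _ _ _ _ _ pb, where c = "Id C P"]) auto
qed

text \<open>The comparison map goes to the pullback of the bottom and the right-hand side, in which these two
  play symmetric roles.\<close>

lemma E2_swap:
  assumes "Square f g t b \<in> E2"
  shows "Square t b f g \<in> E2"
proof -
  note \<alpha> = E2_arrows[OF assms]
  obtain P p q where pb: "is_pullback C b g P p q"
    using E_pullback_exists[of g b] \<alpha> by auto
  obtain c where "c \<in> E" "Dom C c = Dom C f" "Cod C c = P" "p \<cdot> c = f" "q \<cdot> c = t"
    by (rule E2_comparison[OF assms pb])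
  then show ?thesis
    using \<alpha> by (intro E2I[OF _ _ _ _ _ _ _ _ _ pullback_sym[OF pb]]) auto
qed

text \<open>Pullbacks of commutative squares are computed separately on tops and bottoms. The induced arrow
  \<open>w\<close> has to be an extension in order to be an object of \<open>D\<close>; \<open>pullback_ext_arrows_E\<close> below shows
  that it is one as soon as one of the two squares is a double extension.\<close>

lemma pullback_ext_arrows:
  assumes \<phi>: "Square x z t1 b1 \<in> Mor D" and \<epsilon>: "Square y z t2 b2 \<in> Mor D"
    and pt: "is_pullback C t1 t2 Pt p q" and pb: "is_pullback C b1 b2 Pb p' q'"
    and w: "w \<in> E" "Dom C w = Pt" "Cod C w = Pb" "p' \<cdot> w = x \<cdot> p" "q' \<cdot> w = y \<cdot> q"
  shows "is_pullback D (Square x z t1 b1) (Square y z t2 b2) w (Square w x p p') (Square w y q q')"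
proof (rule D.pullbackI)
  note [simp] = pullback_arrows(1,2,4-9)[OF pt] pullback_arrows(1,2,4-9)[OF pb]
    w(1-3) \<phi>[unfolded Mor_D, THEN conjunct1] \<epsilon>[unfolded Mor_D, THEN conjunct1]
  note [simp] = \<phi>[unfolded Mor_D, THEN conjunct2, THEN conjunct1] E_Mor[OF w(1)]
  have ds [simp]: "Dom C t1 = Dom C x" "Dom C b1 = Cod C x" "Dom C t2 = Dom C y" "Dom C b2 = Cod C y"
     "Cod C t1 = Dom C z" "Cod C b1 = Cod C z" "Cod C t2 = Dom C z" "Cod C b2 = Cod C z"
    and sq: "z \<cdot> t1 = b1 \<cdot> x" "z \<cdot> t2 = b2 \<cdot> y"
    using \<phi> \<epsilon> by (auto simp: Mor_D)
  show "Square x z t1 b1 \<cdot>\<^bsub>D\<^esub> Square w x p p' = Square y z t2 b2 \<cdot>\<^bsub>D\<^esub> Square w y q q'"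
    using pullback_arrows(10)[OF pt] pullback_arrows(10)[OF pb] by simp
  show "Square w x p p' \<in> Mor D" "Square w y q q' \<in> Mor D"
    using w by (simp_all add: Mor_D)
  {
    fix \<sigma> \<rho> assume *: "\<sigma> \<in> Mor D" "\<rho> \<in> Mor D" "Dom D \<sigma> = Dom D \<rho>"
      "Cod D \<sigma> = Dom D (Square x z t1 b1)" "Cod D \<rho> = Dom D (Square y z t2 b2)"
      and eq: "Square x z t1 b1 \<cdot>\<^bsub>D\<^esub> \<sigma> = Square y z t2 b2 \<cdot>\<^bsub>D\<^esub> \<rho>"
    define s where "s = sq_dom \<rho>"
    obtain s1 s2 where \<sigma>: "\<sigma> = Square s x s1 s2" and s: "Square s x s1 s2 \<in> Mor D"
      by (rule Mor_ext_arrows_Square[of \<sigma> C E s x]) (use *(1,3,4) in \<open>simp_all add: s_def\<close>)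
    obtain r1 r2 where \<rho>: "\<rho> = Square s y r1 r2" and r: "Square s y r1 r2 \<in> Mor D"
      by (rule Mor_ext_arrows_Square[OF *(2) s_def[symmetric] *(5)[unfolded ext_arrows_simps cell.sel]])
    note sr = s r and [simp] = \<sigma> \<rho>
    have sr' [simp]: "s \<in> E" "s1 \<in> Mor C" "s2 \<in> Mor C" "r1 \<in> Mor C" "r2 \<in> Mor C" "Dom C s1 = Dom C s" "Dom C r1 = Dom C s"
      "Dom C s2 = Cod C s" "Dom C r2 = Cod C s" "Cod C s1 = Dom C x" "Cod C s2 = Cod C x" "Cod C r1 = Dom C y" "Cod C r2 = Cod C y"
      and sr'': "x \<cdot> s1 = s2 \<cdot> s" "y \<cdot> r1 = r2 \<cdot> s"
      using sr by (auto simp: Mor_D)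
    obtain h1 where h1: "h1 \<in> Mor C" "Dom C h1 = Dom C s1" "Cod C h1 = Pt" "p \<cdot> h1 = s1" "q \<cdot> h1 = r1"
      by (rule pullback_lift[OF pt, of s1 r1]) (use eq in auto)
    obtain h2 where h2: "h2 \<in> Mor C" "Dom C h2 = Dom C s2" "Cod C h2 = Pb" "p' \<cdot> h2 = s2" "q' \<cdot> h2 = r2"
      by (rule pullback_lift[OF pb, of s2 r2]) (use eq in auto)
    have "w \<cdot> h1 = h2 \<cdot> s"
    proof (rule pullback_eqI[OF pb])
      show "p' \<cdot> (w \<cdot> h1) = p' \<cdot> (h2 \<cdot> s)"
        using whisker[OF w(4), of h1] whisker1[OF h2(4), of s] h1 h2 sr'' by simp
      show "q' \<cdot> (w \<cdot> h1) = q' \<cdot> (h2 \<cdot> s)"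
        using whisker[OF w(5), of h1] whisker1[OF h2(5), of s] h1 h2 sr'' by simp
    qed (use h1 h2 in simp_all)
    then show "\<exists>h. h \<in> Mor D \<and> Dom D h = Dom D \<rho> \<and> Cod D h = w \<and>
        Square w x p p' \<cdot>\<^bsub>D\<^esub> h = \<sigma> \<and> Square w y q q' \<cdot>\<^bsub>D\<^esub> h = \<rho>"
      using h1 h2 by (intro exI[of _ "Square s w h1 h2"]) (simp add: Mor_D)
  next
    fix h k assume *: "h \<in> Mor D" "k \<in> Mor D" "Dom D h = Dom D k" "Cod D h = w" "Cod D k = w"
      and eq: "Square w x p p' \<cdot>\<^bsub>D\<^esub> h = Square w x p p' \<cdot>\<^bsub>D\<^esub> k" "Square w y q q' \<cdot>\<^bsub>D\<^esub> h = Square w y q q' \<cdot>\<^bsub>D\<^esub> k"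
    define s where "s = sq_dom k"
    obtain h1 h2 where h: "h = Square s w h1 h2" and m1: "Square s w h1 h2 \<in> Mor D"
      by (rule Mor_ext_arrows_Square[of h C E s w]) (use *(1,3,4) in \<open>simp_all add: s_def\<close>)
    obtain k1 k2 where k: "k = Square s w k1 k2" and m2: "Square s w k1 k2 \<in> Mor D"
      by (rule Mor_ext_arrows_Square[OF *(2) s_def[symmetric] *(5)[unfolded ext_arrows_simps]])
    note m = m1 m2 and [simp] = h k
    have "h1 = k1" by (rule pullback_eqI[OF pt]) (use eq m in \<open>auto simp: Mor_D\<close>)
    moreover have "h2 = k2" by (rule pullback_eqI[OF pb]) (use eq m in \<open>auto simp: Mor_D\<close>)
    ultimately show "h = k" by simp
  }
qed (use \<phi> \<epsilon> in simp_all)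

text \<open>The arrow \<open>w\<close> between the two componentwise pullbacks is an extension: it is the composite of
  a pullback of the comparison map \<open>c\<close> of the double extension with a pullback of \<open>x\<close>.\<close>

lemma pullback_ext_arrows_E:
  assumes \<phi>: "Square x z t1 b1 \<in> Mor D" and \<epsilon>: "Square y z t2 b2 \<in> E2"
    and pt: "is_pullback C t1 t2 Pt p q" and pb: "is_pullback C b1 b2 Pb p' q'"
    and w: "w \<in> Mor C" "Dom C w = Pt" "Cod C w = Pb" "p' \<cdot> w = x \<cdot> p" "q' \<cdot> w = y \<cdot> q"
  shows "w \<in> E"
proof -
  note [simp] = pullback_arrows(1,2,4-9,11)[OF pt] pullback_arrows(1,2,4-9,11)[OF pb] w(1-3)
  have [simp]: "x \<in> E" "y \<in> E" "z \<in> E" "Dom C t1 = Dom C x" "Dom C b1 = Cod C x" "Dom C t2 = Dom C y" "Dom C b2 = Cod C y"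
     "Cod C t1 = Dom C z" "Cod C b1 = Cod C z" "Cod C t2 = Dom C z" "Cod C b2 = Cod C z"
    and sq: "z \<cdot> t1 = b1 \<cdot> x" "z \<cdot> t2 = b2 \<cdot> y"
    using \<phi> E2_arrows[OF \<epsilon>] by (auto simp: Mor_D)
  obtain Q r s where Q: "is_pullback C b2 z Q r s"
    using E_pullback_exists[of z b2] by auto
  obtain c where c: "c \<in> E" "Dom C c = Dom C y" "Cod C c = Q" "r \<cdot> c = y" "s \<cdot> c = t2"
    by (rule E2_comparison[OF \<epsilon> Q])
  obtain N n1 n2 where N: "is_pullback C p' x N n1 n2" and n1: "n1 \<in> E"
    using pullback_along_E[of x p'] by auto
  note [simp] = pullback_arrows(1,2,4-9,11)[OF Q] pullback_arrows(1,2,4-9,11)[OF N] c(1-3)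
  note eqs = pullback_arrows(10)[OF pt] pullback_arrows(10)[OF pb] pullback_arrows(10)[OF Q] pullback_arrows(10)[OF N]
  have "b2 \<cdot> (q' \<cdot> n1) = b1 \<cdot> (p' \<cdot> n1)" using whisker[OF eqs(2), of n1] by simp
  also have "\<dots> = z \<cdot> (t1 \<cdot> n2)" using whisker[OF sq(1), of n2] eqs(4) by simp
  finally obtain h where h: "h \<in> Mor C" "Dom C h = N" "Cod C h = Q" "r \<cdot> h = q' \<cdot> n1" "s \<cdot> h = t1 \<cdot> n2"
    using pullback_lift[OF Q, of "q' \<cdot> n1" "t1 \<cdot> n2"] by auto
  obtain d where d: "d \<in> Mor C" "Dom C d = Pt" "Cod C d = N" "n1 \<cdot> d = w" "n2 \<cdot> d = p"
    using pullback_lift[OF N, of w p] w(4) by auto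
  note [simp] = h(1-3) d(1-3)
  have "is_pullback C h c Pt d q"
  proof (rule pullbackI)
    show "h \<cdot> d = c \<cdot> q"
    proof (rule pullback_eqI[OF Q])
      show "r \<cdot> (h \<cdot> d) = r \<cdot> (c \<cdot> q)"
        using whisker[OF h(4), of d] whisker1[OF c(4), of q] d w by simp
      show "s \<cdot> (h \<cdot> d) = s \<cdot> (c \<cdot> q)"
        using whisker[OF h(5), of d] whisker1[OF c(5), of q] d eqs(1) by simp
    qed simp_all
  next
    fix u v assume uv: "u \<in> Mor C" "v \<in> Mor C" "Dom C u = Dom C v" "Cod C u = Dom C h" "Cod C v = Dom C c"
      and eq: "h \<cdot> u = c \<cdot> v"
    have cu: "Cod C u = N" and cv: "Cod C v = Dom C y" using uv by simp_all
    have "t1 \<cdot> (n2 \<cdot> u) = s \<cdot> (h \<cdot> u)" using whisker[OF h(5), of u] uv(1) cu by simp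
    also have "\<dots> = t2 \<cdot> v" unfolding eq using whisker1[OF c(5), of v] uv(2) cv by simp
    finally obtain k where k: "k \<in> Mor C" "Dom C k = Dom C v" "Cod C k = Pt" "p \<cdot> k = n2 \<cdot> u" "q \<cdot> k = v"
      using pullback_lift[OF pt, of "n2 \<cdot> u" v] uv(1-3) cu cv by auto
    have dk: "n1 \<cdot> (d \<cdot> k) = w \<cdot> k" "n2 \<cdot> (d \<cdot> k) = n2 \<cdot> u"
      using whisker1[OF d(4), of k] whisker1[OF d(5), of k] k by simp_all
    have "w \<cdot> k = n1 \<cdot> u"
    proof (rule pullback_eqI[OF pb])
      show "p' \<cdot> (w \<cdot> k) = p' \<cdot> (n1 \<cdot> u)"
        using whisker[OF w(4), of k] whisker[OF eqs(4), of u] uv(1) cu k by simp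
      have "q' \<cdot> (n1 \<cdot> u) = r \<cdot> (h \<cdot> u)" using whisker[OF h(4), of u] uv(1) cu by simp
      also have "\<dots> = y \<cdot> v" unfolding eq using whisker1[OF c(4), of v] uv(2) cv by simp
      finally show "q' \<cdot> (w \<cdot> k) = q' \<cdot> (n1 \<cdot> u)"
        using whisker[OF w(5), of k] k by simp
    qed (use uv(1-3) cu k in simp_all)
    then have "d \<cdot> k = u"
      using pullback_eqI[OF N, of "d \<cdot> k" u] dk uv(1-3) cu k by simp
    then show "\<exists>k. k \<in> Mor C \<and> Dom C k = Dom C v \<and> Cod C k = Pt \<and> d \<cdot> k = u \<and> q \<cdot> k = v"
      using k by auto
  next
    fix a b assume ab: "a \<in> Mor C" "b \<in> Mor C" "Dom C a = Dom C b" "Cod C a = Pt" "Cod C b = Pt"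
      and e: "d \<cdot> a = d \<cdot> b" "q \<cdot> a = q \<cdot> b"
    have "p \<cdot> a = p \<cdot> b"
      using whisker1[OF d(5), of a] whisker1[OF d(5), of b] ab e by simp
    then show "a = b" using pullback_eqI[OF pt ab] e by simp
  qed simp_all
  then have "d \<in> E" by (rule E_pullback[OF c(1)])
  then show ?thesis using E_comp[of d n1] n1 d by simp
qed

text \<open>Hence pullbacks along double extensions in the category of extensions are componentwise.\<close>

lemma pullback_along_E2:
  assumes \<phi>: "Square x z t1 b1 \<in> Mor D" and \<epsilon>: "Square y z t2 b2 \<in> E2"
  obtains w p p' q q' where
    "is_pullback D (Square x z t1 b1) (Square y z t2 b2) w (Square w x p p') (Square w y q q')"
    "is_pullback C t1 t2 (Dom C w) p q" "is_pullback C b1 b2 (Cod C w) p' q'"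
proof -
  have [simp]: "x \<in> E" "y \<in> E" "z \<in> E" "t1 \<in> Mor C" "b1 \<in> Mor C" "t2 \<in> E" "b2 \<in> E" "Dom C t1 = Dom C x" "Dom C b1 = Cod C x" "Dom C t2 = Dom C y" "Dom C b2 = Cod C y"
     "Cod C t1 = Dom C z" "Cod C b1 = Cod C z" "Cod C t2 = Dom C z" "Cod C b2 = Cod C z"
    and sq: "z \<cdot> t1 = b1 \<cdot> x" "z \<cdot> t2 = b2 \<cdot> y"
    using \<phi> E2_arrows[OF \<epsilon>] by (auto simp: Mor_D)
  obtain Pt p q where pt: "is_pullback C t1 t2 Pt p q"
    using E_pullback_exists[of t2 t1] by auto
  obtain Pb p' q' where pb: "is_pullback C b1 b2 Pb p' q'"
    using E_pullback_exists[of b2 b1] by auto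
  note [simp] = pullback_arrows(1,2,4-9,11)[OF pt] pullback_arrows(1,2,4-9,11)[OF pb]
  have "b1 \<cdot> (x \<cdot> p) = b2 \<cdot> (y \<cdot> q)"
    using whisker[OF sq(1), of p] whisker[OF sq(2), of q] pullback_arrows(10)[OF pt] by simp
  then obtain w where w: "w \<in> Mor C" "Dom C w = Pt" "Cod C w = Pb" "p' \<cdot> w = x \<cdot> p" "q' \<cdot> w = y \<cdot> q"
    using pullback_lift[OF pb, of "x \<cdot> p" "y \<cdot> q"] by auto
  have "w \<in> E" by (rule pullback_ext_arrows_E[OF \<phi> \<epsilon> pt pb w])
  from pullback_ext_arrows[OF \<phi> E2_Mor_D[OF \<epsilon>] pt pb this w(2-5)] show thesis
    using pt pb w by (intro that) auto
qed

lemma iso_ext_arrows: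
  assumes "iso D (Square x y t b)"
  shows "iso C t" "iso C b"
proof -
  obtain \<beta> where \<beta>: "\<beta> \<in> Mor D" "sq_dom \<beta> = y" "sq_cod \<beta> = x" "\<beta> \<cdot>\<^bsub>D\<^esub> Square x y t b = Id D x"
    "Square x y t b \<cdot>\<^bsub>D\<^esub> \<beta> = Id D y" and m: "Square x y t b \<in> Mor D"
    using assms unfolding iso_def by auto
  obtain s c where "\<beta> = Square y x s c" "Square y x s c \<in> Mor D"
    by (rule Mor_ext_arrows_Square[OF \<beta>(1-3)])
  with \<beta>(4,5) m show "iso C t" "iso C b"
    unfolding iso_def by (auto simp: Mor_D intro: bexI[of _ s] bexI[of _ c])
qed

text \<open>A pullback is unique up to isomorphism, and isomorphisms in \<open>D\<close> are componentwise.\<close>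

lemma pullback_ext_arrowsD:
  assumes pb: "is_pullback D (Square x z t1 b1) (Square y z t2 b2) w (Square w x p p') (Square w y q q')"
    and \<epsilon>: "Square y z t2 b2 \<in> E2"
  shows "is_pullback C t1 t2 (Dom C w) p q" "is_pullback C b1 b2 (Cod C w) p' q'"
proof -
  obtain v r r' s s' where
    v: "is_pullback D (Square x z t1 b1) (Square y z t2 b2) v (Square v x r r') (Square v y s s')"
    "is_pullback C t1 t2 (Dom C v) r s" "is_pullback C b1 b2 (Cod C v) r' s'"
    by (rule pullback_along_E2[OF D.pullback_arrows(1)[OF pb] \<epsilon>])
  obtain i where i: "i \<in> Mor D" "Dom D i = w" "Cod D i = v" "iso D i"
      "Square v x r r' \<cdot>\<^bsub>D\<^esub> i = Square w x p p'" "Square v y s s' \<cdot>\<^bsub>D\<^esub> i = Square w y q q'"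
    by (rule D.pullback_unique[OF v(1) pb])
  obtain i1 i2 where i': "i = Square w v i1 i2"
    by (rule Mor_ext_arrows_Square[OF i(1), of w v]) (use i(2,3) in simp_all)
  have iso: "iso C i1" "iso C i2" using i(4) iso_ext_arrows unfolding i' by auto
  have m: "i1 \<in> Mor C" "i2 \<in> Mor C" "Cod C i1 = Dom C v" "Cod C i2 = Cod C v" "Dom C i1 = Dom C w" "Dom C i2 = Cod C w"
    using i(1) unfolding i' by (auto simp: Mor_D)
  show "is_pullback C t1 t2 (Dom C w) p q" "is_pullback C b1 b2 (Cod C w) p' q'"
    using pullback_iso[OF v(2) _ _ iso(1)] pullback_iso[OF v(3) _ _ iso(2)] m i(5,6) unfolding i' by auto
qed

end

section \<open>Threefold extensions as cubes\<close>

text \<open>The part of a cube away from its initial vertex has three vertices of depth one, and its limit is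
  determined by the projections \<open>l\<close>, \<open>m\<close>, \<open>k\<close> to them. The six arrows are the edges out of these
  vertices: \<open>u'\<close>, \<open>q\<close> from the first, \<open>f'\<close>, \<open>p'\<close> from the second, \<open>g\<close>, \<open>v\<close> from the third, and they meet
  in pairs in the three vertices of depth two. The terminal vertex imposes no condition, as
  the cube commutes. No direction of the cube is preferred, which makes the two swaps below evident.\<close>

definition punctured_limit :: "('o, 'm) cat \<Rightarrow> 'm \<Rightarrow> 'm \<Rightarrow> 'm \<Rightarrow> 'm \<Rightarrow> 'm \<Rightarrow> 'm \<Rightarrow> 'o \<Rightarrow> 'm \<Rightarrow> 'm \<Rightarrow> 'm \<Rightarrow> bool" where
  "punctured_limit C u' f' q g p' v L l m k \<longleftrightarrow>
     u' \<in> Mor C \<and> f' \<in> Mor C \<and> q \<in> Mor C \<and> g \<in> Mor C \<and> p' \<in> Mor C \<and> v \<in> Mor C \<and>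
     Dom C q = Dom C u' \<and> Dom C p' = Dom C f' \<and> Dom C v = Dom C g \<and>
     Cod C f' = Cod C u' \<and> Cod C g = Cod C q \<and> Cod C v = Cod C p' \<and>
     l \<in> hom C L (Dom C u') \<and> m \<in> hom C L (Dom C f') \<and> k \<in> hom C L (Dom C g) \<and>
     Comp C u' l = Comp C f' m \<and> Comp C q l = Comp C g k \<and> Comp C p' m = Comp C v k \<and>
     (\<forall>Z x y z. x \<in> hom C Z (Dom C u') \<longrightarrow> y \<in> hom C Z (Dom C f') \<longrightarrow> z \<in> hom C Z (Dom C g) \<longrightarrow>
        Comp C u' x = Comp C f' y \<longrightarrow> Comp C q x = Comp C g z \<longrightarrow> Comp C p' y = Comp C v z \<longrightarrow>
        (\<exists>!h. h \<in> hom C Z L \<and> Comp C l h = x \<and> Comp C m h = y \<and> Comp C k h = z))"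

context cat_on
begin

lemma punctured_limit_arrows:
  assumes "punctured_limit C u' f' q g p' v L l m k"
  shows "u' \<in> Mor C" "f' \<in> Mor C" "q \<in> Mor C" "g \<in> Mor C" "p' \<in> Mor C" "v \<in> Mor C"
    "Dom C q = Dom C u'" "Dom C p' = Dom C f'" "Dom C v = Dom C g"
    "Cod C f' = Cod C u'" "Cod C g = Cod C q" "Cod C v = Cod C p'"
    "l \<in> Mor C" "m \<in> Mor C" "k \<in> Mor C" "Dom C l = L" "Dom C m = L" "Dom C k = L"
    "Cod C l = Dom C u'" "Cod C m = Dom C f'" "Cod C k = Dom C g"
    "u' \<cdot> l = f' \<cdot> m" "q \<cdot> l = g \<cdot> k" "p' \<cdot> m = v \<cdot> k"
  using assms by (auto simp: punctured_limit_def)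

lemma punctured_limit_lift:
  assumes h: "punctured_limit C u' f' q g p' v L l m k"
    and "x \<in> Mor C" "y \<in> Mor C" "z \<in> Mor C" "Dom C x = Dom C z" "Dom C y = Dom C z"
    "Cod C x = Dom C u'" "Cod C y = Dom C f'" "Cod C z = Dom C g"
    "u' \<cdot> x = f' \<cdot> y" "q \<cdot> x = g \<cdot> z" "p' \<cdot> y = v \<cdot> z"
  obtains h where "h \<in> Mor C" "Dom C h = Dom C z" "Cod C h = L" "l \<cdot> h = x" "m \<cdot> h = y" "k \<cdot> h = z"
proof -
  have "x \<in> hom C (Dom C z) (Dom C u')" "y \<in> hom C (Dom C z) (Dom C f')" "z \<in> hom C (Dom C z) (Dom C g)"
    using assms by auto
  then have "\<exists>!h. h \<in> hom C (Dom C z) L \<and> l \<cdot> h = x \<and> m \<cdot> h = y \<and> k \<cdot> h = z"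
    using h assms(10-12) unfolding punctured_limit_def by blast
  then show thesis using that by auto
qed

lemma punctured_limit_eqI:
  assumes h: "punctured_limit C u' f' q g p' v L l m k"
    and "a \<in> Mor C" "b \<in> Mor C" "Dom C a = Dom C b" "Cod C a = L" "Cod C b = L"
    "l \<cdot> a = l \<cdot> b" "m \<cdot> a = m \<cdot> b" "k \<cdot> a = k \<cdot> b"
  shows "a = b"
proof -
  note [simp] = punctured_limit_arrows(1-21)[OF h] and eqs = punctured_limit_arrows(22-24)[OF h]
  have "l \<cdot> a \<in> hom C (Dom C a) (Dom C u')" "m \<cdot> a \<in> hom C (Dom C a) (Dom C f')" "k \<cdot> a \<in> hom C (Dom C a) (Dom C g)"
    "u' \<cdot> (l \<cdot> a) = f' \<cdot> (m \<cdot> a)" "q \<cdot> (l \<cdot> a) = g \<cdot> (k \<cdot> a)" "p' \<cdot> (m \<cdot> a) = v \<cdot> (k \<cdot> a)"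
    using assms(2,5) whisker[OF eqs(1), of a] whisker[OF eqs(2), of a] whisker[OF eqs(3), of a] by auto
  then have "\<exists>!h. h \<in> hom C (Dom C a) L \<and> l \<cdot> h = l \<cdot> a \<and> m \<cdot> h = m \<cdot> a \<and> k \<cdot> h = k \<cdot> a"
    using h unfolding punctured_limit_def by blast
  then show ?thesis using assms by auto
qed

lemma punctured_limitI:
  assumes "u' \<in> Mor C" "f' \<in> Mor C" "q \<in> Mor C" "g \<in> Mor C" "p' \<in> Mor C" "v \<in> Mor C"
    "Dom C q = Dom C u'" "Dom C p' = Dom C f'" "Dom C v = Dom C g"
    "Cod C f' = Cod C u'" "Cod C g = Cod C q" "Cod C v = Cod C p'"
    "l \<in> Mor C" "m \<in> Mor C" "k \<in> Mor C" "Dom C l = L" "Dom C m = L" "Dom C k = L"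
    "Cod C l = Dom C u'" "Cod C m = Dom C f'" "Cod C k = Dom C g"
    "u' \<cdot> l = f' \<cdot> m" "q \<cdot> l = g \<cdot> k" "p' \<cdot> m = v \<cdot> k"
    and ex: "\<And>x y z. x \<in> Mor C \<Longrightarrow> y \<in> Mor C \<Longrightarrow> z \<in> Mor C \<Longrightarrow> Dom C x = Dom C z \<Longrightarrow> Dom C y = Dom C z \<Longrightarrow>
        Cod C x = Dom C u' \<Longrightarrow> Cod C y = Dom C f' \<Longrightarrow> Cod C z = Dom C g \<Longrightarrow>
        u' \<cdot> x = f' \<cdot> y \<Longrightarrow> q \<cdot> x = g \<cdot> z \<Longrightarrow> p' \<cdot> y = v \<cdot> z \<Longrightarrow>
        \<exists>h. h \<in> Mor C \<and> Dom C h = Dom C z \<and> Cod C h = L \<and> l \<cdot> h = x \<and> m \<cdot> h = y \<and> k \<cdot> h = z"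
    and un: "\<And>a b. a \<in> Mor C \<Longrightarrow> b \<in> Mor C \<Longrightarrow> Dom C a = Dom C b \<Longrightarrow> Cod C a = L \<Longrightarrow> Cod C b = L \<Longrightarrow>
        l \<cdot> a = l \<cdot> b \<Longrightarrow> m \<cdot> a = m \<cdot> b \<Longrightarrow> k \<cdot> a = k \<cdot> b \<Longrightarrow> a = b"
  shows "punctured_limit C u' f' q g p' v L l m k"
  unfolding punctured_limit_def
proof (intro conjI allI impI)
  fix Z x y z assume a: "x \<in> hom C Z (Dom C u')" "y \<in> hom C Z (Dom C f')" "z \<in> hom C Z (Dom C g)"
    "u' \<cdot> x = f' \<cdot> y" "q \<cdot> x = g \<cdot> z" "p' \<cdot> y = v \<cdot> z"
  obtain h where "h \<in> Mor C" "Dom C h = Z" "Cod C h = L" "l \<cdot> h = x" "m \<cdot> h = y" "k \<cdot> h = z"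
    using ex[of x y z] a by auto
  then show "\<exists>!h. h \<in> hom C Z L \<and> l \<cdot> h = x \<and> m \<cdot> h = y \<and> k \<cdot> h = z"
    using un by (intro ex1I[of _ h]) auto
qed (use assms(1-24) in simp_all)

lemma punctured_limit_swap_xy:
  assumes h: "punctured_limit C u' f' q g p' v L l m k"
  shows "punctured_limit C f' u' p' v q g L m l k"
proof (rule punctured_limitI)
  note a = punctured_limit_arrows[OF h]
  show "\<exists>h. h \<in> Mor C \<and> Dom C h = Dom C z \<and> Cod C h = L \<and> m \<cdot> h = x \<and> l \<cdot> h = y \<and> k \<cdot> h = z"
    if "x \<in> Mor C" "y \<in> Mor C" "z \<in> Mor C" "Dom C x = Dom C z" "Dom C y = Dom C z"
      "Cod C x = Dom C f'" "Cod C y = Dom C u'" "Cod C z = Dom C v"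
      "f' \<cdot> x = u' \<cdot> y" "p' \<cdot> x = v \<cdot> z" "q \<cdot> y = g \<cdot> z" for x y z
    by (rule punctured_limit_lift[OF h, of y x z]) (use that a in auto)
  show "x = y" if "x \<in> Mor C" "y \<in> Mor C" "Dom C x = Dom C y" "Cod C x = L" "Cod C y = L"
      "m \<cdot> x = m \<cdot> y" "l \<cdot> x = l \<cdot> y" "k \<cdot> x = k \<cdot> y" for x y
    by (rule punctured_limit_eqI[OF h that(1-5,7,6,8)])
qed (use punctured_limit_arrows[OF h] in simp_all)

lemma punctured_limit_swap_yz:
  assumes h: "punctured_limit C u' f' q g p' v L l m k"
  shows "punctured_limit C q g u' f' v p' L l k m"
proof (rule punctured_limitI)
  note a = punctured_limit_arrows[OF h]
  show "\<exists>h. h \<in> Mor C \<and> Dom C h = Dom C z \<and> Cod C h = L \<and> l \<cdot> h = x \<and> k \<cdot> h = y \<and> m \<cdot> h = z"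
    if "x \<in> Mor C" "y \<in> Mor C" "z \<in> Mor C" "Dom C x = Dom C z" "Dom C y = Dom C z"
      "Cod C x = Dom C q" "Cod C y = Dom C g" "Cod C z = Dom C f'"
      "q \<cdot> x = g \<cdot> y" "u' \<cdot> x = f' \<cdot> z" "v \<cdot> y = p' \<cdot> z" for x y z
    by (rule punctured_limit_lift[OF h, of x z y]) (use that a in auto)
  show "x = y" if "x \<in> Mor C" "y \<in> Mor C" "Dom C x = Dom C y" "Cod C x = L" "Cod C y = L"
      "l \<cdot> x = l \<cdot> y" "k \<cdot> x = k \<cdot> y" "m \<cdot> x = m \<cdot> y" for x y
    by (rule punctured_limit_eqI[OF h that(1-6,8,7)])
qed (use punctured_limit_arrows[OF h] in simp_all)

lemma punctured_limit_unique:
  assumes 1: "punctured_limit C u' f' q g p' v L l m k" and 2: "punctured_limit C u' f' q g p' v L' l' m' k'"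
  obtains i where "i \<in> Mor C" "Dom C i = L'" "Cod C i = L" "iso C i" "l \<cdot> i = l'" "m \<cdot> i = m'" "k \<cdot> i = k'"
proof -
  note h1 = punctured_limit_arrows[OF 1] and h2 = punctured_limit_arrows[OF 2]
  obtain i where i: "i \<in> Mor C" "Dom C i = L'" "Cod C i = L" "l \<cdot> i = l'" "m \<cdot> i = m'" "k \<cdot> i = k'"
    using punctured_limit_lift[OF 1, of l' m' k'] h2 by auto
  obtain j where j: "j \<in> Mor C" "Dom C j = L" "Cod C j = L'" "l' \<cdot> j = l" "m' \<cdot> j = m" "k' \<cdot> j = k"
    using punctured_limit_lift[OF 2, of l m k] h1 by auto
  have L: "L \<in> Ob C" "L' \<in> Ob C" using i by auto
  have "i \<cdot> j = Id C L"
    by (rule punctured_limit_eqI[OF 1])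
      (use i(1-3) j(1-3) L h1(13-21) whisker1[OF i(4), of j] whisker1[OF i(5), of j] whisker1[OF i(6), of j] j(4-6) in simp_all)
  moreover have "j \<cdot> i = Id C L'"
    by (rule punctured_limit_eqI[OF 2])
      (use i(1-3) j(1-3) L h2(13-21) whisker1[OF j(4), of i] whisker1[OF j(5), of i] whisker1[OF j(6), of i] i(4-6) in simp_all)
  ultimately have "iso C i" using i j by (auto simp: iso_def intro!: bexI[of _ j])
  then show thesis using that i by blast
qed

end

text \<open>The cube with edges \<open>f\<close>, \<open>f'\<close>, \<open>g\<close>, \<open>g'\<close> in the first direction, \<open>u\<close>, \<open>u'\<close>, \<open>v\<close>, \<open>v'\<close> in the
  second and \<open>p\<close>, \<open>q\<close>, \<open>p'\<close>, \<open>q'\<close> in the third, seen as an arrow in the third direction from the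
  square \<open>f \<rightarrow> f'\<close> to the square \<open>g \<rightarrow> g'\<close>.\<close>

abbreviation cube where
  "cube f f' u u' g g' v v' p q p' q' \<equiv>
     Square (Square f f' u u') (Square g g' v v') (Square f g p q) (Square f' g' p' q')"

text \<open>That double extensions are again extensions in the category \<open>D\<close> is a hypothesis here: in a tower it is part
  of the Galois structure on the next level.\<close>

locale cubes = ext_cells C E + D: extensions "ext_arrows C E" "double_exts C E"
  for C :: "('o, 'm) cell_cat" (structure) and E
begin

sublocale D: ext_cells D E2
  by unfold_locales

abbreviation "E3 \<equiv> double_exts D E2"

lemma E3_arrows:
  assumes "cube f f' u u' g g' v v' p q p' q' \<in> E3"
  shows "Square f f' u u' \<in> E2" "Square g g' v v' \<in> E2" "Square f g p q \<in> E2" "Square f' g' p' q' \<in> E2"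
    "v \<cdot> p = p' \<cdot> u" "v' \<cdot> q = q' \<cdot> u'"
  using D.E2_arrows[OF assms] by auto

lemma E3_cube:
  assumes "\<Phi> \<in> E3" "sq_dom \<Phi> = Square f f' u u'" "sq_cod \<Phi> = Square g g' v v'"
  obtains p q p' q' where "\<Phi> = cube f f' u u' g g' v v' p q p' q'"
proof -
  obtain \<tau> \<beta> t b where \<Phi>: "\<Phi> = Square \<tau> \<beta> t b" "Square \<tau> \<beta> t b \<in> E3"
    using assms(1) by (rule D.E2E)
  note a = D.E2_arrows[OF \<Phi>(2)]
  obtain p q where "t = Square f g p q"
    by (rule Mor_ext_arrows_Square[OF E2_Mor_D[OF a(3)], of f g]) (use a \<Phi> assms in auto)
  moreover obtain p' q' where "b = Square f' g' p' q'"
    by (rule Mor_ext_arrows_Square[OF E2_Mor_D[OF a(4)], of f' g']) (use a \<Phi> assms in auto)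
  ultimately show thesis using that \<Phi> assms by auto
qed

text \<open>The pullback in \<open>D\<close> of the codomain square of a cube along its bottom square, with the comparison
  \<open>(\<zeta>1, \<zeta>2)\<close> from the initial edge \<open>f\<close> to it.\<close>

lemma cube_comparison:
  assumes \<tau>: "Square f f' u u' \<in> Mor D" and \<beta>: "Square g g' v v' \<in> E2" and t: "Square f g p q \<in> Mor D"
    and b: "Square f' g' p' q' \<in> Mor D" and eq: "v \<cdot> p = p' \<cdot> u" "v' \<cdot> q = q' \<cdot> u'"
  obtains W \<pi>1 \<pi>2 \<kappa>1 \<kappa>2 \<zeta>1 \<zeta>2 where
    "is_pullback D (Square f' g' p' q') (Square g g' v v') W (Square W f' \<pi>1 \<pi>2) (Square W g \<kappa>1 \<kappa>2)"
    "is_pullback C p' v (Dom C W) \<pi>1 \<kappa>1" "is_pullback C q' v' (Cod C W) \<pi>2 \<kappa>2"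
    "Square f W \<zeta>1 \<zeta>2 \<in> Mor D" "\<pi>1 \<cdot> \<zeta>1 = u" "\<kappa>1 \<cdot> \<zeta>1 = p" "\<pi>2 \<cdot> \<zeta>2 = u'" "\<kappa>2 \<cdot> \<zeta>2 = q"
proof -
  obtain W \<pi>1 \<pi>2 \<kappa>1 \<kappa>2 where
    W: "is_pullback D (Square f' g' p' q') (Square g g' v v') W (Square W f' \<pi>1 \<pi>2) (Square W g \<kappa>1 \<kappa>2)"
    "is_pullback C p' v (Dom C W) \<pi>1 \<kappa>1" "is_pullback C q' v' (Cod C W) \<pi>2 \<kappa>2"
    by (rule pullback_along_E2[OF b \<beta>])
  obtain \<zeta> where \<zeta>: "\<zeta> \<in> Mor D" "Dom D \<zeta> = f" "Cod D \<zeta> = W" "Square W f' \<pi>1 \<pi>2 \<cdot>\<^bsub>D\<^esub> \<zeta> = Square f f' u u'"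
    "Square W g \<kappa>1 \<kappa>2 \<cdot>\<^bsub>D\<^esub> \<zeta> = Square f g p q"
    using D.pullback_lift[OF W(1), of "Square f f' u u'" "Square f g p q"] \<tau> t eq by auto
  obtain \<zeta>1 \<zeta>2 where "\<zeta> = Square f W \<zeta>1 \<zeta>2" "Square f W \<zeta>1 \<zeta>2 \<in> Mor D"
    by (rule Mor_ext_arrows_Square[OF \<zeta>(1), of f W]) (use \<zeta>(2,3) in auto)
  then show thesis using that W \<zeta>(4,5) by auto
qed

text \<open>Tops and bottoms of \<open>W\<close> are pullbacks of opposite faces. Pulling \<open>W\<close> back along \<open>\<zeta>2\<close> adds the
  vertex at the end of \<open>f\<close>, so this pullback is the limit of the punctured cube. Consequently the comparison map
  of the square \<open>(\<zeta>1, \<zeta>2) : f \<rightarrow> W\<close> is the comparison map of the whole cube.\<close>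

lemma punctured_limit_of_comparison:
  assumes \<beta>: "Square g g' v v' \<in> E2" and t: "Square f g p q \<in> Mor D"
    and W: "is_pullback D (Square f' g' p' q') (Square g g' v v') W (Square W f' \<pi>1 \<pi>2) (Square W g \<kappa>1 \<kappa>2)"
    "is_pullback C p' v (Dom C W) \<pi>1 \<kappa>1" "is_pullback C q' v' (Cod C W) \<pi>2 \<kappa>2"
    and \<zeta>: "Square f W \<zeta>1 \<zeta>2 \<in> Mor D" "\<pi>2 \<cdot> \<zeta>2 = u'" "\<kappa>2 \<cdot> \<zeta>2 = q"
    and X: "is_pullback C \<zeta>2 W X x y"
  shows "punctured_limit C u' f' q g p' v X x (\<pi>1 \<cdot> y) (\<kappa>1 \<cdot> y)"
proof -
  note m = D.pullback_arrows(1,2,4,5)[OF W(1)] \<zeta>(1) t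
  note [simp] = m[unfolded Mor_D, THEN conjunct1] m[unfolded Mor_D, THEN conjunct2, THEN conjunct1]
  note [simp] = pullback_arrows(1,2,4-9,11)[OF W(2)] pullback_arrows(1,2,4-9,11)[OF W(3)] pullback_arrows(1,2,4-9,11)[OF X]
  have [simp]: "Dom C p' = Dom C f'" "Dom C v = Dom C g" "Dom C \<zeta>1 = Dom C f" "Dom C \<zeta>2 = Cod C f"
    "Cod C \<zeta>1 = Dom C W" "Cod C \<zeta>2 = Cod C W" "\<zeta>1 \<in> Mor C" "\<zeta>2 \<in> Mor C" "Dom C q' = Cod C f'" "Dom C v' = Cod C g"
    "Cod C p' = Dom C g'" "Cod C v = Dom C g'" "Cod C q' = Cod C g'" "Cod C v' = Cod C g'"
    and e: "\<pi>2 \<cdot> W = f' \<cdot> \<pi>1" "\<kappa>2 \<cdot> W = g \<cdot> \<kappa>1"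
    using m by (auto simp: Mor_D)
  have [simp]: "u' \<in> Mor C" "q \<in> Mor C" "Dom C u' = Cod C f" "Dom C q = Cod C f" "Cod C u' = Cod C f'" "Cod C q = Cod C g"
    using \<zeta>(2,3) by (auto simp flip: \<zeta>(2,3))
  note ep = pullback_arrows(10)[OF W(2)] pullback_arrows(10)[OF X]
  show ?thesis
  proof (rule punctured_limitI)
    show "u' \<cdot> x = f' \<cdot> (\<pi>1 \<cdot> y)"
      using whisker1[OF \<zeta>(2), of x] whisker[OF e(1), of y] ep(2) by simp
    show "q \<cdot> x = g \<cdot> (\<kappa>1 \<cdot> y)"
      using whisker1[OF \<zeta>(3), of x] whisker[OF e(2), of y] ep(2) by simp
    show "p' \<cdot> (\<pi>1 \<cdot> y) = v \<cdot> (\<kappa>1 \<cdot> y)"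
      using whisker[OF ep(1), of y] by simp
  next
    fix l m k assume a: "l \<in> Mor C" "m \<in> Mor C" "k \<in> Mor C" "Dom C l = Dom C k" "Dom C m = Dom C k"
        "Cod C l = Dom C u'" "Cod C m = Dom C f'" "Cod C k = Dom C g"
      and eq: "u' \<cdot> l = f' \<cdot> m" "q \<cdot> l = g \<cdot> k" "p' \<cdot> m = v \<cdot> k"
    have [simp]: "Cod C l = Cod C f" using a by simp
    obtain w where w: "w \<in> Mor C" "Dom C w = Dom C k" "Cod C w = Dom C W" "\<pi>1 \<cdot> w = m" "\<kappa>1 \<cdot> w = k"
      using pullback_lift[OF W(2), of m k] a eq(3) by auto
    have "\<zeta>2 \<cdot> l = W \<cdot> w"
    proof (rule pullback_eqI[OF W(3)])
      show "\<pi>2 \<cdot> (\<zeta>2 \<cdot> l) = \<pi>2 \<cdot> (W \<cdot> w)"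
        using whisker1[OF \<zeta>(2), of l] whisker[OF e(1), of w] w a(1-3) eq by simp
      show "\<kappa>2 \<cdot> (\<zeta>2 \<cdot> l) = \<kappa>2 \<cdot> (W \<cdot> w)"
        using whisker1[OF \<zeta>(3), of l] whisker[OF e(2), of w] w a(1-3) eq by simp
    qed (use a(1-5) w in simp_all)
    then obtain h where h: "h \<in> Mor C" "Dom C h = Dom C k" "Cod C h = X" "x \<cdot> h = l" "y \<cdot> h = w"
      using pullback_lift[OF X, of l w] a(1-5) w by auto
    then show "\<exists>h. h \<in> Mor C \<and> Dom C h = Dom C k \<and> Cod C h = X \<and> x \<cdot> h = l \<and> \<pi>1 \<cdot> y \<cdot> h = m \<and> \<kappa>1 \<cdot> y \<cdot> h = k"
      using w by (intro exI[of _ h]) (simp add: assoc)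
  next
    fix a b assume ab: "a \<in> Mor C" "b \<in> Mor C" "Dom C a = Dom C b" "Cod C a = X" "Cod C b = X"
      and eq: "x \<cdot> a = x \<cdot> b" "\<pi>1 \<cdot> y \<cdot> a = \<pi>1 \<cdot> y \<cdot> b" "\<kappa>1 \<cdot> y \<cdot> a = \<kappa>1 \<cdot> y \<cdot> b"
    have "y \<cdot> a = y \<cdot> b"
      by (rule pullback_eqI[OF W(2)]) (use ab eq(2,3) in \<open>simp_all add: assoc\<close>)
    then show "a = b" by (intro pullback_eqI[OF X ab eq(1)])
  qed simp_all
qed

lemma E3_comparison:
  assumes \<Phi>: "cube f f' u u' g g' v v' p q p' q' \<in> E3"
  obtains W \<pi>1 \<pi>2 \<kappa>1 \<kappa>2 \<zeta>1 \<zeta>2 where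
    "is_pullback D (Square f' g' p' q') (Square g g' v v') W (Square W f' \<pi>1 \<pi>2) (Square W g \<kappa>1 \<kappa>2)"
    "is_pullback C p' v (Dom C W) \<pi>1 \<kappa>1" "is_pullback C q' v' (Cod C W) \<pi>2 \<kappa>2"
    "Square f W \<zeta>1 \<zeta>2 \<in> E2" "\<pi>1 \<cdot> \<zeta>1 = u" "\<kappa>1 \<cdot> \<zeta>1 = p" "\<pi>2 \<cdot> \<zeta>2 = u'" "\<kappa>2 \<cdot> \<zeta>2 = q"
proof -
  note a = E3_arrows[OF \<Phi>]
  obtain W \<pi>1 \<pi>2 \<kappa>1 \<kappa>2 \<zeta>1 \<zeta>2 where
    W: "is_pullback D (Square f' g' p' q') (Square g g' v v') W (Square W f' \<pi>1 \<pi>2) (Square W g \<kappa>1 \<kappa>2)"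
    "is_pullback C p' v (Dom C W) \<pi>1 \<kappa>1" "is_pullback C q' v' (Cod C W) \<pi>2 \<kappa>2"
    and \<zeta>: "Square f W \<zeta>1 \<zeta>2 \<in> Mor D" "\<pi>1 \<cdot> \<zeta>1 = u" "\<kappa>1 \<cdot> \<zeta>1 = p" "\<pi>2 \<cdot> \<zeta>2 = u'" "\<kappa>2 \<cdot> \<zeta>2 = q"
    by (rule cube_comparison[OF E2_Mor_D[OF a(1)] a(2) E2_Mor_D[OF a(3)] E2_Mor_D[OF a(4)] a(5,6)])
  obtain c where c: "c \<in> E2" "Dom D c = f" "Cod D c = W" "Square W f' \<pi>1 \<pi>2 \<cdot>\<^bsub>D\<^esub> c = Square f f' u u'"
    "Square W g \<kappa>1 \<kappa>2 \<cdot>\<^bsub>D\<^esub> c = Square f g p q"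
    using D.E2_comparison[OF \<Phi> W(1)] by auto
  have "c = Square f W \<zeta>1 \<zeta>2"
    by (rule D.pullback_eqI[OF W(1)]) (use c \<zeta> E2_Mor_D in simp_all)
  then show thesis using that[OF W _ \<zeta>(2-5)] c by simp
qed

text \<open>With \<open>E3I\<close>, this describes the threefold extensions as the cubes whose six faces are double
  extensions and whose comparison map to the punctured limit is an extension. The two faces that are not mentioned
  in the definition of a threefold extension correspond to \<open>\<zeta>1\<close> and \<open>\<zeta>2\<close> being extensions.\<close>

lemma E3E:
  assumes \<Phi>: "cube f f' u u' g g' v v' p q p' q' \<in> E3"
  obtains L l m k c where "punctured_limit C u' f' q g p' v L l m k" "c \<in> E" "Dom C c = Dom C f" "Cod C c = L"
    "l \<cdot> c = f" "m \<cdot> c = u" "k \<cdot> c = p" "Square u v p p' \<in> E2" "Square u' v' q q' \<in> E2"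
proof -
  note a = E3_arrows[OF \<Phi>]
  obtain W \<pi>1 \<pi>2 \<kappa>1 \<kappa>2 \<zeta>1 \<zeta>2 where
    W: "is_pullback D (Square f' g' p' q') (Square g g' v v') W (Square W f' \<pi>1 \<pi>2) (Square W g \<kappa>1 \<kappa>2)"
    "is_pullback C p' v (Dom C W) \<pi>1 \<kappa>1" "is_pullback C q' v' (Cod C W) \<pi>2 \<kappa>2"
    and \<zeta>E: "Square f W \<zeta>1 \<zeta>2 \<in> E2" and eqs: "\<pi>1 \<cdot> \<zeta>1 = u" "\<kappa>1 \<cdot> \<zeta>1 = p" "\<pi>2 \<cdot> \<zeta>2 = u'" "\<kappa>2 \<cdot> \<zeta>2 = q"
    by (rule E3_comparison[OF \<Phi>])
  note \<zeta> = E2_Mor_D[OF \<zeta>E] eqs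
  note z = E2_arrows[OF \<zeta>E]
  obtain X x y where X: "is_pullback C \<zeta>2 W X x y"
    using E_pullback_exists[of W \<zeta>2] z by auto
  obtain d where d: "d \<in> E" "Dom C d = Dom C f" "Cod C d = X" "x \<cdot> d = f" "y \<cdot> d = \<zeta>1"
    by (rule E2_comparison[OF \<zeta>E X])
  note pa = pullback_arrows[OF W(2)] pullback_arrows[OF X]
  have "\<pi>1 \<cdot> y \<cdot> d = u" "\<kappa>1 \<cdot> y \<cdot> d = p"
    using d pa(4-9,15-20) \<zeta>(2,3) z(5-8) by (simp_all add: assoc)
  moreover have "Square u v p p' \<in> E2"
    by (rule E2I[OF _ _ _ _ _ _ _ _ _ W(2)]) (use E2_arrows[OF a(1)] E2_arrows[OF a(2)] E2_arrows[OF a(3)] E2_arrows[OF a(4)] z \<zeta> a in simp_all)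
  moreover have "Square u' v' q q' \<in> E2"
    by (rule E2I[OF _ _ _ _ _ _ _ _ _ W(3)]) (use E2_arrows[OF a(1)] E2_arrows[OF a(2)] E2_arrows[OF a(3)] E2_arrows[OF a(4)] z \<zeta> a in simp_all)
  ultimately show thesis
    using that[OF punctured_limit_of_comparison[OF a(2) E2_Mor_D[OF a(3)] W \<zeta>(1,4,5) X] d(1-4)] by blast
qed

lemma E3I:
  assumes a: "Square f f' u u' \<in> E2" "Square g g' v v' \<in> E2" "Square f g p q \<in> E2" "Square f' g' p' q' \<in> E2"
    "Square u v p p' \<in> E2" "Square u' v' q q' \<in> E2"
    and h: "punctured_limit C u' f' q g p' v L l m k" "c \<in> E" "Dom C c = Dom C f" "Cod C c = L" "l \<cdot> c = f" "m \<cdot> c = u" "k \<cdot> c = p"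
  shows "cube f f' u u' g g' v v' p q p' q' \<in> E3"
proof -
  note E2_arrows(9)[OF a(5)] E2_arrows(9)[OF a(6)]
  then obtain W \<pi>1 \<pi>2 \<kappa>1 \<kappa>2 \<zeta>1 \<zeta>2 where
    W: "is_pullback D (Square f' g' p' q') (Square g g' v v') W (Square W f' \<pi>1 \<pi>2) (Square W g \<kappa>1 \<kappa>2)"
    "is_pullback C p' v (Dom C W) \<pi>1 \<kappa>1" "is_pullback C q' v' (Cod C W) \<pi>2 \<kappa>2"
    and \<zeta>: "Square f W \<zeta>1 \<zeta>2 \<in> Mor D" "\<pi>1 \<cdot> \<zeta>1 = u" "\<kappa>1 \<cdot> \<zeta>1 = p" "\<pi>2 \<cdot> \<zeta>2 = u'" "\<kappa>2 \<cdot> \<zeta>2 = q"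
    by (rule cube_comparison[OF E2_Mor_D[OF a(1)] a(2) E2_Mor_D[OF a(3)] E2_Mor_D[OF a(4)]])
  have z: "f \<in> E" "W \<in> E" "\<zeta>1 \<in> Mor C" "\<zeta>2 \<in> Mor C" "Dom C \<zeta>1 = Dom C f" "Cod C \<zeta>1 = Dom C W"
    "Dom C \<zeta>2 = Cod C f" "Cod C \<zeta>2 = Cod C W" "W \<cdot> \<zeta>1 = \<zeta>2 \<cdot> f"
    using \<zeta>(1) by (auto simp: Mor_D)
  note s = E2_arrows[OF a(1)] E2_arrows[OF a(2)] E2_arrows[OF a(3)] E2_arrows[OF a(4)]
  obtain c1 where c1: "c1 \<in> E" "Dom C c1 = Dom C u" "Cod C c1 = Dom C W" "\<pi>1 \<cdot> c1 = u" "\<kappa>1 \<cdot> c1 = p"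
    by (rule E2_comparison[OF a(5) W(2)])
  have "c1 = \<zeta>1" by (rule pullback_eqI[OF W(2)]) (use c1 z \<zeta> s(5) in simp_all)
  then have z1: "\<zeta>1 \<in> E" using c1 by simp
  obtain c2 where c2: "c2 \<in> E" "Dom C c2 = Dom C u'" "Cod C c2 = Cod C W" "\<pi>2 \<cdot> c2 = u'" "\<kappa>2 \<cdot> c2 = q"
    by (rule E2_comparison[OF a(6) W(3)])
  have "c2 = \<zeta>2" by (rule pullback_eqI[OF W(3)]) (use c2 z \<zeta> s(7) in simp_all)
  then have z2: "\<zeta>2 \<in> E" using c2 by simp
  obtain X x y where X: "is_pullback C \<zeta>2 W X x y"
    using E_pullback_exists[of W \<zeta>2] z by auto
  note pa = pullback_arrows(1,2,4-9,11)[OF W(2)] pullback_arrows(1,2,4-9,11)[OF X]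
  have hX: "punctured_limit C u' f' q g p' v X x (\<pi>1 \<cdot> y) (\<kappa>1 \<cdot> y)"
    by (rule punctured_limit_of_comparison[OF a(2) E2_Mor_D[OF a(3)] W \<zeta>(1,4,5) X])
  obtain i where i: "i \<in> Mor C" "Dom C i = L" "Cod C i = X" "iso C i" "x \<cdot> i = l" "\<pi>1 \<cdot> y \<cdot> i = m" "\<kappa>1 \<cdot> y \<cdot> i = k"
    by (rule punctured_limit_unique[OF hX h(1)])
  have "i \<cdot> c \<in> E" using i h by (simp add: E_comp E_iso)
  moreover have "x \<cdot> (i \<cdot> c) = f" using whisker1[OF i(5), of c] i h pa by simp
  moreover have "y \<cdot> (i \<cdot> c) = \<zeta>1"
  proof (rule pullback_eqI[OF W(2)])
    have "\<pi>1 \<cdot> (y \<cdot> (i \<cdot> c)) = \<pi>1 \<cdot> y \<cdot> i \<cdot> c" "\<kappa>1 \<cdot> (y \<cdot> (i \<cdot> c)) = \<kappa>1 \<cdot> y \<cdot> i \<cdot> c"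
      using i(1-3) h(2-4) pa z by (simp_all add: assoc)
    then show "\<pi>1 \<cdot> (y \<cdot> (i \<cdot> c)) = \<pi>1 \<cdot> \<zeta>1" "\<kappa>1 \<cdot> (y \<cdot> (i \<cdot> c)) = \<kappa>1 \<cdot> \<zeta>1"
      using i(6,7) h(6,7) \<zeta>(2,3) by simp_all
  qed (use i(1-3) h(2-4) pa z in simp_all)
  ultimately have "Square f W \<zeta>1 \<zeta>2 \<in> E2"
    by (intro E2I[OF z(1,2) z1 z2 z(5-9) X, where c = "i \<cdot> c"]) (use i h in simp_all)
  then show ?thesis
    by (intro D.E2I[OF _ _ _ _ _ _ _ _ _ W(1), where c = "Square f W \<zeta>1 \<zeta>2"]) (use a \<zeta> E2_arrows(9)[OF a(5)] E2_arrows(9)[OF a(6)] in simp_all)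
qed

lemma E3_swap_xy:
  assumes "cube f f' u u' g g' v v' p q p' q' \<in> E3"
  shows "cube u u' f f' v v' g g' p p' q q' \<in> E3"
proof -
  obtain L l m k c where h: "punctured_limit C u' f' q g p' v L l m k" "c \<in> E" "Dom C c = Dom C f" "Cod C c = L"
    "l \<cdot> c = f" "m \<cdot> c = u" "k \<cdot> c = p" "Square u v p p' \<in> E2" "Square u' v' q q' \<in> E2"
    by (rule E3E[OF assms])
  note a = E3_arrows[OF assms]
  show ?thesis
    by (rule E3I[OF E2_swap[OF a(1)] E2_swap[OF a(2)] h(8,9) a(3,4) punctured_limit_swap_xy[OF h(1)] h(2) _ h(4,6,5,7)])
      (use h E2_arrows[OF a(1)] in simp)
qed

text \<open>For a limit cube the comparison with the punctured limit is invertible, and that limit is the pullback of \<open>\<zeta>2\<close>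
  and \<open>W\<close>. The cube itself need not be a pullback in \<open>D\<close>: nothing forces the bottom face to be one in \<open>C\<close>.\<close>

lemma limit_comparison_pullback:
  assumes \<Phi>: "cube f f' u u' g g' v v' p q p' q' \<in> E3" and h: "punctured_limit C u' f' q g p' v (Dom C f) f u p"
    and W: "is_pullback D (Square f' g' p' q') (Square g g' v v') W (Square W f' \<pi>1 \<pi>2) (Square W g \<kappa>1 \<kappa>2)"
    "is_pullback C p' v (Dom C W) \<pi>1 \<kappa>1" "is_pullback C q' v' (Cod C W) \<pi>2 \<kappa>2"
    and \<zeta>: "Square f W \<zeta>1 \<zeta>2 \<in> Mor D" "\<pi>1 \<cdot> \<zeta>1 = u" "\<kappa>1 \<cdot> \<zeta>1 = p" "\<pi>2 \<cdot> \<zeta>2 = u'" "\<kappa>2 \<cdot> \<zeta>2 = q"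
  shows "is_pullback C \<zeta>2 W (Dom C f) f \<zeta>1"
proof -
  note a = E3_arrows[OF \<Phi>]
  have z: "f \<in> E" "W \<in> E" "\<zeta>1 \<in> Mor C" "\<zeta>2 \<in> Mor C" "Dom C \<zeta>1 = Dom C f" "Cod C \<zeta>1 = Dom C W"
    "Dom C \<zeta>2 = Cod C f" "Cod C \<zeta>2 = Cod C W" "W \<cdot> \<zeta>1 = \<zeta>2 \<cdot> f"
    using \<zeta>(1) by (auto simp: Mor_D)
  obtain X x y where X: "is_pullback C \<zeta>2 W X x y"
    using E_pullback_exists[of W \<zeta>2] z by auto
  have hX: "punctured_limit C u' f' q g p' v X x (\<pi>1 \<cdot> y) (\<kappa>1 \<cdot> y)"
    by (rule punctured_limit_of_comparison[OF a(2) E2_Mor_D[OF a(3)] W \<zeta>(1,4,5) X])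
  obtain i where i: "i \<in> Mor C" "Dom C i = Dom C f" "Cod C i = X" "iso C i" "x \<cdot> i = f" "\<pi>1 \<cdot> y \<cdot> i = u" "\<kappa>1 \<cdot> y \<cdot> i = p"
    by (rule punctured_limit_unique[OF hX h])
  note pa = pullback_arrows(1,2,4-9,11)[OF W(2)] pullback_arrows(1,2,4-9,11)[OF X]
  have "y \<cdot> i = \<zeta>1"
    by (rule pullback_eqI[OF W(2)]) (use i pa z \<zeta> in \<open>simp_all add: assoc\<close>)
  then show ?thesis using pullback_iso[OF X i(1,3,4)] i by simp
qed

text \<open>The converse does hold: the top pullback alone provides the lift, and the bottom one shows that
  the lift has the right composite with \<open>f\<close>.\<close>

lemma punctured_limit_of_pullback:
  assumes pb: "is_pullback D (Square f' g' p' q') (Square g g' v v') f (Square f f' u u') (Square f g p q)"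
    and \<beta>: "Square g g' v v' \<in> E2"
  shows "punctured_limit C u' f' q g p' v (Dom C f) f u p"
proof -
  note C = pullback_ext_arrowsD[OF pb \<beta>]
  note m = D.pullback_arrows(1,2,4,5)[OF pb]
  note [simp] = m[unfolded Mor_D, THEN conjunct1] m[unfolded Mor_D, THEN conjunct2, THEN conjunct1]
  note [simp] = pullback_arrows(1,2,4-9,11)[OF C(1)] pullback_arrows(1,2,4-9,11)[OF C(2)]
  have [simp]: "Dom C p' = Dom C f'" "Dom C v = Dom C g" "Dom C q' = Cod C f'" "Dom C v' = Cod C g"
    "Cod C p' = Dom C g'" "Cod C v = Dom C g'" "Cod C q' = Cod C g'" "Cod C v' = Cod C g'"
    and e: "f' \<cdot> u = u' \<cdot> f" "g \<cdot> p = q \<cdot> f"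
    using m by (auto simp: Mor_D)
  show ?thesis
  proof (rule punctured_limitI)
    show "u' \<cdot> f = f' \<cdot> u" "q \<cdot> f = g \<cdot> p" "p' \<cdot> u = v \<cdot> p"
      using e pullback_arrows(10)[OF C(1)] by simp_all
  next
    fix l m k assume a: "l \<in> Mor C" "m \<in> Mor C" "k \<in> Mor C" "Dom C l = Dom C k" "Dom C m = Dom C k"
        "Cod C l = Dom C u'" "Cod C m = Dom C f'" "Cod C k = Dom C g"
      and eq: "u' \<cdot> l = f' \<cdot> m" "q \<cdot> l = g \<cdot> k" "p' \<cdot> m = v \<cdot> k"
    have [simp]: "Cod C l = Cod C f" using a by simp
    obtain h where h: "h \<in> Mor C" "Dom C h = Dom C k" "Cod C h = Dom C f" "u \<cdot> h = m" "p \<cdot> h = k"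
      using pullback_lift[OF C(1), of m k] a eq(3) by auto
    have "f \<cdot> h = l"
    proof (rule pullback_eqI[OF C(2)])
      show "u' \<cdot> (f \<cdot> h) = u' \<cdot> l" "q \<cdot> (f \<cdot> h) = q \<cdot> l"
        using whisker[OF e(1), of h] whisker[OF e(2), of h] h eq by simp_all
    qed (use a(1-5) h in simp_all)
    then show "\<exists>h. h \<in> Mor C \<and> Dom C h = Dom C k \<and> Cod C h = Dom C f \<and> f \<cdot> h = l \<and> u \<cdot> h = m \<and> p \<cdot> h = k"
      using h by auto
  next
    fix a b assume ab: "a \<in> Mor C" "b \<in> Mor C" "Dom C a = Dom C b" "Cod C a = Dom C f" "Cod C b = Dom C f"
      and eq: "f \<cdot> a = f \<cdot> b" "u \<cdot> a = u \<cdot> b" "p \<cdot> a = p \<cdot> b"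
    show "a = b" by (rule pullback_eqI[OF C(1) ab eq(2,3)])
  qed simp_all
qed

lemma E3_homs:
  assumes "cube f f' u u' g g' v v' p q p' q' \<in> E3"
  shows "f \<in> Mor C" "f' \<in> Mor C" "u \<in> Mor C" "u' \<in> Mor C" "g \<in> Mor C" "g' \<in> Mor C" "v \<in> Mor C" "v' \<in> Mor C"
    "p \<in> Mor C" "q \<in> Mor C" "p' \<in> Mor C" "q' \<in> Mor C"
    "Dom C u = Dom C f" "Dom C p = Dom C f" "Dom C u' = Cod C f" "Dom C q = Cod C f" "Cod C u = Dom C f'" "Dom C p' = Dom C f'"
    "Cod C u' = Cod C f'" "Dom C q' = Cod C f'" "Cod C p = Dom C g" "Dom C v = Dom C g" "Cod C q = Cod C g" "Dom C v' = Cod C g"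
    "Cod C p' = Dom C g'" "Cod C v = Dom C g'" "Cod C q' = Cod C g'" "Cod C v' = Cod C g'"
    and "f' \<cdot> u = u' \<cdot> f" "g \<cdot> p = q \<cdot> f" "v \<cdot> p = p' \<cdot> u" "g' \<cdot> v = v' \<cdot> g" "g' \<cdot> p' = q' \<cdot> f'" "v' \<cdot> q = q' \<cdot> u'"
  using E2_arrows[OF E3_arrows(1)[OF assms]] E2_arrows[OF E3_arrows(2)[OF assms]]
    E2_arrows[OF E3_arrows(3)[OF assms]] E2_arrows[OF E3_arrows(4)[OF assms]] E3_arrows(5,6)[OF assms] by simp_all

lemma punctured_limit_comp:
  assumes \<Phi>: "cube f f' u u' g g' v v' p q p' q' \<in> E3" and h1: "punctured_limit C u' f' q g p' v (Dom C f) f u p"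
    and \<Psi>: "cube g g' v v' h h' w w' r s r' s' \<in> E3" and h2: "punctured_limit C v' g' s h r' w (Dom C g) g v r"
  shows "punctured_limit C u' f' (s \<cdot> q) h (r' \<cdot> p') w (Dom C f) f u (r \<cdot> p)"
proof -
  note [simp] = E3_homs(1-28)[OF \<Phi>] E3_homs(1-28)[OF \<Psi>]
  note e1 = E3_homs(29-34)[OF \<Phi>] and e2 = E3_homs(29-34)[OF \<Psi>]
  show ?thesis
  proof (rule punctured_limitI)
    show "u' \<cdot> f = f' \<cdot> u" by (simp add: e1)
    show "s \<cdot> q \<cdot> f = h \<cdot> (r \<cdot> p)" using whisker[OF e2(2), of p] e1(2) by (simp add: assoc)
    show "r' \<cdot> p' \<cdot> u = w \<cdot> (r \<cdot> p)" using whisker[OF e2(3), of p] e1(3) by (simp add: assoc)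
  next
    fix l m k assume a: "l \<in> Mor C" "m \<in> Mor C" "k \<in> Mor C" "Dom C l = Dom C k" "Dom C m = Dom C k"
        "Cod C l = Dom C u'" "Cod C m = Dom C f'" "Cod C k = Dom C h"
      and eq: "u' \<cdot> l = f' \<cdot> m" "s \<cdot> q \<cdot> l = h \<cdot> k" "r' \<cdot> p' \<cdot> m = w \<cdot> k"
    have [simp]: "Cod C l = Cod C f" using a by simp
    have "v' \<cdot> (q \<cdot> l) = g' \<cdot> (p' \<cdot> m)"
      using whisker[OF e1(6), of l] whisker[OF e1(5), of m] a(1-3,7) eq(1) by simp
    then obtain d where d: "d \<in> Mor C" "Dom C d = Dom C k" "Cod C d = Dom C g" "g \<cdot> d = q \<cdot> l" "v \<cdot> d = p' \<cdot> m" "r \<cdot> d = k"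
      using punctured_limit_lift[OF h2, of "q \<cdot> l" "p' \<cdot> m" k] a(1-5,7,8) eq(2,3) by (auto simp: assoc)
    then obtain e where e: "e \<in> Mor C" "Dom C e = Dom C d" "Cod C e = Dom C f" "f \<cdot> e = l" "u \<cdot> e = m" "p \<cdot> e = d"
      using punctured_limit_lift[OF h1, of l m d] a(1-5,7,8) eq(1) by auto
    show "\<exists>h. h \<in> Mor C \<and> Dom C h = Dom C k \<and> Cod C h = Dom C f \<and> f \<cdot> h = l \<and> u \<cdot> h = m \<and> r \<cdot> p \<cdot> h = k"
      using e d by (intro exI[of _ e]) (simp add: assoc)
  next
    fix a b assume ab: "a \<in> Mor C" "b \<in> Mor C" "Dom C a = Dom C b" "Cod C a = Dom C f" "Cod C b = Dom C f"
      and eq: "f \<cdot> a = f \<cdot> b" "u \<cdot> a = u \<cdot> b" "r \<cdot> p \<cdot> a = r \<cdot> p \<cdot> b"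
    have "p \<cdot> a = p \<cdot> b"
    proof (rule punctured_limit_eqI[OF h2])
      show "g \<cdot> (p \<cdot> a) = g \<cdot> (p \<cdot> b)"
        using whisker[OF e1(2), of a] whisker[OF e1(2), of b] ab eq(1) by simp
      show "v \<cdot> (p \<cdot> a) = v \<cdot> (p \<cdot> b)"
        using whisker[OF e1(3), of a] whisker[OF e1(3), of b] ab eq(2) by simp
      show "r \<cdot> (p \<cdot> a) = r \<cdot> (p \<cdot> b)" using ab eq(3) by (simp add: assoc)
    qed (use ab in simp_all)
    then show "a = b" by (rule punctured_limit_eqI[OF h1 ab eq(1,2)])
  qed simp_all
qed

text \<open>The projection \<open>K\<close> of a componentwise pullback of \<open>\<Phi>\<close> along \<open>\<Psi>\<close> inherits the limit property from \<open>\<Phi>\<close>: a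
  cone over the punctured cube \<open>K\<close> maps to one over \<open>\<Phi>\<close>, and its lift there, together with the given
  arrow to the domain of \<open>\<Psi>\<close>, defines a lift to the pullback of the initial vertices.\<close>

lemma punctured_limit_pulled_back:
  assumes \<Phi>: "cube f f' u u' g g' v v' p q p' q' \<in> E3" and h: "punctured_limit C u' f' q g p' v (Dom C f) f u p"
    and \<Psi>: "cube s s' o1 o' g g' v v' a b a' b' \<in> E3"
    and \<Pi>: "cube w w' e e' f f' u u' p00 p10 p01 p11 \<in> E3" and K: "cube w w' e e' s s' o1 o' k00 k10 k01 k11 \<in> E3"
    and pb: "is_pullback C p a (Dom C w) p00 k00" "is_pullback C q b (Cod C w) p10 k10"
      "is_pullback C p' a' (Dom C w') p01 k01" "is_pullback C q' b' (Cod C w') p11 k11"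
  shows "punctured_limit C e' w' k10 s k01 o1 (Dom C w) w e k00"
proof -
  note [simp] = E3_homs(1-28)[OF \<Phi>] E3_homs(1-28)[OF \<Psi>] E3_homs(1-28)[OF \<Pi>] E3_homs(1-28)[OF K]
  note e1 = E3_homs(29-34)[OF \<Phi>] and e2 = E3_homs(29-34)[OF \<Psi>] and e3 = E3_homs(29-34)[OF \<Pi>] and e4 = E3_homs(29-34)[OF K]
  note pe = pb[THEN pullback_arrows(10)]
  show ?thesis
  proof (rule punctured_limitI)
    show "e' \<cdot> w = w' \<cdot> e" "k10 \<cdot> w = s \<cdot> k00" "k01 \<cdot> e = o1 \<cdot> k00" by (simp_all add: e4)
  next
    fix l m k assume A: "l \<in> Mor C" "m \<in> Mor C" "k \<in> Mor C" "Dom C l = Dom C k" "Dom C m = Dom C k"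
        "Cod C l = Dom C e'" "Cod C m = Dom C w'" "Cod C k = Dom C s"
      and eq: "e' \<cdot> l = w' \<cdot> m" "k10 \<cdot> l = s \<cdot> k" "k01 \<cdot> m = o1 \<cdot> k"
    have [simp]: "Cod C l = Cod C w" using A by simp
    note [simp] = A(1-3,7,8)
    have "u' \<cdot> (p10 \<cdot> l) = p11 \<cdot> (e' \<cdot> l)" using whisker[OF e3(6), of l] by simp
    also have "\<dots> = f' \<cdot> (p01 \<cdot> m)" unfolding eq using whisker[OF e3(5), of m] by simp
    finally have 1: "u' \<cdot> (p10 \<cdot> l) = f' \<cdot> (p01 \<cdot> m)" .
    have "q \<cdot> (p10 \<cdot> l) = b \<cdot> (k10 \<cdot> l)" using whisker[OF pe(2), of l] by simp
    also have "\<dots> = g \<cdot> (a \<cdot> k)" unfolding eq using whisker[OF e2(2), of k] by simp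
    finally have 2: "q \<cdot> (p10 \<cdot> l) = g \<cdot> (a \<cdot> k)" .
    have "p' \<cdot> (p01 \<cdot> m) = a' \<cdot> (k01 \<cdot> m)" using whisker[OF pe(3), of m] by simp
    also have "\<dots> = v \<cdot> (a \<cdot> k)" unfolding eq using whisker[OF e2(3), of k] by simp
    finally have 3: "p' \<cdot> (p01 \<cdot> m) = v \<cdot> (a \<cdot> k)" .
    obtain d where d: "d \<in> Mor C" "Dom C d = Dom C k" "Cod C d = Dom C f" "f \<cdot> d = p10 \<cdot> l" "u \<cdot> d = p01 \<cdot> m" "p \<cdot> d = a \<cdot> k"
      using punctured_limit_lift[OF h, of "p10 \<cdot> l" "p01 \<cdot> m" "a \<cdot> k"] A(4,5) 1 2 3 by auto
    obtain x where x: "x \<in> Mor C" "Dom C x = Dom C k" "Cod C x = Dom C w" "p00 \<cdot> x = d" "k00 \<cdot> x = k"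
      using pullback_lift[OF pb(1), of d k] d by auto
    have "w \<cdot> x = l"
    proof (rule pullback_eqI[OF pb(2)])
      show "p10 \<cdot> (w \<cdot> x) = p10 \<cdot> l" using whisker[OF e3(2), of x] x d by simp
      show "k10 \<cdot> (w \<cdot> x) = k10 \<cdot> l" using whisker[OF e4(2), of x] x eq by simp
    qed (use A(4,5) x in simp_all)
    moreover have "e \<cdot> x = m"
    proof (rule pullback_eqI[OF pb(3)])
      show "p01 \<cdot> (e \<cdot> x) = p01 \<cdot> m" using whisker[OF e3(3), of x] x d by simp
      show "k01 \<cdot> (e \<cdot> x) = k01 \<cdot> m" using whisker[OF e4(3), of x] x eq by simp
    qed (use A(4,5) x in simp_all)
    ultimately show "\<exists>h. h \<in> Mor C \<and> Dom C h = Dom C k \<and> Cod C h = Dom C w \<and> w \<cdot> h = l \<and> e \<cdot> h = m \<and> k00 \<cdot> h = k"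
      using x by (intro exI[of _ x]) simp
  next
    fix x y assume xy: "x \<in> Mor C" "y \<in> Mor C" "Dom C x = Dom C y" "Cod C x = Dom C w" "Cod C y = Dom C w"
      and eq: "w \<cdot> x = w \<cdot> y" "e \<cdot> x = e \<cdot> y" "k00 \<cdot> x = k00 \<cdot> y"
    have "p00 \<cdot> x = p00 \<cdot> y"
    proof (rule punctured_limit_eqI[OF h])
      show "f \<cdot> (p00 \<cdot> x) = f \<cdot> (p00 \<cdot> y)"
        using whisker[OF e3(2), of x] whisker[OF e3(2), of y] xy eq(1) by simp
      show "u \<cdot> (p00 \<cdot> x) = u \<cdot> (p00 \<cdot> y)"
        using whisker[OF e3(3), of x] whisker[OF e3(3), of y] xy eq(2) by simp
      show "p \<cdot> (p00 \<cdot> x) = p \<cdot> (p00 \<cdot> y)"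
        using whisker[OF pe(1), of x] whisker[OF pe(1), of y] xy eq(3) by simp
    qed (use xy in simp_all)
    then show "x = y" by (intro pullback_eqI[OF pb(1) xy] eq(3))
  qed simp_all
qed

end

section \<open>Discrete fibrations of double extensions\<close>

text \<open>Three consecutive levels of a tower. Coverings are compared on the first two; the third one serves
  to compose threefold extensions and to pull them back along each other.\<close>

locale three_levels =
  birkhoff C E G0 +
  D: birkhoff "ext_arrows C E" "double_exts C E" G1 +
  DD: birkhoff "ext_arrows (ext_arrows C E) (double_exts C E)" "double_exts (ext_arrows C E) (double_exts C E)" G2
  for C :: "('o, 'm) cell_cat" (structure) and E G0 G1 G2 +
  assumes Sub_G1: "Sub G1 = {c. covering G0 c}"
begin

sublocale cubes C E
  by unfold_locales

text \<open>The discrete fibrations along the third direction of the cube. Up to a permutation of the directions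
  these are all of them (\<open>dfib_of_face\<close>), so that they can be composed and pulled back as arrows.\<close>

definition dfib :: "('o, 'm) cell \<Rightarrow> ('o, 'm) cell \<Rightarrow> bool" where
  "dfib \<tau> \<beta> \<longleftrightarrow> (\<exists>f f' u u' g g' v v' p q p' q'. \<tau> = Square f f' u u' \<and> \<beta> = Square g g' v v' \<and>
     cube f f' u u' g g' v v' p q p' q' \<in> E3 \<and> punctured_limit C u' f' q g p' v (Dom C f) f u p)"

lemma dfibI: "cube f f' u u' g g' v v' p q p' q' \<in> E3 \<Longrightarrow> punctured_limit C u' f' q g p' v (Dom C f) f u p \<Longrightarrow>
    dfib (Square f f' u u') (Square g g' v v')"
  unfolding dfib_def by blast

lemma dfibE:
  assumes "dfib (Square f f' u u') (Square g g' v v')"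
  obtains p q p' q' where "cube f f' u u' g g' v v' p q p' q' \<in> E3" "punctured_limit C u' f' q g p' v (Dom C f) f u p"
  using assms unfolding dfib_def by auto

lemma dfib_swap: "dfib (Square f f' u u') (Square g g' v v') \<Longrightarrow> dfib (Square u u' f f') (Square v v' g g')"
proof (erule dfibE)
  fix p q p' q' assume \<Phi>: "cube f f' u u' g g' v v' p q p' q' \<in> E3" and h: "punctured_limit C u' f' q g p' v (Dom C f) f u p"
  show ?thesis
    by (rule dfibI[OF E3_swap_xy[OF \<Phi>]]) (use punctured_limit_swap_xy[OF h] E3_homs(13)[OF \<Phi>] in simp)
qed

lemma dfib_comp:
  assumes "dfib \<tau> \<gamma>" "dfib \<gamma> \<beta>"
  shows "dfib \<tau> \<beta>"
proof -
  obtain f f' u u' g g' v v' p q p' q' where [simp]: "\<tau> = Square f f' u u'" "\<gamma> = Square g g' v v'" and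
    \<Phi>: "cube f f' u u' g g' v v' p q p' q' \<in> E3" and h1: "punctured_limit C u' f' q g p' v (Dom C f) f u p"
    using assms(1) unfolding dfib_def by blast
  obtain h h' w w' r s r' s' where [simp]: "\<beta> = Square h h' w w'" and
    \<Psi>: "cube g g' v v' h h' w w' r s r' s' \<in> E3" and h2: "punctured_limit C v' g' s h r' w (Dom C g) g v r"
    using assms(2) unfolding dfib_def by auto
  have "cube f f' u u' h h' w w' (r \<cdot> p) (s \<cdot> q) (r' \<cdot> p') (s' \<cdot> q') \<in> E3"
    using DD.E_comp[OF \<Phi> \<Psi>] by simp
  then show ?thesis using dfibI[OF _ punctured_limit_comp[OF \<Phi> h1 \<Psi> h2]] by simp
qed

lemma dfib_of_pullback:
  assumes pb: "is_pullback D b \<beta> P \<tau> t" and b: "b \<in> E2" and \<beta>: "\<beta> \<in> E2"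
  shows "dfib \<tau> \<beta>"
proof -
  note a = D.pullback_arrows[OF pb]
  have E: "\<tau> \<in> E2" "t \<in> E2" by (rule D.E_pullback[OF \<beta> pb], rule D.E_pullback'[OF b pb])
  obtain f f' u u' where \<tau>: "\<tau> = Square f f' u u'" by (rule E2E[OF E(1)])
  obtain g g' v v' where \<beta>': "\<beta> = Square g g' v v'" by (rule E2E[OF \<beta>])
  have P: "P = f" using a(6) \<tau> by simp
  obtain p q where t: "t = Square f g p q"
    by (rule Mor_ext_arrows_Square[OF E2_Mor_D[OF E(2)], of f g]) (use a \<tau> \<beta>' P in auto)
  obtain p' q' where b': "b = Square f' g' p' q'"
    by (rule Mor_ext_arrows_Square[OF E2_Mor_D[OF b], of f' g']) (use a \<tau> \<beta>' in auto)
  have "Square \<tau> \<beta> t b \<in> E3" using D.E2_of_pullback[OF pb b \<beta>] .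
  then show ?thesis unfolding \<tau> \<beta>' t b'
    by (rule dfibI) (rule punctured_limit_of_pullback, use pb \<beta> in \<open>simp_all add: \<tau> \<beta>' t b' P\<close>)
qed

lemma dfib_pullback:
  assumes "dfib \<tau> \<gamma>" "dfib \<sigma> \<gamma>"
  obtains \<omega> where "dfib \<omega> \<tau>" "dfib \<omega> \<sigma>"
proof -
  obtain f f' u u' g g' v v' p q p' q' where [simp]: "\<tau> = Square f f' u u'" and \<gamma> [simp]: "\<gamma> = Square g g' v v'" and
    \<Phi>: "cube f f' u u' g g' v v' p q p' q' \<in> E3" and h1: "punctured_limit C u' f' q g p' v (Dom C f) f u p"
    using assms(1) unfolding dfib_def by blast
  obtain s s' o1 o' a b a' b' where [simp]: "\<sigma> = Square s s' o1 o'" and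
    \<Psi>: "cube s s' o1 o' g g' v v' a b a' b' \<in> E3" and h2: "punctured_limit C o' s' b g a' v (Dom C s) s o1 a"
    using assms(2) unfolding dfib_def by auto
  obtain \<omega> \<Pi>1 \<Pi>2 K1 K2 where
    pb: "is_pullback D.D (cube f f' u u' g g' v v' p q p' q') (cube s s' o1 o' g g' v v' a b a' b') \<omega>
      (Square \<omega> (Square f f' u u') \<Pi>1 \<Pi>2) (Square \<omega> (Square s s' o1 o') K1 K2)"
    and t: "is_pullback D (Square f g p q) (Square s g a b) (Dom D \<omega>) \<Pi>1 K1"
    and bt: "is_pullback D (Square f' g' p' q') (Square s' g' a' b') (Cod D \<omega>) \<Pi>2 K2"
    by (rule D.pullback_along_E2[OF D.E2_Mor_D[OF \<Phi>] \<Psi>])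
  have \<Pi>E: "Square \<omega> (Square f f' u u') \<Pi>1 \<Pi>2 \<in> E3" "Square \<omega> (Square s s' o1 o') K1 K2 \<in> E3"
    by (rule DD.E_pullback[OF \<Psi> pb], rule DD.E_pullback'[OF \<Phi> pb])
  obtain w w' e e' where \<omega>: "\<omega> = Square w w' e e'"
    by (rule E2E[OF D.E2_arrows(1)[OF \<Pi>E(1)]])
  obtain p00 p10 p01 p11 where \<Pi>: "\<Pi>1 = Square w f p00 p10" "\<Pi>2 = Square w' f' p01 p11"
    by (rule E3_cube[OF \<Pi>E(1), of w w' e e' f f' u u']) (simp_all add: \<omega>)
  obtain k00 k10 k01 k11 where K: "K1 = Square w s k00 k10" "K2 = Square w' s' k01 k11"
    by (rule E3_cube[OF \<Pi>E(2), of w w' e e' s s' o1 o']) (simp_all add: \<omega>)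
  note t' = pullback_ext_arrowsD[OF t[unfolded \<Pi> K \<omega> ext_arrows_simps cell.sel] E3_arrows(3)[OF \<Psi>]]
  note b' = pullback_ext_arrowsD[OF bt[unfolded \<Pi> K \<omega> ext_arrows_simps cell.sel] E3_arrows(4)[OF \<Psi>]]
  have PE: "cube w w' e e' f f' u u' p00 p10 p01 p11 \<in> E3" and KE: "cube w w' e e' s s' o1 o' k00 k10 k01 k11 \<in> E3"
    using \<Pi>E by (simp_all add: \<omega> \<Pi> K)
  have "dfib \<omega> \<sigma>" unfolding \<omega> \<open>\<sigma> = _\<close>
    by (rule dfibI[OF KE punctured_limit_pulled_back[OF \<Phi> h1 \<Psi> PE KE t' b']])
  moreover have "dfib \<omega> \<tau>" unfolding \<omega> \<open>\<tau> = _\<close>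
    by (rule dfibI[OF PE punctured_limit_pulled_back[OF \<Psi> h2 \<Phi> KE PE t'[THEN pullback_sym] b'[THEN pullback_sym]]])
  ultimately show thesis using that by blast
qed

section \<open>Discrete fibrations and coverings\<close>

text \<open>Next to the given pullback on tops, the identity square of \<open>b\<close> is a pullback on bottoms. So the square
  is the pullback in \<open>D\<close> of \<open>(b, b)\<close> from the identity of the codomain of \<open>x\<close> to that of \<open>W\<close>, whose domain
  is a covering.\<close>

lemma trivial_of_cartesian:
  assumes \<kappa>: "Square x W t b \<in> E2" and pb: "is_pullback C b W P x t"
  shows "trivial_covering G1 (Square x W t b)"
proof -
  note a = E2_arrows[OF \<kappa>] and P = pullback_arrows(6)[OF pb]
  let ?B = "Id C (Cod C W)" and ?B' = "Id C (Cod C x)"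
  have I: "?B \<in> E" "?B' \<in> E" using a by (auto intro: E_Id)
  have "is_pullback D (Square W ?B W ?B) (Square ?B' ?B b b) x (Square x W t b) (Square x ?B' x ?B')"
    by (rule pullback_ext_arrows[OF _ _ pullback_sym[OF pb] pullback_Id[of b, unfolded a(7,8)]])
      (use a P I in \<open>simp_all add: Mor_D\<close>)
  moreover have "?B' \<in> Sub G1"
    using covering_of_trivial[OF trivial_Id[of "Cod C x"]] a by (simp add: Sub_G1)
  ultimately show ?thesis using D.trivial_of_pullback[OF \<kappa>] by simp
qed

text \<open>The cube factors through the pullback of \<open>\<beta>\<close> in \<open>D\<close>, and the comparison is a pullback square in \<open>C\<close>.\<close>

lemma dfib_factor:
  assumes "dfib \<tau> \<beta>"
  obtains b W \<pi> \<kappa> \<zeta> where "is_pullback D b \<beta> W \<pi> \<kappa>" "b \<in> E2" "\<beta> \<in> E2" "\<zeta> \<in> E2" "trivial_covering G1 \<zeta>"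
    "Cod D \<zeta> = W" "\<pi> \<cdot>\<^bsub>D\<^esub> \<zeta> = \<tau>"
proof -
  obtain f f' u u' g g' v v' p q p' q' where \<tau>: "\<tau> = Square f f' u u'" and \<beta>: "\<beta> = Square g g' v v'" and
    \<Phi>: "cube f f' u u' g g' v v' p q p' q' \<in> E3" and h: "punctured_limit C u' f' q g p' v (Dom C f) f u p"
    using assms unfolding dfib_def by blast
  obtain W \<pi>1 \<pi>2 \<kappa>1 \<kappa>2 \<zeta>1 \<zeta>2 where
    W: "is_pullback D (Square f' g' p' q') (Square g g' v v') W (Square W f' \<pi>1 \<pi>2) (Square W g \<kappa>1 \<kappa>2)"
    "is_pullback C p' v (Dom C W) \<pi>1 \<kappa>1" "is_pullback C q' v' (Cod C W) \<pi>2 \<kappa>2"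
    and \<zeta>: "Square f W \<zeta>1 \<zeta>2 \<in> E2" and eqs: "\<pi>1 \<cdot> \<zeta>1 = u" "\<kappa>1 \<cdot> \<zeta>1 = p" "\<pi>2 \<cdot> \<zeta>2 = u'" "\<kappa>2 \<cdot> \<zeta>2 = q"
    by (rule E3_comparison[OF \<Phi>])
  have "is_pullback C \<zeta>2 W (Dom C f) f \<zeta>1"
    by (rule limit_comparison_pullback[OF \<Phi> h W E2_Mor_D[OF \<zeta>] eqs])
  then have "trivial_covering G1 (Square f W \<zeta>1 \<zeta>2)" by (rule trivial_of_cartesian[OF \<zeta>])
  with W(1) \<zeta> E3_arrows(2,4)[OF \<Phi>] show thesis
    by (intro that[of "Square f' g' p' q'" W]) (use eqs in \<open>auto simp: \<tau> \<beta>\<close>)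
qed

lemma trivial_of_dfib:
  assumes "dfib \<tau> \<beta>" and S: "Dom C (sq_dom \<beta>) \<in> S"
  shows "trivial_covering G1 \<tau>"
proof -
  obtain b W \<pi> \<kappa> \<zeta> where W: "is_pullback D b \<beta> W \<pi> \<kappa>" and E: "b \<in> E2" "\<beta> \<in> E2" "\<zeta> \<in> E2" and \<zeta>: "trivial_covering G1 \<zeta>"
    "Cod D \<zeta> = W" "\<pi> \<cdot>\<^bsub>D\<^esub> \<zeta> = \<tau>"
    by (rule dfib_factor[OF assms(1)])
  have "sq_dom \<beta> \<in> Sub G1"
    using covering_of_trivial[OF trivial_in_S[OF _ S]] E2_Mor_D[OF E(2)] by (simp add: Sub_G1)
  then have "trivial_covering G1 \<pi>"
    using D.trivial_of_pullback[OF D.E_pullback[OF E(2) W] W] by simp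
  then have "trivial_covering G1 (\<pi> \<cdot>\<^bsub>D\<^esub> \<zeta>)"
    by (rule D.trivial_comp[OF \<zeta>(1)]) (use \<zeta>(2) D.pullback_arrows(6)[OF W] in simp)
  then show ?thesis by (simp only: \<zeta>(3))
qed

lemma covering_of_dfib:
  assumes "dfib \<tau> \<alpha>" and \<tau>: "trivial_covering G1 \<tau>"
  shows "covering G1 \<alpha>"
proof -
  obtain b W \<pi> \<kappa> \<zeta> where W: "is_pullback D b \<alpha> W \<pi> \<kappa>" and E: "b \<in> E2" "\<alpha> \<in> E2" "\<zeta> \<in> E2" and \<zeta>: "trivial_covering G1 \<zeta>"
    "Cod D \<zeta> = W" "\<pi> \<cdot>\<^bsub>D\<^esub> \<zeta> = \<tau>"
    by (rule dfib_factor[OF assms(1)])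
  have "trivial_covering G1 \<pi>"
  proof (rule D.trivial_cancel[OF \<zeta>(1)])
    show "\<pi> \<in> E2" by (rule D.E_pullback[OF E(2) W])
    show "Cod D \<zeta> = Dom D \<pi>" using \<zeta>(2) D.pullback_arrows(6)[OF W] by simp
    show "trivial_covering G1 (\<pi> \<cdot>\<^bsub>D\<^esub> \<zeta>)" unfolding \<zeta>(3) by (rule \<tau>)
  qed
  then show ?thesis
    using E W D.pullback_arrows(3)[OF W] unfolding covering_def by (auto simp del: ext_arrows_simps)
qed

text \<open>Let \<open>e1\<close> and \<open>e2\<close> split \<open>c\<close> and \<open>c'\<close>. Pulling \<open>e2\<close> back along the bottom \<open>g'\<close> of the double
  extension, and then \<open>e1\<close> back along the result, gives a double extension \<open>\<theta>\<close> over \<open>g'\<close>; its two components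
  still split \<open>c\<close> and \<open>c'\<close>, since trivial coverings are stable under pullback. The square is then pulled back
  along \<open>\<theta>\<close> in its transposed form, as an arrow from \<open>g\<close> to \<open>g'\<close>.\<close>

lemma splitting_square:
  assumes c: "covering G0 c" and c': "covering G0 c'" and \<gamma>: "Square c c' g g' \<in> E2"
  obtains \<sigma> \<rho> p1 p2 where "dfib (Square \<sigma> \<rho> p1 p2) (Square g g' c c')" "Square \<sigma> \<rho> p1 p2 \<in> E2"
    "trivial_covering G0 p1" "trivial_covering G0 p2"
proof -
  obtain e1 P1 x1 y1 where e1: "e1 \<in> E" "Cod C e1 = Cod C c" and P1: "is_pullback C e1 c P1 x1 y1" and x1: "trivial_covering G0 x1"
    by (rule coveringE[OF c])
  obtain e2 P2 x2 y2 where e2: "e2 \<in> E" "Cod C e2 = Cod C c'" and P2: "is_pullback C e2 c' P2 x2 y2" and x2: "trivial_covering G0 x2"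
    by (rule coveringE[OF c'])
  note \<gamma>a = E2_arrows[OF \<gamma>]
  obtain V v1 v2 where V: "is_pullback C g' e2 V v1 v2" and v1: "v1 \<in> E"
    using pullback_along_E[OF e2(1), of g'] \<gamma>a e2 by auto
  have v2: "v2 \<in> E" by (rule E_pullback'[OF \<gamma>a(4) V])
  note Va = pullback_arrows[OF V]
  obtain R r r2 where R: "is_pullback C v1 e1 R r r2" and r: "r \<in> E"
    using pullback_along_E[OF e1(1), of v1] Va \<gamma>a e1 by auto
  note Ra = pullback_arrows[OF R]
  let ?\<rho> = "v2 \<cdot> r" and ?a = "v1 \<cdot> r"
  have \<rho>: "?\<rho> \<in> E" "?a \<in> E" using v1 v2 r Ra(4-9) Va(4-9) by (auto intro: E_comp)
  \<comment> \<open>The comparison map of this square is \<open>r\<close>.\<close>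
  have \<theta>: "Square ?\<rho> g' ?a e2 \<in> E2"
    by (rule E2I[OF _ _ _ _ _ _ _ _ _ pullback_sym[OF V] r])
      (use \<rho> \<gamma>a e2 Ra(4-9) Va(4-9) whisker[OF Va(10), of r] in \<open>simp_all add: assoc\<close>)
  obtain \<sigma> p1 p2 q1 q2 where
    pb: "is_pullback D (Square ?\<rho> g' ?a e2) (Square g g' c c') \<sigma> (Square \<sigma> ?\<rho> p1 p2) (Square \<sigma> g q1 q2)"
    and p1: "is_pullback C ?a c (Dom C \<sigma>) p1 q1" and p2: "is_pullback C e2 c' (Cod C \<sigma>) p2 q2"
    by (rule pullback_along_E2[OF E2_Mor_D[OF \<theta>] E2_swap[OF \<gamma>]])
  have "dfib (Square \<sigma> ?\<rho> p1 p2) (Square g g' c c')"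
    by (rule dfib_of_pullback[OF pb \<theta> E2_swap[OF \<gamma>]])
  moreover have "Square \<sigma> ?\<rho> p1 p2 \<in> E2" by (rule D.E_pullback[OF E2_swap[OF \<gamma>] pb])
  moreover have "trivial_covering G0 p1"
  proof -
    have eq: "?a = e1 \<cdot> r2" using Ra(10) by simp
    note p1' = pullback_arrows[OF p1]
    have "e1 \<cdot> (r2 \<cdot> p1) = c \<cdot> q1"
      using p1' Ra(4-9) e1 by (simp add: eq assoc)
    then obtain s where s: "s \<in> Mor C" "Dom C s = Dom C \<sigma>" "Cod C s = P1" "x1 \<cdot> s = r2 \<cdot> p1" "y1 \<cdot> s = q1"
      using pullback_lift[OF P1, of "r2 \<cdot> p1" q1] p1' Ra(4-9) Va(4-9) by auto
    have "is_pullback C r2 x1 (Dom C \<sigma>) p1 s"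
      by (rule pullback_cancel[OF P1 p1[unfolded eq] Ra(5,9) s])
    then show ?thesis by (rule trivial_pulled_back[OF x1])
  qed
  moreover have "trivial_covering G0 p2"
  proof -
    obtain s where s: "s \<in> Mor C" "Dom C s = Cod C \<sigma>" "Cod C s = P2" "iso C s" "x2 \<cdot> s = p2"
      using pullback_unique[OF P2 p2] by metis
    have p2': "p2 \<in> E" by (rule E_pullback[OF \<gamma>a(2) p2])
    have "is_pullback C (Id C (Dom C e2)) x2 (Cod C \<sigma>) p2 s"
      using pullback_iso[OF pullback_Id[of x2], of s] s pullback_arrows[OF P2] by simp
    then show ?thesis by (rule trivial_pulled_back[OF x2])
  qed
  ultimately show thesis using that by blast
qed

lemma unit_E2: "e \<in> E \<Longrightarrow> Square e (F e) (\<eta> (Dom C e)) (\<eta> (Cod C e)) \<in> E2"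
proof -
  assume e: "e \<in> E"
  then have "double_extension C E e (F e) (\<eta> (Dom C e)) (\<eta> (Cod C e))"
    using birkhoff unfolding strongly_birkhoff_def Cat_G Exts_G by blast
  moreover have "Square e (F e) (\<eta> (Dom C e)) (\<eta> (Cod C e)) \<in> Mor D"
    unfolding Mor_D
    by (intro conjI e reflection_E[OF e] unit_natural[OF E_Mor[OF e], symmetric]) (use e in simp_all)
  ultimately show ?thesis unfolding double_exts_def by simp
qed

text \<open>The reflection squares of \<open>p1\<close> and \<open>p2\<close> are pullbacks, which together form a pullback in \<open>D\<close>. It remains to
  see that the reflection of the whole square is a double extension. Its comparison map \<open>c\<close> composed with the
  unit factors as \<open>s \<cdot> d\<close>, where \<open>d\<close> is the comparison map of the given square and \<open>s\<close> is a pullback of the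
  unit, since the reflection square of \<open>p2\<close> is a pullback. So \<open>factor_through_unit_E\<close> applies.\<close>

lemma reflect_trivial_square:
  assumes p: "Square \<sigma> \<rho> p1 p2 \<in> E2" and t1: "trivial_covering G0 p1" and t2: "trivial_covering G0 p2"
  shows "Square (F \<sigma>) (F \<rho>) (F p1) (F p2) \<in> E2" "dfib (Square \<sigma> \<rho> p1 p2) (Square (F \<sigma>) (F \<rho>) (F p1) (F p2))"
proof -
  note a = E2_arrows[OF p]
  note [simp] = a(5-8) a(1-4)[THEN E_Mor] a(1-4)[THEN E_regular_epi] a(1-4)
  note pb1 = trivial_pullback[OF t1] and pb2 = trivial_pullback[OF t2]
  have comm: "F \<rho> \<cdot> F p1 = F p2 \<cdot> F \<sigma>"
    using F_comp[of p1 \<rho>] F_comp[of \<sigma> p2] a(9) by simp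
  obtain K k1 k2 where K: "is_pullback C (F p2) (F \<rho>) K k1 k2"
    using E_pullback_exists[of "F \<rho>" "F p2"] reflection_E by auto
  note Ka = pullback_arrows[OF K]
  obtain c where c: "c \<in> Mor C" "Dom C c = Fo (Dom C \<sigma>)" "Cod C c = K" "k1 \<cdot> c = F \<sigma>" "k2 \<cdot> c = F p1"
    using pullback_lift[OF K, of "F \<sigma>" "F p1"] comm by auto
  obtain Q q1 q2 where Q: "is_pullback C p2 \<rho> Q q1 q2"
    using E_pullback_exists[of \<rho> p2] by auto
  note Qa = pullback_arrows[OF Q]
  obtain d where d: "d \<in> E" "Dom C d = Dom C \<sigma>" "Cod C d = Q" "q1 \<cdot> d = \<sigma>" "q2 \<cdot> d = p1"
    by (rule E2_comparison[OF p Q])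
  let ?n = "\<eta> (Cod C \<sigma>)" and ?r = "\<eta> (Cod C p1)"
  have Q': "is_pullback C (F \<rho> \<cdot> ?r) (F p2) Q q2 (?n \<cdot> q1)"
    using pullback_paste[OF pb2, of \<rho> Q q2 q1] pullback_sym[OF Q] unit_natural[of \<rho>] by simp
  have "F p2 \<cdot> (?n \<cdot> q1) = F \<rho> \<cdot> (?r \<cdot> q2)"
    using pullback_arrows(10)[OF Q'] Qa(4-9) by (simp add: assoc)
  then obtain s where s: "s \<in> Mor C" "Dom C s = Q" "Cod C s = K" "k1 \<cdot> s = ?n \<cdot> q1" "k2 \<cdot> s = ?r \<cdot> q2"
    using pullback_lift[OF K, of "?n \<cdot> q1" "?r \<cdot> q2"] Qa(4-9) by auto
  have sp: "is_pullback C ?r k2 Q q2 s"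
    by (rule pullback_cancel[OF pullback_sym[OF K] Q' _ _ s(1-3,5,4)]) simp_all
  have "s \<in> E" by (rule E_pullback'[OF unit_E sp]) simp
  then have "s \<cdot> d \<in> E" using d s by (simp add: E_comp)
  moreover have "c \<cdot> \<eta> (Dom C \<sigma>) = s \<cdot> d"
  proof (rule pullback_eqI[OF K])
    show "k1 \<cdot> (c \<cdot> \<eta> (Dom C \<sigma>)) = k1 \<cdot> (s \<cdot> d)"
      using whisker1[OF c(4), of "\<eta> (Dom C \<sigma>)"] whisker[OF s(4), of d] c(1-3) s(1-3) d Ka(4-9) Qa(4-9) unit_natural[of \<sigma>] by simp
    show "k2 \<cdot> (c \<cdot> \<eta> (Dom C \<sigma>)) = k2 \<cdot> (s \<cdot> d)"
      using whisker1[OF c(5), of "\<eta> (Dom C \<sigma>)"] whisker[OF s(5), of d] c(1-3) s(1-3) d Ka(4-9) Qa(4-9) unit_natural[of p1] by simp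
  qed (use c s d in simp_all)
  ultimately have "c \<cdot> \<eta> (Dom C \<sigma>) \<in> E" by simp
  then have cE: "c \<in> E"
    by (rule factor_through_unit_E[OF K, rotated 2]) (use c in simp_all)
  show \<beta>: "Square (F \<sigma>) (F \<rho>) (F p1) (F p2) \<in> E2"
    by (rule E2I[OF _ _ _ _ _ _ _ _ comm K cE]) (use c in \<open>simp_all add: reflection_E\<close>)
  have "is_pullback D (Square \<rho> (F \<rho>) (\<eta> (Dom C \<rho>)) (\<eta> (Cod C \<rho>))) (Square (F \<sigma>) (F \<rho>) (F p1) (F p2)) \<sigma>
      (Square \<sigma> \<rho> p1 p2) (Square \<sigma> (F \<sigma>) (\<eta> (Dom C \<sigma>)) (\<eta> (Cod C \<sigma>)))"
    using pb1 pb2 a(9) unit_natural[of \<sigma>]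
    by (intro pullback_ext_arrows[OF E2_Mor_D[OF unit_E2] E2_Mor_D[OF \<beta>]]) simp_all
  then show "dfib (Square \<sigma> \<rho> p1 p2) (Square (F \<sigma>) (F \<rho>) (F p1) (F p2))"
    by (rule dfib_of_pullback[OF _ unit_E2 \<beta>]) simp
qed

lemma dfib_of_covering:
  assumes "covering G1 \<alpha>"
  obtains \<omega> \<beta> where "dfib \<omega> \<alpha>" "dfib \<omega> \<beta>"
    "Dom C (sq_dom \<beta>) \<in> S" "Cod C (sq_dom \<beta>) \<in> S" "Dom C (sq_cod \<beta>) \<in> S" "Cod C (sq_cod \<beta>) \<in> S"
proof -
  obtain e P \<pi> \<kappa> where e: "e \<in> E2" "is_pullback D e \<alpha> P \<pi> \<kappa>" "trivial_covering G1 \<pi>" "\<alpha> \<in> E2"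
    by (rule D.coveringE[OF assms])
  have \<alpha>: "dfib \<pi> \<alpha>" by (rule dfib_of_pullback[OF e(2,1,4)])
  let ?\<gamma> = "D.F \<pi>"
  have \<pi>E: "\<pi> \<in> E2" by (rule D.trivial_E[OF e(3)])
  have \<gamma>E: "?\<gamma> \<in> E2" by (rule D.reflection_E[OF \<pi>E])
  have dO: "Dom D \<pi> \<in> Ob D" "Cod D \<pi> \<in> Ob D" using E2_Mor_D[OF \<pi>E] by simp_all
  have \<gamma>: "dfib \<pi> ?\<gamma>"
    by (rule dfib_of_pullback[OF D.trivial_pullback[OF e(3)] D.unit_E[OF dO(2)] \<gamma>E])
  have m: "Dom D ?\<gamma> = D.Fo (Dom D \<pi>)" "Cod D ?\<gamma> = D.Fo (Cod D \<pi>)"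
    using D.Dom_F[OF E2_Mor_D[OF \<pi>E]] D.Cod_F[OF E2_Mor_D[OF \<pi>E]] .
  obtain c c' g g' where \<gamma>': "?\<gamma> = Square c c' g g'" by (rule E2E[OF \<gamma>E])
  have "covering G0 c" "covering G0 c'"
    using D.Fo_S[OF dO(1)] D.Fo_S[OF dO(2)] m unfolding \<gamma>' Sub_G1 by simp_all
  then obtain \<sigma> \<rho> p1 p2 where p: "dfib (Square \<sigma> \<rho> p1 p2) (Square g g' c c')" "Square \<sigma> \<rho> p1 p2 \<in> E2"
    "trivial_covering G0 p1" "trivial_covering G0 p2"
    by (rule splitting_square[OF _ _ \<gamma>E[unfolded \<gamma>']])
  obtain x x' y y' where \<pi>: "\<pi> = Square x x' y y'" by (rule E2E[OF \<pi>E])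
  obtain a a' b b' where \<alpha>': "\<alpha> = Square a a' b b'" by (rule E2E[OF e(4)])
  \<comment> \<open>The fibrations from \<open>\<pi>\<close> are transposed, because the splitting acts in the other direction of the square.\<close>
  from \<gamma> have "dfib (Square x x' y y') (Square c c' g g')"
    unfolding \<gamma>' unfolding \<pi> .
  then have "dfib (Square y y' x x') (Square g g' c c')"
    by (rule dfib_swap)
  then obtain \<omega> where \<omega>: "dfib \<omega> (Square y y' x x')" "dfib \<omega> (Square \<sigma> \<rho> p1 p2)"
    using dfib_pullback[OF _ p(1)] by metis
  have 1: "dfib \<omega> (Square b b' a a')"
    using dfib_comp[OF \<omega>(1) dfib_swap] \<alpha> unfolding \<pi> \<alpha>' by blast
  have 2: "dfib \<omega> (Square (F \<sigma>) (F \<rho>) (F p1) (F p2))"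
    by (rule dfib_comp[OF \<omega>(2) reflect_trivial_square(2)[OF p(2-4)]])
  obtain w w' v v' where \<omega>': "\<omega> = Square w w' v v'" using 1 unfolding dfib_def by blast
  show thesis
  proof (rule that)
    show "dfib (Square v v' w w') \<alpha>" "dfib (Square v v' w w') (Square (F p1) (F p2) (F \<sigma>) (F \<rho>))"
      using 1 2 dfib_swap unfolding \<omega>' \<alpha>' by blast+
  qed (use E2_arrows[OF p(2)] in simp_all)
qed

end

section \<open>Limit cubes\<close>

lemma all_cube_edges:
  "(\<forall>(a, h, b) \<in> {(u, f, v) \<in> cube_edges \<Phi>. u \<noteq> (False, False, False)}. P a h b) \<longleftrightarrow>
     P (False, True, False) (x_edge \<Phi> True False) (True, True, False) \<and>
     P (False, False, True) (x_edge \<Phi> False True) (True, False, True) \<and>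
     P (False, True, True) (x_edge \<Phi> True True) (True, True, True) \<and>
     P (True, False, False) (y_edge \<Phi> True False) (True, True, False) \<and>
     P (False, False, True) (y_edge \<Phi> False True) (False, True, True) \<and>
     P (True, False, True) (y_edge \<Phi> True True) (True, True, True) \<and>
     P (True, False, False) (z_edge \<Phi> True False) (True, False, True) \<and>
     P (False, True, False) (z_edge \<Phi> False True) (False, True, True) \<and>
     P (True, True, False) (z_edge \<Phi> True True) (True, True, True)" (is "?L \<longleftrightarrow> ?R")
proof
  show ?L if ?R
    by (clarsimp simp: cube_edges_def, elim disjE exE conjE)
      (use that in \<open>auto split: if_splits; metis (full_types)\<close>)+
  show ?R if ?L
    using that by (auto simp: cube_edges_def)
qed

lemma all_punctured_cube:
  "(\<forall>v \<in> UNIV - {(False, False, False)}. P v) \<longleftrightarrow>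
     P (True, False, False) \<and> P (False, True, False) \<and> P (False, False, True) \<and>
     P (True, True, False) \<and> P (True, False, True) \<and> P (False, True, True) \<and> P (True, True, True)"
  by (simp add: Ball_def split_paired_All all_bool_eq) blast

context cubes
begin

lemmas edge_simps = x_edge_def y_edge_def z_edge_def sq_end_def sq_comp_def

text \<open>A cone over the seven vertices of the punctured cube amounts to its values at the three vertices
  of depth one: the other values are composites, and the faces around the terminal vertex commute.\<close>

lemma limit_cube_iff:
  assumes \<Phi>: "cube f f' u u' g g' v v' p q p' q' \<in> E3"
  shows "limit_cube C (cube f f' u u' g g' v v' p q p' q') \<longleftrightarrow> punctured_limit C u' f' q g p' v (Dom C f) f u p"
    (is "limit_cube C ?\<Phi> \<longleftrightarrow> ?punctured_limit")
proof -
  note [simp] = E3_homs(1-28)[OF \<Phi>]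
  note e = E3_homs(29-34)[OF \<Phi>]
  let ?N = "UNIV - {(False, False, False)}" and ?K = "{(u, f, v) \<in> cube_edges ?\<Phi>. u \<noteq> (False, False, False)}"
  have diagram: "diagram C ?N (cube_vertex C ?\<Phi>) ?K"
    unfolding diagram_def all_punctured_cube all_cube_edges by (simp add: edge_simps)
  have ini: "cone C ?N (cube_vertex C ?\<Phi>) ?K (Dom C f) (initial_cone C ?\<Phi>)"
    unfolding cone_def all_punctured_cube all_cube_edges using e
    by (simp add: edge_simps Let_def assoc whisker[OF e(5)] whisker[OF e(6)])
  have cone_iff: "cone C ?N (cube_vertex C ?\<Phi>) ?K z \<zeta> \<longleftrightarrow> z \<in> Ob C \<and>
      \<zeta> (True, False, False) \<in> hom C z (Cod C f) \<and> \<zeta> (False, True, False) \<in> hom C z (Dom C f') \<and>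
      \<zeta> (False, False, True) \<in> hom C z (Dom C g) \<and>
      u' \<cdot> \<zeta> (True, False, False) = f' \<cdot> \<zeta> (False, True, False) \<and>
      q \<cdot> \<zeta> (True, False, False) = g \<cdot> \<zeta> (False, False, True) \<and>
      p' \<cdot> \<zeta> (False, True, False) = v \<cdot> \<zeta> (False, False, True) \<and>
      \<zeta> (True, True, False) = u' \<cdot> \<zeta> (True, False, False) \<and>
      \<zeta> (True, False, True) = q \<cdot> \<zeta> (True, False, False) \<and>
      \<zeta> (False, True, True) = p' \<cdot> \<zeta> (False, True, False) \<and>
      \<zeta> (True, True, True) = q' \<cdot> \<zeta> (True, True, False)" (is "?l \<longleftrightarrow> ?r") for z \<zeta>
  proof
    assume ?l then show ?r
      unfolding cone_def all_punctured_cube all_cube_edges by (simp add: edge_simps)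
  next
    assume r: ?r
    define l m k where "l = \<zeta> (True, False, False)" and "m = \<zeta> (False, True, False)" and "k = \<zeta> (False, False, True)"
    have lmk [simp]: "l \<in> Mor C" "m \<in> Mor C" "k \<in> Mor C" "Dom C l = z" "Dom C m = z" "Dom C k = z"
      "Cod C l = Cod C f" "Cod C m = Dom C f'" "Cod C k = Dom C g"
      and eq: "u' \<cdot> l = f' \<cdot> m" "q \<cdot> l = g \<cdot> k" "p' \<cdot> m = v \<cdot> k"
      using r by (simp_all add: l_def m_def k_def)
    have "g' \<cdot> (p' \<cdot> m) = q' \<cdot> (u' \<cdot> l)" "v' \<cdot> (q \<cdot> l) = q' \<cdot> (u' \<cdot> l)"
      using whisker[OF e(5), of m] whisker[OF e(6), of l] eq by simp_all
    then show ?l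
      using r eq unfolding cone_def all_punctured_cube all_cube_edges
      by (simp add: edge_simps flip: l_def m_def k_def)
  qed
  have v0: "cube_vertex C ?\<Phi> (False, False, False) = Dom C f"
    by (simp add: edge_simps)
  show ?thesis
  proof
    assume L: "limit_cube C ?\<Phi>"
    have uni: "\<exists>!h. h \<in> hom C z (Dom C f) \<and> (\<forall>v \<in> ?N. initial_cone C ?\<Phi> v \<cdot> h = \<zeta> v)"
      if "cone C ?N (cube_vertex C ?\<Phi>) ?K z \<zeta>" for z \<zeta>
      using L that unfolding limit_cube_def is_limit_def Let_def v0 by blast
    show ?punctured_limit
    proof (rule punctured_limitI)
      show "u' \<cdot> f = f' \<cdot> u" "q \<cdot> f = g \<cdot> p" "p' \<cdot> u = v \<cdot> p" using e by simp_all
    next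
      fix l m k assume a: "l \<in> Mor C" "m \<in> Mor C" "k \<in> Mor C" "Dom C l = Dom C k" "Dom C m = Dom C k"
        "Cod C l = Dom C u'" "Cod C m = Dom C f'" "Cod C k = Dom C g"
        and eq: "u' \<cdot> l = f' \<cdot> m" "q \<cdot> l = g \<cdot> k" "p' \<cdot> m = v \<cdot> k"
      define \<zeta> where "\<zeta> = (\<lambda>(x, y, z). if z then (if y then (if x then q' \<cdot> (u' \<cdot> l) else p' \<cdot> m) else if x then q \<cdot> l else k)
         else if y then (if x then u' \<cdot> l else m) else l)"
      have "cone C ?N (cube_vertex C ?\<Phi>) ?K (Dom C k) \<zeta>"
        unfolding cone_iff using a eq by (simp add: \<zeta>_def)
      then obtain h where "h \<in> hom C (Dom C k) (Dom C f)" "\<forall>v \<in> ?N. initial_cone C ?\<Phi> v \<cdot> h = \<zeta> v"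
        using uni by blast
      then show "\<exists>h. h \<in> Mor C \<and> Dom C h = Dom C k \<and> Cod C h = Dom C f \<and> f \<cdot> h = l \<and> u \<cdot> h = m \<and> p \<cdot> h = k"
        unfolding all_punctured_cube by (intro exI[of _ h]) (simp add: edge_simps \<zeta>_def Let_def)
    next
      fix x y assume xy: "x \<in> Mor C" "y \<in> Mor C" "Dom C x = Dom C y" "Cod C x = Dom C f" "Cod C y = Dom C f"
        and eq: "f \<cdot> x = f \<cdot> y" "u \<cdot> x = u \<cdot> y" "p \<cdot> x = p \<cdot> y"
      let ?\<zeta> = "\<lambda>v. initial_cone C ?\<Phi> v \<cdot> x"
      have w: "u' \<cdot> (f \<cdot> x) = f' \<cdot> (u \<cdot> x)" "q \<cdot> (f \<cdot> x) = g \<cdot> (p \<cdot> x)" "p' \<cdot> (u \<cdot> x) = v \<cdot> (p \<cdot> x)"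
        using whisker[OF e(1), of x] whisker[OF e(2), of x] whisker[OF e(3), of x] xy by simp_all
      have c: "cone C ?N (cube_vertex C ?\<Phi>) ?K (Dom C x) ?\<zeta>"
        unfolding cone_iff using xy(1-5) w e by (simp add: edge_simps Let_def assoc)
      have "\<exists>!h. h \<in> hom C (Dom C x) (Dom C f) \<and> (\<forall>v \<in> ?N. initial_cone C ?\<Phi> v \<cdot> h = ?\<zeta> v)"
        by (rule uni[OF c])
      moreover have "\<forall>v \<in> ?N. initial_cone C ?\<Phi> v \<cdot> y = ?\<zeta> v"
        unfolding all_punctured_cube using xy eq e by (simp add: edge_simps Let_def assoc)
      ultimately show "x = y" using xy by (metis mem_hom)
    qed simp_all
  next
    assume h: ?punctured_limit
    have "\<exists>!h. h \<in> hom C z (Dom C f) \<and> (\<forall>v \<in> ?N. initial_cone C ?\<Phi> v \<cdot> h = \<zeta> v)"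
      if c: "cone C ?N (cube_vertex C ?\<Phi>) ?K z \<zeta>" for z \<zeta>
    proof -
      note c' = c[unfolded cone_iff mem_hom]
      obtain d where d: "d \<in> Mor C" "Dom C d = z" "Cod C d = Dom C f" "f \<cdot> d = \<zeta> (True, False, False)"
        "u \<cdot> d = \<zeta> (False, True, False)" "p \<cdot> d = \<zeta> (False, False, True)"
        by (rule punctured_limit_lift[OF h, of "\<zeta> (True, False, False)" "\<zeta> (False, True, False)" "\<zeta> (False, False, True)"])
          (use c' in simp_all)
      show ?thesis
      proof (rule ex1I[of _ d])
        show "d \<in> hom C z (Dom C f) \<and> (\<forall>v \<in> ?N. initial_cone C ?\<Phi> v \<cdot> d = \<zeta> v)"
          unfolding all_punctured_cube using d c' by (simp add: edge_simps Let_def assoc)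
      next
        fix x assume x: "x \<in> hom C z (Dom C f) \<and> (\<forall>v \<in> ?N. initial_cone C ?\<Phi> v \<cdot> x = \<zeta> v)"
        then have fx: "f \<cdot> x = \<zeta> (True, False, False)" "u \<cdot> x = \<zeta> (False, True, False)" "p \<cdot> x = \<zeta> (False, False, True)"
          unfolding all_punctured_cube by (simp_all add: edge_simps Let_def)
        show "x = d" by (rule punctured_limit_eqI[OF h]) (use x d fx in simp_all)
      qed
    qed
    then show "limit_cube C ?\<Phi>"
      using diagram ini unfolding limit_cube_def is_limit_def Let_def v0 by blast
  qed
qed

end

section \<open>The tower\<close>

text \<open>Higher extensions are defined inside the iterated arrow categories of the base. As they are arrows
  of the category one level below, nothing changes if the arrow category is formed from that full
  subcategory instead.\<close>

lemma ext_cat_Suc: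
  assumes "higher_ext C0 (Suc k) \<subseteq> Mor (ext_cat C0 k)"
  shows "ext_cat C0 (Suc k) = ext_arrows (ext_cat C0 k) (higher_ext C0 (Suc k))"
  using assms unfolding ext_cat_def ext_arrows_def iterated_arrow_cat_def funpow.simps comp_def
  by (auto simp: full_sub_def arrow_cat_def commutative_square_def simp del: higher_ext.simps) 

lemma higher_ext_Suc_Suc:
  assumes "higher_ext C0 (Suc k) \<subseteq> Mor (ext_cat C0 k)"
  shows "higher_ext C0 (Suc (Suc k)) = double_exts (ext_cat C0 k) (higher_ext C0 (Suc k))"
proof -
  have "full_sub (iterated_arrow_cat C0 (Suc k)) (higher_ext C0 (Suc k)) = ext_arrows (ext_cat C0 k) (higher_ext C0 (Suc k))"
    using ext_cat_Suc[OF assms] unfolding ext_cat_def .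
  then show ?thesis
    unfolding higher_ext.simps(3) double_exts_def by (simp only: ext_cat_def)
qed

context three_levels
begin

text \<open>The swaps of the first two and of the last two directions generate all permutations of the directions. So each of the three
  pairs of opposite faces, in either orientation, occurs as domain and codomain of a cube of the form
  used in \<open>dfib\<close>.\<close>

lemma dfib_of_face:
  assumes \<Phi>: "\<Phi> \<in> E3" and lim: "limit_cube C \<Phi>"
    and face: "face \<in> {x_face \<Phi>, y_face \<Phi>, z_face \<Phi>}"
    and \<tau>\<beta>: "\<tau> = face False \<and> \<beta> = face True \<or> \<tau> = sq_transpose (face False) \<and> \<beta> = sq_transpose (face True)"
  shows "dfib \<tau> \<beta>"
proof -
  obtain \<tau>' \<beta>' t b where sq: "\<Phi> = Square \<tau>' \<beta>' t b" "Square \<tau>' \<beta>' t b \<in> E3"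
    by (rule D.E2E[OF \<Phi>])
  obtain f f' u u' where \<tau>': "\<tau>' = Square f f' u u'" by (rule E2E[OF D.E2_arrows(1)[OF sq(2)]])
  obtain g g' v v' where \<beta>': "\<beta>' = Square g g' v v'" by (rule E2E[OF D.E2_arrows(2)[OF sq(2)]])
  obtain p q p' q' where \<Phi>': "\<Phi> = cube f f' u u' g g' v v' p q p' q'"
    by (rule E3_cube[OF \<Phi>, of f f' u u' g g' v v']) (use sq \<tau>' \<beta>' in simp_all)
  note \<Phi>E = \<Phi>[unfolded \<Phi>']
  have h: "punctured_limit C u' f' q g p' v (Dom C f) f u p"
    using lim limit_cube_iff[OF \<Phi>E] \<Phi>' by simp
  have z: "dfib (Square f f' u u') (Square g g' v v')"
    by (rule dfibI[OF \<Phi>E h])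
  have y: "dfib (Square f g p q) (Square f' g' p' q')"
    by (rule dfibI[OF D.E2_swap[OF \<Phi>E] punctured_limit_swap_yz[OF h]])
  have x: "dfib (Square u v p p') (Square u' v' q q')"
    by (rule dfibI[OF D.E2_swap[OF E3_swap_xy[OF \<Phi>E]]])
      (use punctured_limit_swap_yz[OF punctured_limit_swap_xy[OF h]] E3_homs(13)[OF \<Phi>E] in simp)
  show ?thesis
    using face \<tau>\<beta> x y z dfib_swap[OF x] dfib_swap[OF y] dfib_swap[OF z]
    by (auto simp: \<Phi>' x_face_def y_face_def z_face_def edge_simps sq_transpose_def)
qed

lemma face_of_dfib:
  assumes "dfib \<tau> \<beta>"
  obtains \<Phi> where "\<Phi> \<in> E3" "limit_cube C \<Phi>" "\<tau> = z_face \<Phi> False" "\<beta> = z_face \<Phi> True"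
proof -
  obtain f f' u u' g g' v v' p q p' q' where "\<tau> = Square f f' u u'" "\<beta> = Square g g' v v'" and
    \<Phi>: "cube f f' u u' g g' v v' p q p' q' \<in> E3" and h: "punctured_limit C u' f' q g p' v (Dom C f) f u p"
    using assms unfolding dfib_def by blast
  then show thesis
    using that[OF \<Phi>] limit_cube_iff[OF \<Phi>] by (simp add: z_face_def edge_simps)
qed

end

theorem theorem6p4:
  fixes C\<^sub>0 :: "('o, 'm) cat"
    and \<Gamma> :: "nat \<Rightarrow> (('o, 'm) cell, ('o, 'm) cell) galois"
    and n :: nat
    and \<alpha> :: "('o, 'm) cell"
  assumes "barr_exact C\<^sub>0"
    and "birkhoff_tower C\<^sub>0 \<Gamma>"
    and "\<alpha> \<in> higher_ext C\<^sub>0 (n + 2)"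
  shows "covering (\<Gamma> (n + 1)) \<alpha> \<longleftrightarrow> symmetric_double_covering C\<^sub>0 \<Gamma> n \<alpha>"
proof -
  let ?C = "ext_cat C\<^sub>0 n" and ?E = "higher_ext C\<^sub>0 (Suc n)"
  have level: "birkhoff (ext_cat C\<^sub>0 k) (higher_ext C\<^sub>0 (Suc k)) (\<Gamma> k)" for k
    using assms(2) unfolding birkhoff_tower_def birkhoff_def by blast
  have ext_Mor: "higher_ext C\<^sub>0 (Suc k) \<subseteq> Mor (ext_cat C\<^sub>0 k)" for k
  proof -
    interpret birkhoff "ext_cat C\<^sub>0 k" "higher_ext C\<^sub>0 (Suc k)" "\<Gamma> k" by (rule level)
    show ?thesis using E_Mor by blast
  qed
  note cat_eq = ext_cat_Suc[OF ext_Mor] and ext_eq = higher_ext_Suc_Suc[OF ext_Mor]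
  have "three_levels ?C ?E (\<Gamma> n) (\<Gamma> (Suc n)) (\<Gamma> (Suc (Suc n)))"
    using level[of n] level[of "Suc n"] level[of "Suc (Suc n)"] assms(2)
    unfolding three_levels_def three_levels_axioms_def birkhoff_tower_def cat_eq ext_eq by blast
  then interpret three_levels ?C ?E "\<Gamma> n" "\<Gamma> (Suc n)" "\<Gamma> (Suc (Suc n))" .
  have E2: "higher_ext C\<^sub>0 (n + 2) = E2" and E3: "higher_ext C\<^sub>0 (n + 3) = E3"
  proof -
    have "n + 2 = Suc (Suc n)" "n + 3 = Suc (Suc (Suc n))" by simp_all
    then show "higher_ext C\<^sub>0 (n + 2) = E2" "higher_ext C\<^sub>0 (n + 3) = E3"
      by (simp_all only: ext_eq cat_eq)
  qed
  have fib: "dfib \<tau> \<beta>" if "discrete_fibration C\<^sub>0 n \<Phi> \<tau> \<beta>" for \<Phi> \<tau> \<beta>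
    using that dfib_of_face unfolding discrete_fibration_def E3 by blast
  have fibI: "\<exists>\<Phi>. discrete_fibration C\<^sub>0 n \<Phi> \<tau> \<beta>" if "dfib \<tau> \<beta>" for \<tau> \<beta>
    using face_of_dfib[OF that] unfolding discrete_fibration_def E3 by blast
  show ?thesis
  proof
    assume "covering (\<Gamma> (n + 1)) \<alpha>"
    then obtain \<omega> \<beta> where \<omega>: "dfib \<omega> \<alpha>" "dfib \<omega> \<beta>" and S: "Dom ?C (sq_dom \<beta>) \<in> S" "Cod ?C (sq_dom \<beta>) \<in> S"
      "Dom ?C (sq_cod \<beta>) \<in> S" "Cod ?C (sq_cod \<beta>) \<in> S"
      using dfib_of_covering[of \<alpha>] by auto
    have "\<omega> \<in> E2" using \<omega>(1) E3_arrows(1) unfolding dfib_def by blast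
    then show "symmetric_double_covering C\<^sub>0 \<Gamma> n \<alpha>"
      using assms(3) fibI[OF \<omega>(1)] fibI[OF \<omega>(2)] S
      unfolding symmetric_double_covering_def symmetrically_trivial_double_covering_def E2 by blast
  next
    assume "symmetric_double_covering C\<^sub>0 \<Gamma> n \<alpha>"
    then obtain \<Phi> \<tau> \<Psi> \<beta> where "discrete_fibration C\<^sub>0 n \<Phi> \<tau> \<alpha>" "discrete_fibration C\<^sub>0 n \<Psi> \<tau> \<beta>"
      and "Dom ?C (sq_dom \<beta>) \<in> S"
      unfolding symmetric_double_covering_def symmetrically_trivial_double_covering_def by blast
    then have "covering (\<Gamma> (Suc n)) \<alpha>"
      by (intro covering_of_dfib[OF fib trivial_of_dfib[OF fib]])
    then show "covering (\<Gamma> (n + 1)) \<alpha>" by simp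
  qed
qed

end
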